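(* Let $1\le p_1<\dots<p_n<\infty$ and $p\in[1,\infty)\setminus\{p_1,\dots,p_n\}$. Then neither $T^p$ nor $\ell_p$ coarse Lipschitz embeds into $T^{p_1}\oplus\dots\oplus T^{p_n}$. In particular, $T^p$ does not coarse Lipschitz embed into $T^q$ for all $p,q\in[1,\infty)$ with $p\ne q$.
   Context: $c_{00}$ is the space of eventually zero real sequences, $\|x\|_0=\max|x_n|$; for finite $E\subset\mathbb N$, $Ex$ is the restriction of $x$ to $E$; $E<F$ means $\max E<\min F$, $k\le E$ means $k\le\min E$. The Tsirelson space $T$ is the completion of $c_{00}$ under the unique norm with $\|x\|=\max\{\|x\|_0,\frac12\sup\sum_{j=1}^k\|E_jx\|\}$, sup over $k$ and finite sets $k\le E_1<\dots<E_k$. For $p\in[1,\infty)$, $T^p$ (the $p$-convexification) is the space of real sequences $(x_n)$ with $\sum|x_n|^pe_n\in T$, with norm $\|x\|_p=\|\sum|x_n|^pe_n\|_T^{1/p}$. A map $f$ between metric spaces is a coarse Lipschitz embedding if for some $L>0$, $\omega_f(t)\le Lt+L$ and $\rho_f(t)\ge L^{-1}t-L$ for all $t\ge0$, where $\omega_f(t)=\sup\{d(f(x),f(y)):d(x,y)\le t\}$, $\rho_f(t)=\inf\{d(f(x),f(y)):d(x,y)\ge t\}$. Finite direct sums carry any of the equivalent product norms. *)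

theory Defs
  imports "HOL-Analysis.Analysis"
begin

text \<open>Real sequences are functions nat => real; coordinate i (0-based) plays
the role of the natural number i+1 of the paper (N = {1,2,...}).\<close>

definition c00 :: "(nat \<Rightarrow> real) set" where
  "c00 = {x. finite {i. x i \<noteq> 0}}"

definition restr :: "nat set \<Rightarrow> (nat \<Rightarrow> real) \<Rightarrow> (nat \<Rightarrow> real)" where
  "restr E x = (\<lambda>i. if i \<in> E then x i else 0)"

definition supnorm0 :: "(nat \<Rightarrow> real) \<Rightarrow> real" where
  "supnorm0 x = Sup (range (\<lambda>i. \<bar>x i\<bar>))"

text \<open>Admissible families k <= E_1 < ... < E_k of finite nonempty sets
(indexed E 0, ..., E (k-1)); "k <= E_1" refers to 1-based positions.\<close>

definition admissible :: "nat \<Rightarrow> (nat \<Rightarrow> nat set) \<Rightarrow> bool" where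
  "admissible k E \<longleftrightarrow> 1 \<le> k \<and>
     (\<forall>j<k. finite (E j) \<and> E j \<noteq> {}) \<and>
     (\<forall>j. Suc j < k \<longrightarrow> Max (E j) < Min (E (Suc j))) \<and>
     k \<le> Suc (Min (E 0))"

definition is_norm_on_c00 :: "((nat \<Rightarrow> real) \<Rightarrow> real) \<Rightarrow> bool" where
  "is_norm_on_c00 f \<longleftrightarrow>
     (\<forall>x\<in>c00. f x \<ge> 0 \<and> (f x = 0 \<longleftrightarrow> x = (\<lambda>_. 0))) \<and>
     (\<forall>x\<in>c00. \<forall>c. f (\<lambda>i. c * x i) = \<bar>c\<bar> * f x) \<and>
     (\<forall>x\<in>c00. \<forall>y\<in>c00. f (\<lambda>i. x i + y i) \<le> f x + f y)"

definition tsirelson_eq :: "((nat \<Rightarrow> real) \<Rightarrow> real) \<Rightarrow> bool" where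
  "tsirelson_eq f \<longleftrightarrow> (\<forall>x\<in>c00. f x = max (supnorm0 x)
      ((1/2) * Sup {\<Sum>j<k. f (restr (E j) x) | k E. admissible k E}))"

text \<open>The Tsirelson norm on c00: the unique norm satisfying the implicit equation
(set to 0 off c00 to make it unique as a function).\<close>

definition tsirelson_norm :: "(nat \<Rightarrow> real) \<Rightarrow> real" where
  "tsirelson_norm = (THE f. is_norm_on_c00 f \<and> tsirelson_eq f \<and> (\<forall>x. x \<notin> c00 \<longrightarrow> f x = 0))"

section \<open>The Tsirelson space T as a sequence space (completion of c00)\<close>

definition trunc :: "nat \<Rightarrow> (nat \<Rightarrow> real) \<Rightarrow> (nat \<Rightarrow> real)" where
  "trunc m x = restr {..<m} x"

definition T_space :: "(nat \<Rightarrow> real) set" where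
  "T_space = {x. \<forall>\<epsilon>>0. \<exists>N. \<forall>m\<ge>N. \<forall>n\<ge>N.
      tsirelson_norm (\<lambda>i. trunc n x i - trunc m x i) < \<epsilon>}"

definition T_norm :: "(nat \<Rightarrow> real) \<Rightarrow> real" where
  "T_norm x = lim (\<lambda>m. tsirelson_norm (trunc m x))"

definition Tp :: "real \<Rightarrow> (nat \<Rightarrow> real) set" where
  "Tp p = {x. (\<lambda>i. \<bar>x i\<bar> powr p) \<in> T_space}"

definition Tp_norm :: "real \<Rightarrow> (nat \<Rightarrow> real) \<Rightarrow> real" where
  "Tp_norm p x = T_norm (\<lambda>i. \<bar>x i\<bar> powr p) powr (1/p)"

definition Tp_dist :: "real \<Rightarrow> (nat \<Rightarrow> real) \<Rightarrow> (nat \<Rightarrow> real) \<Rightarrow> real" where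
  "Tp_dist p x y = Tp_norm p (\<lambda>i. x i - y i)"

definition lp :: "real \<Rightarrow> (nat \<Rightarrow> real) set" where
  "lp p = {x. summable (\<lambda>i. \<bar>x i\<bar> powr p)}"

definition lp_dist :: "real \<Rightarrow> (nat \<Rightarrow> real) \<Rightarrow> (nat \<Rightarrow> real) \<Rightarrow> real" where
  "lp_dist p x y = (\<Sum>i. \<bar>x i - y i\<bar> powr p) powr (1/p)"

definition dsum :: "nat \<Rightarrow> (nat \<Rightarrow> real) \<Rightarrow> (nat \<Rightarrow> nat \<Rightarrow> real) set" where
  "dsum n ps = {x. (\<forall>i<n. x i \<in> Tp (ps i)) \<and> (\<forall>i\<ge>n. x i = (\<lambda>_. 0))}"

definition dsum_dist :: "nat \<Rightarrow> (nat \<Rightarrow> real) \<Rightarrow> (nat \<Rightarrow> nat \<Rightarrow> real) \<Rightarrow> (nat \<Rightarrow> nat \<Rightarrow> real) \<Rightarrow> real" where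
  "dsum_dist n ps x y = (\<Sum>i<n. Tp_dist (ps i) (x i) (y i))"

text \<open>omega_f(t) <= L t + L and rho_f(t) >= t/L - L for all t >= 0, with the
sup/inf unfolded.\<close>

definition coarse_lipschitz_embeds ::
  "'a set \<Rightarrow> ('a \<Rightarrow> 'a \<Rightarrow> real) \<Rightarrow> 'b set \<Rightarrow> ('b \<Rightarrow> 'b \<Rightarrow> real) \<Rightarrow> bool" where
  "coarse_lipschitz_embeds A dA B dB \<longleftrightarrow> (\<exists>f L. f ` A \<subseteq> B \<and> L > 0 \<and>
     (\<forall>t\<ge>0. \<forall>x\<in>A. \<forall>y\<in>A. dA x y \<le> t \<longrightarrow> dB (f x) (f y) \<le> L * t + L) \<and>
     (\<forall>t\<ge>0. \<forall>x\<in>A. \<forall>y\<in>A. dA x y \<ge> t \<longrightarrow> dB (f x) (f y) \<ge> t / L - L))"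

end

theory Submission
  imports Defs "HOL-Library.Function_Algebras"
begin

text \<open>
  Both \<open>\<ell>\<^sub>p\<close> and \<open>T\<^sup>p\<close> are \<open>p\<close>-convexifications of spaces normed by \<open>\<parallel>x\<parallel> = sup (\<Sum>i<M. \<phi> i * \<bar>x i\<bar>)\<close>, where \<open>\<phi>\<close>
  runs through a set \<open>K\<close> of weights with values in \<open>[0, 1]\<close>: the constant 1 for \<open>\<ell>\<^sub>p\<close>, the norming functionals
  of \<open>T\<close> for \<open>T\<^sup>p\<close>. In both cases \<open>K\<close> is stable under half sums over admissible families.

  Suppose \<open>g\<close> is a coarse Lipschitz embedding of such a space with exponent \<open>p\<close> into the direct sum, and
  consider the points \<open>x + \<tau> * k powr (-1/p) * (e n\<^sub>1 + \<dots> + e n\<^sub>k)\<close>, whose mutual distances are of order \<open>\<tau>\<close>.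

  In the components with \<open>p\<^sub>i > p\<close>, disjointly supported vectors satisfy an upper \<open>p\<^sub>i\<close>-estimate. Taking
  limits of the coordinates along an ultrafilter in \<open>n\<^sub>k\<close>, \<dots>, \<open>n\<^sub>1\<close> one after the other (as in the graph
  argument of Kalton and Randrianarivony), most image points lie within a multiple of
  \<open>k powr (1/p\<^sub>i - 1/p) * \<tau>\<close> of one point, which is negligible against \<open>\<tau>\<close> for large \<open>k\<close>.

  In the components with \<open>p\<^sub>i < p\<close>, any \<open>N\<close> successive blocks of norm at least \<open>a\<close> in the space before
  convexification have a sum of norm at least \<open>N * a / 4\<close>. This weak-type inequality yields an equivalent
  norm \<open>\<rho>\<close> with \<open>\<rho>(u + v) powr q \<ge> \<rho>(u) powr q + \<rho>(v) powr q\<close> for successive \<open>u\<close>, \<open>v\<close>, where \<open>p\<^sub>i < q < p\<close>. If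
  \<open>x\<close> is the midpoint of a pair at which the asymptotic Lipschitz constant of \<open>g\<close> is nearly attained, the
  points above are approximate midpoints. In the target, approximate midpoints lie near a
  finite-dimensional set up to an error small compared to \<open>\<tau>\<close>, because \<open>q < p\<close>. So these components
  collapse as well, and the lower bound for \<open>g\<close> is violated.
\<close>

section \<open>Seminorms\<close>

instantiation "fun" :: (type, real_vector) real_vector
begin

definition scaleR_fun :: "real \<Rightarrow> ('a \<Rightarrow> 'b) \<Rightarrow> 'a \<Rightarrow> 'b" where
  "scaleR_fun c f = (\<lambda>x. c *\<^sub>R f x)"

instance
  by standard (simp_all add: scaleR_fun_def fun_eq_iff scaleR_add_right scaleR_add_left)

end

lemma scaleR_fun_apply [simp]: "(c *\<^sub>R f) x = c *\<^sub>R f x"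
  by (simp add: scaleR_fun_def)

locale seminorm_on =
  fixes V :: "'a::real_vector set" and N :: "'a \<Rightarrow> real"
  assumes subspace: "subspace V"
    and triangle: "x \<in> V \<Longrightarrow> y \<in> V \<Longrightarrow> N (x + y) \<le> N x + N y"
    and scaleR: "x \<in> V \<Longrightarrow> N (c *\<^sub>R x) = \<bar>c\<bar> * N x"
begin

lemmas mem_0 = subspace_0[OF subspace]
lemmas mem_add = subspace_add[OF subspace]
lemmas mem_diff = subspace_diff[OF subspace]
lemmas mem_scaleR = subspace_scale[OF subspace]
lemmas mem_uminus = subspace_neg[OF subspace]

lemma zero: "N 0 = 0"
  using scaleR[OF mem_0, of 0] by simp

lemma uminus: "x \<in> V \<Longrightarrow> N (- x) = N x"
  using scaleR[of x "- 1"] by simp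

lemma nonneg: "x \<in> V \<Longrightarrow> 0 \<le> N x"
  using triangle[of x "- x"] by (simp add: mem_uminus uminus zero)

lemma triangle_diff: "x \<in> V \<Longrightarrow> y \<in> V \<Longrightarrow> N (x - y) \<le> N x + N y"
  using triangle[of x "- y"] by (simp add: mem_uminus uminus)

lemma le_add_diff: "x \<in> V \<Longrightarrow> y \<in> V \<Longrightarrow> N x \<le> N y + N (x - y)"
  using triangle[of y "x - y"] by (simp add: mem_diff)

lemma triangle_center: "x \<in> V \<Longrightarrow> y \<in> V \<Longrightarrow> c \<in> V \<Longrightarrow> N (x - y) \<le> N (x - c) + N (y - c)"
  using triangle_diff[of "x - c" "y - c"] by (simp add: mem_diff)

end

lemma seminorm_onI:
  assumes "subspace V"
    and triangle: "\<And>x y. x \<in> V \<Longrightarrow> y \<in> V \<Longrightarrow> N (x + y) \<le> N x + N y"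
    and scaleR: "\<And>c x. x \<in> V \<Longrightarrow> N (c *\<^sub>R x) \<le> \<bar>c\<bar> * N x"
  shows "seminorm_on V N"
proof
  fix x c assume x_mem: "x \<in> V"
  show "N (c *\<^sub>R x) = \<bar>c\<bar> * N x"
  proof (cases "c = 0")
    case True
    then show ?thesis using scaleR[OF x_mem, of 0] triangle[of 0 0] subspace_0[OF assms(1)] by simp
  next
    case False
    have "N (inverse c *\<^sub>R c *\<^sub>R x) \<le> \<bar>inverse c\<bar> * N (c *\<^sub>R x)"
      by (rule scaleR[OF subspace_scale[OF assms(1) x_mem]])
    then have "\<bar>c\<bar> * N x \<le> N (c *\<^sub>R x)" using False by (simp add: field_simps abs_inverse)
    then show ?thesis using scaleR[OF x_mem, of c] by simp
  qed
qed (use assms in auto)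

lemma seminorm_on_cong:
  assumes "seminorm_on V N" "\<And>x. x \<in> V \<Longrightarrow> N' x = N x"
  shows "seminorm_on V N'"
  using assms unfolding seminorm_on_def by (simp add: subspace_add subspace_scale)

lemma seminorm_on_abs_component: "seminorm_on UNIV (\<lambda>x. \<bar>x i :: real\<bar>)"
  by standard (auto simp: abs_mult)

lemma seminorm_on_direct_sum:
  assumes "\<And>i. i \<in> I \<Longrightarrow> seminorm_on (V i) (N i)"
  shows "seminorm_on {y. \<forall>i\<in>I. y i \<in> V i} (\<lambda>y. \<Sum>i\<in>I. N i (y i))"
proof
  show "subspace {y. \<forall>i\<in>I. y i \<in> V i}"
    using assms by (simp add: subspace_def seminorm_on_def)
qed (use assms in \<open>auto simp: seminorm_on_def sum_distrib_left simp flip: sum.distrib intro!: sum_mono\<close>)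

lemma convex_on_powr_nonneg:
  fixes q :: real
  assumes "1 \<le> q"
  shows "convex_on {0..} (\<lambda>x. x powr q)"
proof (rule convex_onI)
  have scale: "(t * z) powr q \<le> t * z powr q" if "0 < t" "t < 1" "0 \<le> z" for t z :: real
    using powr_mono'[of 1 q t] that assms by (simp add: powr_mult mult_right_mono)
  fix t x y :: real assume t_bounds: "0 < t" "t < 1" and xy_nonneg: "x \<in> {0..}" "y \<in> {0..}"
  show "((1 - t) *\<^sub>R x + t *\<^sub>R y) powr q \<le> (1 - t) * x powr q + t * y powr q"
  proof (cases "x = 0 \<or> y = 0")
    case True
    then show ?thesis using scale[of t y] scale[of "1 - t" x] t_bounds xy_nonneg by auto
  next
    case False
    then show ?thesis using convex_onD[OF powr_convex[OF assms], of t x y] t_bounds xy_nonneg by auto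
  qed
qed (rule convex_real_interval)

lemma powr_add_le_convex:
  fixes x y A B q :: real
  assumes "0 \<le> x" "0 \<le> y" "0 < A" "0 < B" "1 \<le> q"
  shows "(x + y) powr q \<le> (A + B) powr q * (A / (A + B) * (x / A) powr q + B / (A + B) * (y / B) powr q)"
proof -
  define t where "t = B / (A + B)"
  have t_weights: "0 \<le> t" "t \<le> 1" "1 - t = A / (A + B)" using assms by (auto simp: t_def field_simps)
  have "x + y = (A + B) * ((1 - t) * (x / A) + t * (y / B))"
    unfolding t_weights(3) using assms by (simp add: t_def distrib_left)
  then have "(x + y) powr q = (A + B) powr q * ((1 - t) * (x / A) + t * (y / B)) powr q"
    using assms t_weights by (simp add: powr_mult)
  also have "\<dots> \<le> (A + B) powr q * ((1 - t) * (x / A) powr q + t * (y / B) powr q)"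
    using convex_onD[OF convex_on_powr_nonneg[OF assms(5)], of t "x / A" "y / B"] t_weights(1,2) assms
    by (intro mult_left_mono) auto
  finally show ?thesis unfolding t_weights(3) unfolding t_def .
qed

lemma powr_le_powr_imp_le:
  fixes a b p :: real
  assumes "a powr p \<le> b powr p" "0 < p" "0 \<le> b"
  shows "a \<le> b"
  using assms powr_less_mono2[of p b a] by (meson not_le)

lemma Minkowski_sum_powr:
  fixes w a b :: "'i \<Rightarrow> real"
  assumes p_ge_1: "1 \<le> p" and nonneg: "\<And>j. j \<in> S \<Longrightarrow> 0 \<le> w j" "\<And>j. j \<in> S \<Longrightarrow> 0 \<le> a j" "\<And>j. j \<in> S \<Longrightarrow> 0 \<le> b j"
  shows "(\<Sum>j\<in>S. w j * (a j + b j) powr p) powr (1 / p)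
    \<le> (\<Sum>j\<in>S. w j * a j powr p) powr (1 / p) + (\<Sum>j\<in>S. w j * b j powr p) powr (1 / p)"
    (is "?AB \<le> ?A + ?B")
proof (rule field_le_epsilon)
  fix e :: real assume e_pos: "0 < e"
  define A B where "A = ?A + e / 2" and "B = ?B + e / 2"
  have AB_pos: "0 < A" "0 < B" using e_pos by (auto simp: A_def B_def add_nonneg_pos)
  have root_le: "(\<Sum>j\<in>S. w j * c j powr p) \<le> C powr p"
    if "(\<Sum>j\<in>S. w j * c j powr p) powr (1 / p) \<le> C" for c C
  proof -
    have "(\<Sum>j\<in>S. w j * c j powr p) = ((\<Sum>j\<in>S. w j * c j powr p) powr (1 / p)) powr p"
      using p_ge_1 nonneg(1) by (simp add: powr_powr sum_nonneg)
    also have "\<dots> \<le> C powr p" using that p_ge_1 by (intro powr_mono2) auto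
    finally show ?thesis .
  qed
  have sums_le: "(\<Sum>j\<in>S. w j * a j powr p) \<le> A powr p" "(\<Sum>j\<in>S. w j * b j powr p) \<le> B powr p"
    using e_pos by (auto simp: A_def B_def intro: root_le)
  have "(\<Sum>j\<in>S. w j * (a j + b j) powr p) \<le> (\<Sum>j\<in>S. w j * ((A + B) powr p *
      (A / (A + B) / A powr p * a j powr p + B / (A + B) / B powr p * b j powr p)))"
    using powr_add_le_convex[OF nonneg(2,3) AB_pos p_ge_1] AB_pos nonneg(1)
    by (intro sum_mono mult_left_mono) (auto simp: powr_divide)
  also have "\<dots> = (A + B) powr p * (A / (A + B) / A powr p * (\<Sum>j\<in>S. w j * a j powr p)
      + B / (A + B) / B powr p * (\<Sum>j\<in>S. w j * b j powr p))"
    by (simp add: sum_distrib_left sum.distrib distrib_left mult_ac)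
  also have "\<dots> \<le> (A + B) powr p * (A / (A + B) / A powr p * A powr p + B / (A + B) / B powr p * B powr p)"
    using AB_pos by (intro mult_left_mono add_mono sums_le) auto
  also have "\<dots> = (A + B) powr p" using AB_pos by (simp flip: add_divide_distrib)
  finally have "?AB \<le> ((A + B) powr p) powr (1 / p)"
    using p_ge_1 nonneg(1) by (intro powr_mono2) (auto intro: sum_nonneg)
  then show "?AB \<le> ?A + ?B + e" using p_ge_1 AB_pos by (simp add: powr_powr A_def B_def)
qed

lemma seminorm_on_powr_sum:
  assumes p_ge_1: "1 \<le> p" and V_subspace: "subspace V" and w_nonneg: "\<And>j. j \<in> S \<Longrightarrow> 0 \<le> w j"
    and N_seminorm: "\<And>j. j \<in> S \<Longrightarrow> seminorm_on V (N j)"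
  shows "seminorm_on V (\<lambda>x. (\<Sum>j\<in>S. w j * N j x powr p) powr (1 / p))"
proof (rule seminorm_onI[OF V_subspace])
  note nonneg = seminorm_on.nonneg[OF N_seminorm]
  show "(\<Sum>j\<in>S. w j * N j (x + y) powr p) powr (1 / p)
      \<le> (\<Sum>j\<in>S. w j * N j x powr p) powr (1 / p) + (\<Sum>j\<in>S. w j * N j y powr p) powr (1 / p)"
    if x_mem: "x \<in> V" and y_mem: "y \<in> V" for x y
  proof -
    have "(\<Sum>j\<in>S. w j * N j (x + y) powr p) powr (1 / p) \<le> (\<Sum>j\<in>S. w j * (N j x + N j y) powr p) powr (1 / p)"
      using p_ge_1 w_nonneg nonneg[OF _ subspace_add[OF V_subspace x_mem y_mem]]
        seminorm_on.triangle[OF N_seminorm x_mem y_mem]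
      by (intro powr_mono2 sum_mono mult_left_mono sum_nonneg) auto
    also have "\<dots> \<le> (\<Sum>j\<in>S. w j * N j x powr p) powr (1 / p) + (\<Sum>j\<in>S. w j * N j y powr p) powr (1 / p)"
      using w_nonneg nonneg x_mem y_mem by (intro Minkowski_sum_powr[OF p_ge_1])
    finally show ?thesis .
  qed
  show "(\<Sum>j\<in>S. w j * N j (c *\<^sub>R x) powr p) powr (1 / p) \<le> \<bar>c\<bar> * (\<Sum>j\<in>S. w j * N j x powr p) powr (1 / p)"
    if x_mem: "x \<in> V" for c x
  proof -
    have "(\<Sum>j\<in>S. w j * N j (c *\<^sub>R x) powr p) = \<bar>c\<bar> powr p * (\<Sum>j\<in>S. w j * N j x powr p)"
      by (simp add: seminorm_on.scaleR[OF N_seminorm x_mem] powr_mult sum_distrib_left mult_ac)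
    then show ?thesis using p_ge_1 by (simp add: powr_mult powr_powr)
  qed
qed

lemma seminorm_on_SUP:
  assumes "A \<noteq> {}" and N_seminorm: "\<And>a. a \<in> A \<Longrightarrow> seminorm_on V (N a)"
  shows "seminorm_on {x \<in> V. bdd_above ((\<lambda>a. N a x) ` A)} (\<lambda>x. SUP a\<in>A. N a x)"
    (is "seminorm_on ?W ?N")
proof (rule seminorm_onI)
  have le_SUP: "N a x \<le> ?N x" if "a \<in> A" "x \<in> ?W" for a x
    using that by (intro cSUP_upper) auto
  have add_le: "N a (x + y) \<le> ?N x + ?N y" if "a \<in> A" "x \<in> ?W" "y \<in> ?W" for a x y
    using seminorm_on.triangle[OF N_seminorm[OF that(1)], of x y] le_SUP[OF that(1,2)]
      le_SUP[OF that(1,3)] that by auto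
  have scaleR_le: "N a (c *\<^sub>R x) \<le> \<bar>c\<bar> * ?N x" if "a \<in> A" "x \<in> ?W" for a c x
    using seminorm_on.scaleR[OF N_seminorm[OF that(1)], of x c] le_SUP[OF that] that
    by (simp add: mult_left_mono)
  have V_subspace: "subspace V" using assms seminorm_on.subspace by blast
  have "(\<lambda>a. N a 0) ` A \<subseteq> {0}" using seminorm_on.zero[OF N_seminorm] by auto
  then have "bdd_above ((\<lambda>a. N a 0) ` A)" by (rule bdd_above_mono[rotated]) simp
  moreover have "bdd_above ((\<lambda>a. N a (x + y)) ` A)" if "x \<in> ?W" "y \<in> ?W" for x y
    by (rule bdd_aboveI2) (rule add_le[OF _ that])
  moreover have "bdd_above ((\<lambda>a. N a (c *\<^sub>R x)) ` A)" if "x \<in> ?W" for c x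
    by (rule bdd_aboveI2) (rule scaleR_le[OF _ that])
  ultimately show "subspace ?W"
    using V_subspace unfolding subspace_def by simp
  show "?N (x + y) \<le> ?N x + ?N y" if "x \<in> ?W" "y \<in> ?W" for x y
    using assms(1) add_le that by (intro cSUP_least)
  show "?N (c *\<^sub>R x) \<le> \<bar>c\<bar> * ?N x" if "x \<in> ?W" for c x
    using assms(1) scaleR_le that by (intro cSUP_least)
qed

section \<open>Spaces normed by a set of weights\<close>

definition wsum :: "(nat \<Rightarrow> real) \<Rightarrow> nat \<Rightarrow> (nat \<Rightarrow> real) \<Rightarrow> real" where
  "wsum \<phi> M x = (\<Sum>i<M. \<phi> i * \<bar>x i\<bar>)"

definition wspace :: "(nat \<Rightarrow> real) set \<Rightarrow> (nat \<Rightarrow> real) set" where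
  "wspace K = {x. bdd_above ((\<lambda>(\<phi>, M). wsum \<phi> M x) ` (K \<times> UNIV))}"

definition wnorm :: "(nat \<Rightarrow> real) set \<Rightarrow> (nat \<Rightarrow> real) \<Rightarrow> real" where
  "wnorm K x = (SUP (\<phi>, M)\<in>K \<times> UNIV. wsum \<phi> M x)"

definition abs_powr :: "real \<Rightarrow> (nat \<Rightarrow> real) \<Rightarrow> nat \<Rightarrow> real" where
  "abs_powr p x = (\<lambda>i. \<bar>x i\<bar> powr p)"

definition pspace :: "(nat \<Rightarrow> real) set \<Rightarrow> real \<Rightarrow> (nat \<Rightarrow> real) set" where
  "pspace K p = {x. abs_powr p x \<in> wspace K}"

definition pnorm :: "(nat \<Rightarrow> real) set \<Rightarrow> real \<Rightarrow> (nat \<Rightarrow> real) \<Rightarrow> real" where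
  "pnorm K p x = wnorm K (abs_powr p x) powr (1 / p)"

lemma abs_powr_apply [simp]: "abs_powr p x i = \<bar>x i\<bar> powr p"
  by (simp add: abs_powr_def)

lemma abs_powr_restr [simp]: "abs_powr p (restr E x) = restr E (abs_powr p x)"
  by (auto simp: restr_def)

lemma abs_powr_indicator [simp]: "abs_powr p (indicator A) = indicator A"
  by (auto simp: indicator_def)

lemma restr_restr [simp]: "restr A (restr B x) = restr (A \<inter> B) x"
  by (auto simp: restr_def)

lemma restr_UNIV [simp]: "restr UNIV x = x"
  by (simp add: restr_def)

lemma wsum_restr: "wsum \<phi> M (restr E x) = (\<Sum>i<M. restr E \<phi> i * \<bar>x i\<bar>)"
  unfolding wsum_def restr_def by (intro sum.cong) auto

lemma pnorm_nonneg [simp]: "0 \<le> pnorm K p x"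
  by (simp add: pnorm_def)

lemma cSUP_powr:
  fixes f :: "'a \<Rightarrow> real"
  assumes A_bdd: "A \<noteq> {}" "bdd_above (f ` A)" and f_nonneg: "\<And>a. a \<in> A \<Longrightarrow> 0 \<le> f a" and r_pos: "0 < r"
  shows "(SUP a\<in>A. f a powr r) = (SUP a\<in>A. f a) powr r"
proof (rule antisym)
  have powr_le: "f a powr r \<le> (SUP a\<in>A. f a) powr r" if "a \<in> A" for a
    using that f_nonneg r_pos by (intro powr_mono2 cSUP_upper A_bdd) auto
  show "(SUP a\<in>A. f a powr r) \<le> (SUP a\<in>A. f a) powr r"
    using A_bdd(1) powr_le by (rule cSUP_least)
  have bdd: "bdd_above ((\<lambda>a. f a powr r) ` A)"
    using powr_le by (rule bdd_aboveI2)
  have "f a \<le> (SUP a\<in>A. f a powr r) powr (1 / r)" if "a \<in> A" for a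
  proof -
    have "f a = (f a powr r) powr (1 / r)" using f_nonneg[OF that] r_pos by (simp add: powr_powr)
    also have "\<dots> \<le> (SUP a\<in>A. f a powr r) powr (1 / r)"
      using that r_pos by (intro powr_mono2 cSUP_upper bdd) auto
    finally show ?thesis .
  qed
  then have "(SUP a\<in>A. f a) \<le> (SUP a\<in>A. f a powr r) powr (1 / r)"
    by (rule cSUP_least[OF A_bdd(1)])
  moreover have "0 \<le> (SUP a\<in>A. f a powr r)"
    using A_bdd(1) by (auto intro: order_trans[OF _ cSUP_upper[OF _ bdd]])
  moreover have "0 \<le> (SUP a\<in>A. f a)"
    using A_bdd f_nonneg by (auto intro: order_trans[OF _ cSUP_upper])
  ultimately have "(SUP a\<in>A. f a) powr r \<le> ((SUP a\<in>A. f a powr r) powr (1 / r)) powr r"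
    using r_pos by (intro powr_mono2) auto
  then show "(SUP a\<in>A. f a) powr r \<le> (SUP a\<in>A. f a powr r)"
    using r_pos \<open>0 \<le> (SUP a\<in>A. f a powr r)\<close> by (simp add: powr_powr)
qed

lemma bdd_above_powr_iff:
  fixes f :: "'a \<Rightarrow> real"
  assumes f_nonneg: "\<And>a. a \<in> A \<Longrightarrow> 0 \<le> f a" and r_pos: "0 < r"
  shows "bdd_above ((\<lambda>a. f a powr r) ` A) \<longleftrightarrow> bdd_above (f ` A)"
proof
  assume "bdd_above ((\<lambda>a. f a powr r) ` A)"
  then obtain B where le_B: "\<And>a. a \<in> A \<Longrightarrow> f a powr r \<le> B" by (auto simp: bdd_above_def)
  have "f a \<le> B powr (1 / r)" if "a \<in> A" for a
  proof -
    have "f a = (f a powr r) powr (1 / r)" using f_nonneg[OF that] r_pos by (simp add: powr_powr)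
    also have "\<dots> \<le> B powr (1 / r)" using le_B[OF that] r_pos by (intro powr_mono2) auto
    finally show ?thesis .
  qed
  then show "bdd_above (f ` A)" by (rule bdd_aboveI2)
next
  assume "bdd_above (f ` A)"
  then obtain B where "\<And>a. a \<in> A \<Longrightarrow> f a \<le> B" by (auto simp: bdd_above_def)
  then have "f a powr r \<le> B powr r" if "a \<in> A" for a
    using that f_nonneg r_pos by (intro powr_mono2) auto
  then show "bdd_above ((\<lambda>a. f a powr r) ` A)" by (rule bdd_aboveI2)
qed

locale weights =
  fixes K :: "(nat \<Rightarrow> real) set"
  assumes K_nonneg: "\<phi> \<in> K \<Longrightarrow> 0 \<le> \<phi> i"
    and K_le_one: "\<phi> \<in> K \<Longrightarrow> \<phi> i \<le> 1"
    and K_unit: "\<exists>\<phi>\<in>K. \<phi> i = 1"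
begin

lemma K_nonempty: "K \<noteq> {}"
  using K_unit by blast

lemma wsum_nonneg: "\<phi> \<in> K \<Longrightarrow> 0 \<le> wsum \<phi> M x"
  unfolding wsum_def by (intro sum_nonneg) (simp add: K_nonneg)

lemma wsum_mono: "\<phi> \<in> K \<Longrightarrow> (\<And>i. \<bar>x i\<bar> \<le> \<bar>y i\<bar>) \<Longrightarrow> wsum \<phi> M x \<le> wsum \<phi> M y"
  unfolding wsum_def by (intro sum_mono mult_left_mono) (auto simp: K_nonneg)

lemma wsum_mono_length: "\<phi> \<in> K \<Longrightarrow> M \<le> M' \<Longrightarrow> wsum \<phi> M x \<le> wsum \<phi> M' x"
  unfolding wsum_def by (intro sum_mono2) (auto simp: K_nonneg)

lemma wspaceI: "(\<And>\<phi> M. \<phi> \<in> K \<Longrightarrow> wsum \<phi> M x \<le> A) \<Longrightarrow> x \<in> wspace K"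
  by (auto simp: wspace_def intro!: bdd_aboveI2[where M = A])

lemma wsum_le_wnorm: "x \<in> wspace K \<Longrightarrow> \<phi> \<in> K \<Longrightarrow> wsum \<phi> M x \<le> wnorm K x"
  unfolding wnorm_def wspace_def
  using cSUP_upper[of "(\<phi>, M)" "K \<times> UNIV" "\<lambda>(\<phi>, M). wsum \<phi> M x"] by simp

lemma wnorm_least: "(\<And>\<phi> M. \<phi> \<in> K \<Longrightarrow> wsum \<phi> M x \<le> A) \<Longrightarrow> wnorm K x \<le> A"
  unfolding wnorm_def using K_nonempty by (intro cSUP_least) auto

lemma less_wnormE:
  assumes "c < wnorm K x"
  obtains \<phi> M where "\<phi> \<in> K" "c < wsum \<phi> M x"
  using wnorm_least[of x c] assms by (meson not_le)

lemma wnorm_nonneg: "x \<in> wspace K \<Longrightarrow> 0 \<le> wnorm K x"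
  using wsum_le_wnorm wsum_nonneg K_nonempty by (meson all_not_in_conv order_trans)

lemma wspace_mono: "y \<in> wspace K \<Longrightarrow> (\<And>i. \<bar>x i\<bar> \<le> \<bar>y i\<bar>) \<Longrightarrow> x \<in> wspace K"
  by (rule wspaceI[where A = "wnorm K y"]) (blast intro: order_trans wsum_mono wsum_le_wnorm)

lemma wnorm_mono: "y \<in> wspace K \<Longrightarrow> (\<And>i. \<bar>x i\<bar> \<le> \<bar>y i\<bar>) \<Longrightarrow> wnorm K x \<le> wnorm K y"
  by (rule wnorm_least) (blast intro: order_trans wsum_mono wsum_le_wnorm)

lemma wspace_restr: "x \<in> wspace K \<Longrightarrow> restr E x \<in> wspace K"
  by (erule wspace_mono) (simp add: restr_def)

lemma abs_le_wnorm:
  assumes "x \<in> wspace K"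
  shows "\<bar>x i\<bar> \<le> wnorm K x"
proof -
  obtain \<phi> where \<phi>_unit: "\<phi> \<in> K" "\<phi> i = 1" using K_unit by blast
  have "\<bar>x i\<bar> = \<phi> i * \<bar>x i\<bar>" using \<phi>_unit by simp
  also have "\<dots> \<le> wsum \<phi> (Suc i) x"
    unfolding wsum_def using \<phi>_unit
    by (intro member_le_sum[where f = "\<lambda>i. \<phi> i * \<bar>x i\<bar>"]) (auto simp: K_nonneg)
  also have "\<dots> \<le> wnorm K x" by (rule wsum_le_wnorm[OF assms \<phi>_unit(1)])
  finally show ?thesis .
qed

lemma wsum_le_sum_support:
  assumes "\<phi> \<in> K" "finite A" "\<And>i. i \<notin> A \<Longrightarrow> x i = 0"
  shows "wsum \<phi> M x \<le> (\<Sum>i\<in>A. \<bar>x i\<bar>)"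
proof -
  have "wsum \<phi> M x \<le> (\<Sum>i<M. \<bar>x i\<bar>)"
    unfolding wsum_def using K_le_one[OF assms(1)] K_nonneg[OF assms(1)]
    by (intro sum_mono) (simp add: mult_left_le_one_le)
  also have "\<dots> = (\<Sum>i\<in>A \<inter> {..<M}. \<bar>x i\<bar>)"
    using assms by (intro sum.mono_neutral_right) auto
  also have "\<dots> \<le> (\<Sum>i\<in>A. \<bar>x i\<bar>)"
    using assms by (intro sum_mono2) auto
  finally show ?thesis .
qed

lemma wspace_finite_support: "finite A \<Longrightarrow> (\<And>i. i \<notin> A \<Longrightarrow> x i = 0) \<Longrightarrow> x \<in> wspace K"
  by (rule wspaceI, rule wsum_le_sum_support)

lemma wnorm_le_sum_support: "finite A \<Longrightarrow> (\<And>i. i \<notin> A \<Longrightarrow> x i = 0) \<Longrightarrow> wnorm K x \<le> (\<Sum>i\<in>A. \<bar>x i\<bar>)"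
  by (rule wnorm_least, rule wsum_le_sum_support)

lemma wspace_indicator: "finite A \<Longrightarrow> indicator A \<in> wspace K"
  by (rule wspace_finite_support[of A]) auto

lemma pspace_mono: "y \<in> pspace K p \<Longrightarrow> 0 \<le> p \<Longrightarrow> (\<And>i. \<bar>x i\<bar> \<le> \<bar>y i\<bar>) \<Longrightarrow> x \<in> pspace K p"
  unfolding pspace_def mem_Collect_eq by (erule wspace_mono) (auto intro: powr_mono2)

lemma pnorm_mono:
  assumes "y \<in> pspace K p" "0 < p" "\<And>i. \<bar>x i\<bar> \<le> \<bar>y i\<bar>"
  shows "pnorm K p x \<le> pnorm K p y"
  unfolding pnorm_def
proof (intro powr_mono2 wnorm_mono wnorm_nonneg)
  show "abs_powr p x \<in> wspace K"
    using pspace_mono[OF assms(1) _ assms(3)] assms(2) by (simp add: pspace_def)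
qed (use assms in \<open>auto simp: pspace_def intro: powr_mono2\<close>)

lemma pspace_restr: "x \<in> pspace K p \<Longrightarrow> restr E x \<in> pspace K p"
  by (simp add: pspace_def wspace_restr)

lemma pnorm_restr_le: "x \<in> pspace K p \<Longrightarrow> 0 < p \<Longrightarrow> pnorm K p (restr E x) \<le> pnorm K p x"
  by (rule pnorm_mono) (auto simp: restr_def)

lemma pspace_finite_support: "finite A \<Longrightarrow> (\<And>i. i \<notin> A \<Longrightarrow> x i = 0) \<Longrightarrow> x \<in> pspace K p"
  unfolding pspace_def mem_Collect_eq by (rule wspace_finite_support[of A]) auto

lemma pspace_indicator: "finite A \<Longrightarrow> indicator A \<in> pspace K p"
  by (simp add: pspace_def wspace_indicator)

lemma pnorm_indicator_le:
  assumes "finite A" "0 < p"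
  shows "pnorm K p (indicator A) \<le> real (card A) powr (1 / p)"
proof -
  have "wnorm K (indicator A) \<le> real (card A)"
    using wnorm_le_sum_support[of A "indicator A"] assms by simp
  then show ?thesis
    unfolding pnorm_def using assms by (auto intro!: powr_mono2 wnorm_nonneg wspace_indicator)
qed

lemma pnorm_powr: "x \<in> pspace K p \<Longrightarrow> 0 < p \<Longrightarrow> pnorm K p x powr p = wnorm K (abs_powr p x)"
  by (simp add: pnorm_def pspace_def powr_powr wnorm_nonneg)

lemma wsum_abs_powr_le:
  assumes "x \<in> pspace K p" "0 < p" "pnorm K p x \<le> A" "\<phi> \<in> K"
  shows "wsum \<phi> M (abs_powr p x) \<le> A powr p"
proof -
  have "wsum \<phi> M (abs_powr p x) \<le> pnorm K p x powr p"
    using assms by (simp add: pnorm_powr pspace_def wsum_le_wnorm)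
  also have "\<dots> \<le> A powr p" using assms by (intro powr_mono2) auto
  finally show ?thesis .
qed

lemma pnorm_leI:
  assumes "0 < p" "0 \<le> A" "\<And>\<phi> M. \<phi> \<in> K \<Longrightarrow> wsum \<phi> M (abs_powr p x) \<le> A powr p"
  shows "x \<in> pspace K p" "pnorm K p x \<le> A"
proof -
  show x_mem: "x \<in> pspace K p" unfolding pspace_def mem_Collect_eq by (rule wspaceI) (rule assms)
  have "pnorm K p x powr p \<le> A powr p"
    unfolding pnorm_powr[OF x_mem assms(1)] by (rule wnorm_least) (rule assms)
  then show "pnorm K p x \<le> A" using assms by (auto intro: powr_le_powr_imp_le)
qed

lemma abs_le_pnorm:
  assumes "x \<in> pspace K p" "0 < p"
  shows "\<bar>x i\<bar> \<le> pnorm K p x"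
proof (rule powr_le_powr_imp_le)
  show "\<bar>x i\<bar> powr p \<le> pnorm K p x powr p"
    using abs_le_wnorm[of "abs_powr p x" i] assms by (simp add: pnorm_powr pspace_def)
qed (use assms in auto)

lemma seminorm_on_pnorm:
  assumes p_ge_1: "1 \<le> p"
  shows "seminorm_on (pspace K p) (pnorm K p)"
proof -
  define N where "N = (\<lambda>(\<phi>, M) x. wsum \<phi> M (abs_powr p x) powr (1 / p))"
  define A where "A = K \<times> (UNIV :: nat set)"
  have nonneg: "0 \<le> (case a of (\<phi>, M) \<Rightarrow> wsum \<phi> M x)" if "a \<in> A" for a x
    using that wsum_nonneg by (auto simp: A_def)
  have N_eq: "N a x = (case a of (\<phi>, M) \<Rightarrow> wsum \<phi> M (abs_powr p x)) powr (1 / p)" for a x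
    by (cases a) (simp add: N_def)
  have "seminorm_on UNIV (N a)" if "a \<in> A" for a
    using that seminorm_on_powr_sum[where w = "fst a" and S = "{..<snd a}",
        OF p_ge_1 subspace_UNIV _ seminorm_on_abs_component]
    by (auto simp: N_def A_def wsum_def K_nonneg)
  then have "seminorm_on {x \<in> UNIV. bdd_above ((\<lambda>a. N a x) ` A)} (\<lambda>x. SUP a\<in>A. N a x)"
    using K_nonempty by (intro seminorm_on_SUP) (auto simp: A_def)
  moreover have "{x \<in> UNIV. bdd_above ((\<lambda>a. N a x) ` A)} = pspace K p"
    using p_ge_1 nonneg by (simp add: N_eq bdd_above_powr_iff pspace_def wspace_def A_def)
  moreover have "pnorm K p x = (SUP a\<in>A. N a x)" if "x \<in> pspace K p" for x
  proof -
    have "bdd_above ((\<lambda>(\<phi>, M). wsum \<phi> M (abs_powr p x)) ` A)"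
      using that by (simp add: pspace_def wspace_def A_def)
    moreover have "A \<noteq> {}" using K_nonempty by (simp add: A_def)
    ultimately show ?thesis
      unfolding N_eq pnorm_def wnorm_def A_def[symmetric]
      using p_ge_1 nonneg by (intro cSUP_powr[symmetric]) simp_all
  qed
  ultimately show ?thesis by (auto intro: seminorm_on_cong)
qed

lemma pspace_one: "pspace K 1 = wspace K"
  by (simp add: pspace_def wspace_def wsum_def)

lemma pnorm_one: "x \<in> wspace K \<Longrightarrow> pnorm K 1 x = wnorm K x"
  using wnorm_nonneg[of x] by (simp add: pnorm_def wnorm_def wsum_def)

lemma seminorm_on_wnorm: "seminorm_on (wspace K) (wnorm K)"
  using seminorm_on_cong[OF seminorm_on_pnorm[of 1]] by (simp add: pspace_one pnorm_one)

lemma pnorm_add_disjoint_le: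
  assumes "x \<in> pspace K p" "y \<in> pspace K p" "0 < p" "\<And>i. x i = 0 \<or> y i = 0"
    and "pnorm K p x \<le> A" "pnorm K p y \<le> B"
  shows "pnorm K p (x + y) \<le> (A powr p + B powr p) powr (1 / p)"
proof (rule pnorm_leI(2))
  fix \<phi> M assume \<phi>_mem: "\<phi> \<in> K"
  have "abs_powr p (x + y) i = abs_powr p x i + abs_powr p y i" for i
    using assms(3) assms(4)[of i] by auto
  then have "wsum \<phi> M (abs_powr p (x + y)) = wsum \<phi> M (abs_powr p x) + wsum \<phi> M (abs_powr p y)"
    by (simp add: wsum_def distrib_left sum.distrib)
  also have "\<dots> \<le> A powr p + B powr p" using assms \<phi>_mem by (intro add_mono wsum_abs_powr_le)
  also have "\<dots> = ((A powr p + B powr p) powr (1 / p)) powr p" using assms by (simp add: powr_powr)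
  finally show "wsum \<phi> M (abs_powr p (x + y)) \<le> ((A powr p + B powr p) powr (1 / p)) powr p" .
qed (use assms in auto)

lemma tendsto_wsum_abs_powr:
  assumes "\<And>i. ((\<lambda>z. G z i) \<longlongrightarrow> u i) F" "0 < p"
  shows "((\<lambda>z. wsum \<phi> M (abs_powr p (G z))) \<longlongrightarrow> wsum \<phi> M (abs_powr p u)) F"
  unfolding wsum_def abs_powr_apply using assms
  by (intro tendsto_sum tendsto_mult tendsto_const tendsto_rabs tendsto_powr') auto

lemma pnorm_Fatou:
  assumes "0 < p" "F \<noteq> bot" "\<And>i. ((\<lambda>z. G z i) \<longlongrightarrow> u i) F" "0 \<le> A"
    and bounded: "\<forall>\<^sub>F z in F. G z \<in> pspace K p \<and> pnorm K p (G z) \<le> A"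
  shows "u \<in> pspace K p" "pnorm K p u \<le> A"
proof -
  have wsum_le: "wsum \<phi> M (abs_powr p u) \<le> A powr p" if "\<phi> \<in> K" for \<phi> M
  proof (rule tendsto_upperbound[OF tendsto_wsum_abs_powr[OF assms(3,1)] _ assms(2)])
    show "\<forall>\<^sub>F z in F. wsum \<phi> M (abs_powr p (G z)) \<le> A powr p"
      using bounded by eventually_elim (use wsum_abs_powr_le assms(1) that in blast)
  qed
  show "u \<in> pspace K p" "pnorm K p u \<le> A" using pnorm_leI[OF assms(1,4) wsum_le] by blast+
qed

lemma eventually_pnorm_head_le:
  assumes "0 < p" "\<And>i. ((\<lambda>z. G z i) \<longlongrightarrow> 0) F" "0 < e"
  shows "\<forall>\<^sub>F z in F. pnorm K p (restr {..<M} (G z)) \<le> e"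
proof -
  have "((\<lambda>z. \<Sum>i<M. \<bar>G z i\<bar> powr p) \<longlongrightarrow> (\<Sum>i<M. \<bar>0\<bar> powr p)) F"
    using assms by (intro tendsto_sum tendsto_powr' tendsto_rabs tendsto_const) auto
  then have "\<forall>\<^sub>F z in F. (\<Sum>i<M. \<bar>G z i\<bar> powr p) < e powr p"
    using assms by (intro order_tendstoD) auto
  then show ?thesis
  proof eventually_elim
    case (elim z)
    have "wsum \<phi> N (restr {..<M} (abs_powr p (G z))) \<le> e powr p" if "\<phi> \<in> K" for \<phi> N
      using wsum_le_sum_support[OF that, of "{..<M}" "restr {..<M} (abs_powr p (G z))" N] elim
      by (simp add: restr_def)
    then show ?case using assms by (intro pnorm_leI) auto
  qed
qed

end

section \<open>Lower estimates for successive blocks\<close>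

definition before :: "nat set \<Rightarrow> nat set \<Rightarrow> bool" where
  "before A B \<longleftrightarrow> (\<forall>a\<in>A. \<forall>b\<in>B. a < b)"

lemma sorted_wrt_before_Int: "sorted_wrt before Es \<Longrightarrow> sorted_wrt before (map (\<lambda>E. E \<inter> S) Es)"
  unfolding sorted_wrt_map by (erule sorted_wrt_mono_rel[rotated]) (auto simp: before_def)

lemma index_le_sorted_wrt_before:
  assumes "sorted_wrt before Es" "\<And>E. E \<in> set Es \<Longrightarrow> E \<noteq> {}" "j < length Es" "a \<in> Es ! j"
  shows "j \<le> a"
  using assms(3,4)
proof (induction j arbitrary: a)
  case (Suc j)
  obtain b where b_mem: "b \<in> Es ! j" using assms(2) Suc.prems by fastforce
  have "before (Es ! j) (Es ! Suc j)"
    using sorted_wrt_nth_less[OF assms(1), of j "Suc j"] Suc.prems by simp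
  then have "b < a" using b_mem Suc.prems by (auto simp: before_def)
  then show ?case using Suc.IH[OF _ b_mem] Suc.prems by simp
qed simp

text \<open>The \<open>j\<close>-th of finitely many successive nonempty sets lies in \<open>{j..}\<close>, so the latter half of them
  is admissible.\<close>

lemma admissible_latter_half:
  assumes "sorted_wrt before Es" "\<And>E. E \<in> set Es \<Longrightarrow> finite E \<and> E \<noteq> {}" "Es \<noteq> []"
  defines "k \<equiv> (length Es + 1) div 2"
  shows "admissible k (\<lambda>j. Es ! (length Es - k + j))"
proof -
  define n where "n = length Es"
  have "0 < n" using assms(3) by (simp add: n_def)
  then have k_bounds: "1 \<le> k" "k \<le> n" "k \<le> Suc (n - k)" unfolding k_def n_def by linarith+
  have finite_nonempty: "finite (Es ! (n - k + j))" "Es ! (n - k + j) \<noteq> {}" if "j < k" for j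
    using assms(2)[OF nth_mem, of "n - k + j"] that k_bounds by (auto simp: n_def)
  have "Max (Es ! (n - k + j)) < Min (Es ! (n - k + Suc j))" if "Suc j < k" for j
  proof -
    have "before (Es ! (n - k + j)) (Es ! (n - k + Suc j))"
      using that k_bounds by (intro sorted_wrt_nth_less[OF assms(1)]) (auto simp: n_def)
    then show ?thesis using finite_nonempty[of j] finite_nonempty[of "Suc j"] that by (auto simp: before_def)
  qed
  moreover have "n - k \<le> Min (Es ! (n - k + 0))"
    using finite_nonempty[of 0] k_bounds assms(2) index_le_sorted_wrt_before[OF assms(1), of "n - k"]
    by (auto simp: n_def)
  ultimately show ?thesis
    using k_bounds finite_nonempty unfolding admissible_def n_def[symmetric] by auto
qed

lemma sum_powr_le_of_weak_bound:
  fixes as :: "real list"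
  assumes "1 < s" "0 \<le> D" "\<And>a. a \<in> set as \<Longrightarrow> 0 \<le> a"
    and "\<And>c. real (length (filter (\<lambda>a. c \<le> a) as)) * c \<le> D"
  shows "(\<Sum>a\<leftarrow>as. a powr s) \<le> D powr s * (\<Sum>i<length as. real (Suc i) powr - s)"
  using assms(3,4)
proof (induction "length as" arbitrary: as)
  case (Suc n as)
  define m where "m = Min (set as)"
  have "as \<noteq> []" using Suc.hyps(2) by auto
  then have m_least: "m \<in> set as" "\<And>a. a \<in> set as \<Longrightarrow> m \<le> a" by (auto simp: m_def)
  obtain us vs where as_eq: "as = us @ m # vs" using split_list[OF m_least(1)] by blast
  have "filter (\<lambda>a. m \<le> a) as = as" using m_least(2) by (simp add: filter_id_conv)
  then have "real (Suc n) * m \<le> D" using Suc.prems(2)[of m] Suc.hyps(2) by simp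
  then have "m \<le> D * inverse (real (Suc n))" by (simp add: field_simps)
  then have "m powr s \<le> (D * inverse (real (Suc n))) powr s"
    using assms(1) Suc.prems(1)[OF m_least(1)] by (intro powr_mono2) auto
  also have "\<dots> = D powr s * real (Suc n) powr - s"
    by (simp add: powr_mult inverse_powr powr_minus)
  finally have min_le: "m powr s \<le> D powr s * real (Suc n) powr - s" .
  have length_le: "real (length (filter (\<lambda>a. c \<le> a) (us @ vs))) * c \<le> D" for c
  proof (cases "0 \<le> c")
    case True
    then have "real (length (filter (\<lambda>a. c \<le> a) (us @ vs))) * c \<le> real (length (filter (\<lambda>a. c \<le> a) as)) * c"
      by (intro mult_right_mono) (auto simp: as_eq)
    then show ?thesis using Suc.prems(2)[of c] by simp
  next
    case False
    then show ?thesis using assms(2) by (meson mult_nonneg_nonpos nle_le of_nat_0_le_iff order_trans)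
  qed
  have length_rest: "n = length (us @ vs)" using Suc.hyps(2) by (simp add: as_eq)
  have "(\<Sum>a\<leftarrow>us @ vs. a powr s) \<le> D powr s * (\<Sum>i<n. real (Suc i) powr - s)"
    using Suc.hyps(1)[OF length_rest] Suc.prems(1) length_le unfolding length_rest by (simp add: as_eq)
  then show ?case
    unfolding Suc.hyps(2)[symmetric] using min_le by (simp add: as_eq distrib_left)
qed simp

locale tsirelson_weights = weights +
  assumes K_admissible: "admissible k E \<Longrightarrow> (\<And>j. j < k \<Longrightarrow> \<phi>s j \<in> K) \<Longrightarrow>
    \<exists>\<psi>\<in>K. \<forall>i. (1/2) * (\<Sum>j<k. restr (E j) (\<phi>s j) i) \<le> \<psi> i"
begin

lemma sum_wnorm_admissible_le:
  assumes x_mem: "x \<in> wspace K" and E_admissible: "admissible k E"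
  shows "(\<Sum>j<k. wnorm K (restr (E j) x)) \<le> 2 * wnorm K x"
proof (rule field_le_epsilon)
  fix e :: real assume e_pos: "0 < e"
  have k_pos: "0 < k" using E_admissible by (simp add: admissible_def)
  define d where "d = e / real k"
  have d_pos: "0 < d" using e_pos k_pos by (simp add: d_def)
  have "\<exists>\<phi> M. \<phi> \<in> K \<and> wnorm K (restr (E j) x) - d < wsum \<phi> M (restr (E j) x)" for j
    by (rule less_wnormE[of "wnorm K (restr (E j) x) - d" "restr (E j) x"]) (use d_pos in auto)
  then obtain \<phi> M where \<phi>_mem: "\<And>j. \<phi> j \<in> K"
    and M_approx: "\<And>j. wnorm K (restr (E j) x) - d < wsum (\<phi> j) (M j) (restr (E j) x)"
    by metis
  obtain \<psi> where \<psi>_half_sum: "\<psi> \<in> K" "\<And>i. (1/2) * (\<Sum>j<k. restr (E j) (\<phi> j) i) \<le> \<psi> i"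
    using K_admissible[OF E_admissible] \<phi>_mem by meson
  have \<psi>_ge: "(\<Sum>j<k. restr (E j) (\<phi> j) i) \<le> 2 * \<psi> i" for i using \<psi>_half_sum(2)[of i] by simp
  define N where "N = Max (M ` {..<k})"
  have "(\<Sum>j<k. wnorm K (restr (E j) x) - d) \<le> (\<Sum>j<k. wsum (\<phi> j) N (restr (E j) x))"
  proof (intro sum_mono)
    fix j assume "j \<in> {..<k}"
    then have "M j \<le> N" by (simp add: N_def)
    then show "wnorm K (restr (E j) x) - d \<le> wsum (\<phi> j) N (restr (E j) x)"
      using M_approx \<phi>_mem wsum_mono_length by (meson less_imp_le order_trans)
  qed
  also have "\<dots> = (\<Sum>i<N. (\<Sum>j<k. restr (E j) (\<phi> j) i) * \<bar>x i\<bar>)"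
    unfolding wsum_restr by (subst sum.swap) (simp add: sum_distrib_right)
  also have "\<dots> \<le> (\<Sum>i<N. 2 * (\<psi> i * \<bar>x i\<bar>))"
    using mult_right_mono[OF \<psi>_ge abs_ge_zero] by (intro sum_mono) (simp add: mult.assoc)
  also have "\<dots> = 2 * wsum \<psi> N x" by (simp add: wsum_def sum_distrib_left)
  also have "\<dots> \<le> 2 * wnorm K x" by (simp add: wsum_le_wnorm[OF x_mem \<psi>_half_sum(1)])
  finally show "(\<Sum>j<k. wnorm K (restr (E j) x)) \<le> 2 * wnorm K x + e"
    using k_pos by (simp add: sum_subtractf d_def)
qed

lemma eventually_less_wnorm_restr:
  assumes "x \<in> wspace K" "c < wnorm K (restr E x)"
  shows "\<forall>\<^sub>F n in sequentially. c < wnorm K (restr (E \<inter> {..<n}) x)"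
proof -
  obtain \<phi> M where \<phi>_less: "\<phi> \<in> K" "c < wsum \<phi> M (restr E x)"
    using less_wnormE[OF assms(2)] by blast
  have "c < wnorm K (restr (E \<inter> {..<n}) x)" if "M \<le> n" for n
  proof -
    have "wsum \<phi> M (restr E x) = wsum \<phi> M (restr (E \<inter> {..<n}) x)"
      unfolding wsum_def using that by (intro sum.cong) (auto simp: restr_def)
    then show ?thesis
      using \<phi>_less wsum_le_wnorm[OF wspace_restr[OF assms(1)]] by (metis less_le_trans)
  qed
  then show ?thesis by (auto simp: eventually_sequentially)
qed

lemma length_mult_le_finite_successive:
  assumes x_mem: "x \<in> wspace K" and Es_sorted: "sorted_wrt before Es"
    and blocks_finite: "\<And>E. E \<in> set Es \<Longrightarrow> finite E \<and> E \<noteq> {}"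
    and blocks_ge: "\<And>E. E \<in> set Es \<Longrightarrow> c \<le> wnorm K (restr E x)" and "0 \<le> c"
  shows "real (length Es) * c \<le> 4 * wnorm K x"
proof (cases "Es = []")
  case True
  then show ?thesis using wnorm_nonneg[OF x_mem] by simp
next
  case False
  define k where "k = (length Es + 1) div 2"
  let ?E = "\<lambda>j. Es ! (length Es - k + j)"
  have k_bounds: "k \<le> length Es" "length Es \<le> 2 * k" using False by (auto simp: k_def Suc_le_eq)
  have "real (length Es) * c \<le> real (2 * k) * c"
    using k_bounds \<open>0 \<le> c\<close> by (intro mult_right_mono of_nat_mono)
  also have "\<dots> = 2 * (\<Sum>j<k. c)" by simp
  also have "\<dots> \<le> 2 * (\<Sum>j<k. wnorm K (restr (?E j) x))"
    using k_bounds by (intro mult_left_mono sum_mono blocks_ge nth_mem) auto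
  also have "\<dots> \<le> 2 * (2 * wnorm K x)"
    using sum_wnorm_admissible_le[OF x_mem admissible_latter_half[OF Es_sorted blocks_finite False]]
    by (simp add: k_def)
  finally show ?thesis by simp
qed

lemma length_mult_le_successive:
  assumes x_mem: "x \<in> wspace K" and Es_sorted: "sorted_wrt before Es"
    and blocks_ge: "\<And>E. E \<in> set Es \<Longrightarrow> c \<le> wnorm K (restr E x)"
  shows "real (length Es) * c \<le> 4 * wnorm K x"
proof (cases "0 < c \<and> Es \<noteq> []")
  case False
  then have "real (length Es) * c \<le> 0" by (auto simp: mult_nonneg_nonpos)
  then show ?thesis using wnorm_nonneg[OF x_mem] by simp
next
  case True
  then have c_length_pos: "0 < c" "0 < real (length Es)" by auto
  have approx: "real (length Es) * d \<le> 4 * wnorm K x" if d_bounds: "0 < d" "d < c" for d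
  proof -
    have "\<forall>E\<in>set Es. \<forall>\<^sub>F n in sequentially. d < wnorm K (restr (E \<inter> {..<n}) x)"
      using blocks_ge d_bounds by (blast intro: eventually_less_wnorm_restr[OF x_mem] less_le_trans)
    then have "\<forall>\<^sub>F n in sequentially. \<forall>E\<in>set Es. d < wnorm K (restr (E \<inter> {..<n}) x)"
      by (intro eventually_ball_finite) auto
    then obtain n where truncated_blocks_greater: "\<And>E. E \<in> set Es \<Longrightarrow> d < wnorm K (restr (E \<inter> {..<n}) x)"
      using eventually_happens'[OF sequentially_bot] by blast
    have "E \<inter> {..<n} \<noteq> {}" if "E \<in> set Es" for E
    proof
      assume "E \<inter> {..<n} = {}"
      then have "restr (E \<inter> {..<n}) x = 0" by (auto simp: restr_def)
      then show False
        using truncated_blocks_greater[OF that] d_bounds seminorm_on.zero[OF seminorm_on_wnorm] by simp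
    qed
    then have "real (length (map (\<lambda>E. E \<inter> {..<n}) Es)) * d \<le> 4 * wnorm K x"
      using truncated_blocks_greater d_bounds
      by (intro length_mult_le_finite_successive[OF x_mem sorted_wrt_before_Int[OF Es_sorted]])
        (auto intro: less_imp_le)
    then show ?thesis by simp
  qed
  have "d \<le> 4 * wnorm K x / real (length Es)" if "0 < d" "d < c" for d
    using approx[OF that] c_length_pos by (simp add: field_simps)
  then have "c \<le> 4 * wnorm K x / real (length Es)" by (rule dense_le_bounded[OF c_length_pos(1)])
  then show ?thesis using c_length_pos by (simp add: field_simps)
qed

lemma ex_wnorm_tail_le:
  assumes x_mem: "x \<in> wspace K" and e_pos: "0 < e"
  shows "\<exists>n. wnorm K (restr {n..} x) \<le> e"
proof (rule ccontr)
  assume "\<nexists>n. wnorm K (restr {n..} x) \<le> e"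
  then have tail_greater: "e < wnorm K (restr {n..} x)" for n by (meson not_le)
  have "\<exists>m>n. e < wnorm K (restr {n..<m} x)" for n
  proof -
    have "\<forall>\<^sub>F m in sequentially. n < m \<and> e < wnorm K (restr ({n..} \<inter> {..<m}) x)"
      by (intro eventually_conj eventually_gt_at_top eventually_less_wnorm_restr x_mem tail_greater)
    moreover have "{n..} \<inter> {..<m} = {n..<m}" for m by auto
    ultimately show ?thesis using eventually_happens'[OF sequentially_bot] by auto
  qed
  then obtain h where h_block: "\<And>n. n < h n" "\<And>n. e < wnorm K (restr {n..<h n} x)" by metis
  define a where "a j = (h ^^ j) 0" for j
  have a_Suc: "a (Suc j) = h (a j)" for j by (simp add: a_def)
  then have "strict_mono a" using h_block(1) by (simp add: strict_mono_Suc_iff)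
  then have a_mono: "i \<le> j \<Longrightarrow> a i \<le> a j" for i j by (simp add: strict_mono_less_eq)
  have "real n * e \<le> 4 * wnorm K x" for n
  proof -
    have "before {a i..<a (Suc i)} {a j..<a (Suc j)}" if "i < j" for i j
      using a_mono[of "Suc i" j] that by (auto simp: before_def)
    then have "sorted_wrt before (map (\<lambda>j. {a j..<a (Suc j)}) [0..<n])"
      by (simp add: sorted_wrt_iff_nth_less)
    from length_mult_le_successive[OF x_mem this, of e]
    show ?thesis using h_block(2) by (auto simp: a_Suc intro: less_imp_le)
  qed
  then show False using reals_Archimedean3[OF e_pos] by (meson not_le)
qed

lemma wnorm_tail_tendsto_0:
  assumes x_mem: "x \<in> wspace K"
  shows "(\<lambda>n. wnorm K (restr {n..} x)) \<longlonglongrightarrow> 0"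
proof (rule LIMSEQ_I)
  fix e :: real assume "0 < e"
  then obtain m where m_tail_le: "wnorm K (restr {m..} x) \<le> e / 2"
    using ex_wnorm_tail_le[OF x_mem, of "e / 2"] by auto
  have "norm (wnorm K (restr {n..} x) - 0) < e" if "m \<le> n" for n
  proof -
    have "wnorm K (restr {n..} x) \<le> wnorm K (restr {m..} x)"
      using that by (intro wnorm_mono wspace_restr x_mem) (simp add: restr_def)
    then show ?thesis
      using m_tail_le \<open>0 < e\<close> wnorm_nonneg[OF wspace_restr[OF x_mem]] by simp
  qed
  then show "\<exists>m. \<forall>n\<ge>m. norm (wnorm K (restr {n..} x) - 0) < e" by blast
qed

lemma pnorm_tail_tendsto_0:
  assumes "x \<in> pspace K p" "0 < p"
  shows "(\<lambda>n. pnorm K p (restr {n..} x)) \<longlonglongrightarrow> 0"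
proof -
  have "(\<lambda>n. wnorm K (restr {n..} (abs_powr p x)) powr (1 / p)) \<longlonglongrightarrow> 0 powr (1 / p)"
    using assms
    by (intro tendsto_powr' tendsto_const wnorm_tail_tendsto_0)
      (auto simp: pspace_def intro!: always_eventually wnorm_nonneg wspace_restr)
  then show ?thesis by (simp add: pnorm_def)
qed

lemma sum_wnorm_powr_successive_le:
  assumes x_mem: "x \<in> wspace K" and s_gt_1: "1 < s" and Es_sorted: "sorted_wrt before Es"
  shows "(\<Sum>E\<leftarrow>Es. wnorm K (restr E x) powr s) \<le> (4 * wnorm K x) powr s * (\<Sum>i. real (Suc i) powr - s)"
proof -
  let ?as = "map (\<lambda>E. wnorm K (restr E x)) Es"
  have "(\<Sum>a\<leftarrow>?as. a powr s) \<le> (4 * wnorm K x) powr s * (\<Sum>i<length ?as. real (Suc i) powr - s)"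
  proof (rule sum_powr_le_of_weak_bound[OF s_gt_1])
    fix c
    let ?Fs = "filter (\<lambda>E. c \<le> wnorm K (restr E x)) Es"
    have "real (length ?Fs) * c \<le> 4 * wnorm K x"
      using sorted_wrt_filter[OF Es_sorted] by (intro length_mult_le_successive[OF x_mem]) auto
    then show "real (length (filter (\<lambda>a. c \<le> a) ?as)) * c \<le> 4 * wnorm K x"
      by (simp add: filter_map comp_def)
  qed (use wnorm_nonneg[OF x_mem] wnorm_nonneg[OF wspace_restr[OF x_mem]] in auto)
  also have "\<dots> \<le> (4 * wnorm K x) powr s * (\<Sum>i. real (Suc i) powr - s)"
  proof (intro mult_left_mono sum_le_suminf)
    have "summable (\<lambda>i. real i powr - s)" using s_gt_1 by (simp add: summable_real_powr_iff)
    then show "summable (\<lambda>i. real (Suc i) powr - s)" by (subst summable_Suc_iff)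
  qed auto
  finally show ?thesis by (simp add: comp_def)
qed

lemma pnorm_lower_estimate:
  assumes "1 \<le> p" "p < q"
  obtains C where "0 < C" "\<And>x Es. x \<in> pspace K p \<Longrightarrow> sorted_wrt before Es \<Longrightarrow>
    (\<Sum>E\<leftarrow>Es. pnorm K p (restr E x) powr q) \<le> C * pnorm K p x powr q"
proof
  define s where "s = q / p"
  have s_gt_1: "1 < s" using assms by (simp add: s_def)
  define Z where "Z = (\<Sum>i. real (Suc i) powr - s)"
  have pnorm_powr_q: "pnorm K p y powr q = wnorm K (abs_powr p y) powr s" for y
    by (simp add: pnorm_def powr_powr s_def)
  fix x Es assume x_mem: "x \<in> pspace K p" and Es_sorted: "sorted_wrt before Es"
  have "(\<Sum>E\<leftarrow>Es. pnorm K p (restr E x) powr q) \<le> (4 * wnorm K (abs_powr p x)) powr s * Z"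
    using sum_wnorm_powr_successive_le[OF _ s_gt_1 Es_sorted] x_mem
    by (simp add: pnorm_powr_q pspace_def Z_def)
  also have "\<dots> = 4 powr s * Z * pnorm K p x powr q"
    by (simp add: pnorm_powr_q powr_mult mult_ac)
  also have "\<dots> \<le> (4 powr s * \<bar>Z\<bar> + 1) * pnorm K p x powr q"
    by (intro mult_right_mono add_increasing2 mult_left_mono) auto
  finally show "(\<Sum>E\<leftarrow>Es. pnorm K p (restr E x) powr q) \<le> (4 powr s * \<bar>Z\<bar> + 1) * pnorm K p x powr q" .
qed (simp add: add_nonneg_pos)

lemma card_le_wnorm_indicator:
  assumes "finite A"
  shows "real (card A) \<le> 4 * wnorm K (indicator A)"
proof -
  have A_mem: "indicator A \<in> wspace K" by (rule wspace_indicator[OF assms])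
  have "sorted_wrt before (map (\<lambda>a. {a}) (sorted_list_of_set A))"
    using sorted_list_of_set.strict_sorted_key_list_of_set[of A] by (simp add: sorted_wrt_map before_def)
  then have "real (length (map (\<lambda>a. {a}) (sorted_list_of_set A))) * 1 \<le> 4 * wnorm K (indicator A)"
  proof (rule length_mult_le_successive[OF A_mem])
    fix E assume "E \<in> set (map (\<lambda>a. {a}) (sorted_list_of_set A))"
    then obtain a where "a \<in> A" "E = {a}" using assms by auto
    then show "1 \<le> wnorm K (restr E (indicator A))"
      using abs_le_wnorm[OF wspace_restr[OF A_mem], of E a] by (simp add: restr_def)
  qed
  then show ?thesis using assms by simp
qed

end

section \<open>Iterated limits along an ultrafilter\<close>

definition ultrafilter :: "'a filter \<Rightarrow> bool" where
  "ultrafilter F \<longleftrightarrow> F \<noteq> bot \<and> (\<forall>P. eventually P F \<or> eventually (\<lambda>x. \<not> P x) F)"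

lemma Inf_chain_filter_neq_bot:
  fixes C :: "'a filter set"
  assumes "C \<noteq> {}" "bot \<notin> C" and chain: "\<And>F G. F \<in> C \<Longrightarrow> G \<in> C \<Longrightarrow> F \<le> G \<or> G \<le> F"
  shows "Inf C \<noteq> bot"
proof -
  have "eventually P (Inf C) \<longleftrightarrow> (\<exists>F\<in>C. eventually P F)" for P
  proof (rule eventually_Inf_base[OF assms(1)])
    fix F G assume "F \<in> C" "G \<in> C"
    then show "\<exists>H\<in>C. H \<le> inf F G"
      using chain by (metis inf.absorb1 inf.absorb2 order_refl)
  qed
  moreover have "\<not> eventually (\<lambda>x. False) F" if "F \<in> C" for F
    using that assms(2) by (metis trivial_limit_def)
  ultimately show ?thesis by (simp add: trivial_limit_def)
qed

lemma ultrafilterI_minimal: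
  assumes "U \<noteq> bot" and minimal: "\<And>F. F \<noteq> bot \<Longrightarrow> F \<le> U \<Longrightarrow> F = U"
  shows "ultrafilter U"
proof -
  have "eventually P U" if "\<not> eventually (\<lambda>x. \<not> P x) U" for P
  proof -
    have "inf U (principal {x. P x}) \<noteq> bot"
      using that by (simp add: trivial_limit_def eventually_inf_principal)
    then have "inf U (principal {x. P x}) = U" by (intro minimal) auto
    then have "U \<le> principal {x. P x}" by (metis inf.cobounded2)
    then show ?thesis by (simp add: le_principal)
  qed
  then show ?thesis using assms(1) by (auto simp: ultrafilter_def)
qed

lemma ex_ultrafilter_le:
  fixes F :: "'a filter"
  assumes "F \<noteq> bot"
  shows "\<exists>U\<le>F. ultrafilter U"
proof -
  define A where "A = {G. G \<noteq> bot \<and> G \<le> F}"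
  define R :: "'a filter \<Rightarrow> 'a filter \<Rightarrow> bool" where "R G H \<longleftrightarrow> H \<le> G" for G H
  have "partial_order_on A (relation_of R A)"
    by (rule partial_order_on_relation_ofI) (auto simp: R_def)
  then have "\<exists>U\<in>A. \<forall>G\<in>A. R U G \<longrightarrow> G = U"
  proof (rule predicate_Zorn)
    fix C assume "C \<in> Chains (relation_of R A)"
    then have C_chain: "C \<subseteq> A" "\<And>G H. G \<in> C \<Longrightarrow> H \<in> C \<Longrightarrow> G \<le> H \<or> H \<le> G"
      by (auto simp: Chains_def relation_of_def R_def)
    show "\<exists>U\<in>A. \<forall>G\<in>C. R G U"
    proof (cases "C = {}")
      case True
      then show ?thesis using assms by (auto simp: A_def)
    next
      case False
      then have "Inf C \<in> A"
        using C_chain Inf_chain_filter_neq_bot[of C] by (auto simp: A_def intro: Inf_lower2)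
      then show ?thesis by (auto simp: R_def intro: Inf_lower)
    qed
  qed
  then obtain U where "U \<in> A" "\<And>G. G \<in> A \<Longrightarrow> G \<le> U \<Longrightarrow> G = U" by (auto simp: R_def)
  then have "U \<le> F" "ultrafilter U"
    by (auto simp: A_def intro!: ultrafilterI_minimal)
  then show ?thesis by blast
qed

lemma ultrafilter_tendsto_compact:
  assumes F_ultra: "ultrafilter F" and S_compact: "compact S" and f_in_S: "\<forall>\<^sub>F x in F. f x \<in> S"
  shows "\<exists>l\<in>S. (f \<longlongrightarrow> l) F"
proof -
  have "filtermap f F \<noteq> bot" using F_ultra by (simp add: ultrafilter_def filtermap_bot_iff)
  moreover have "eventually (\<lambda>y. y \<in> S) (filtermap f F)" using f_in_S by (simp add: eventually_filtermap)
  ultimately obtain l where l_cluster: "l \<in> S" "inf (nhds l) (filtermap f F) \<noteq> bot"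
    using S_compact unfolding compact_filter by blast
  have "(f \<longlongrightarrow> l) F"
  proof (rule topological_tendstoI, rule ccontr)
    fix T assume T_nhd: "open T" "l \<in> T" and not_ev: "\<not> (\<forall>\<^sub>F x in F. f x \<in> T)"
    then have "\<forall>\<^sub>F x in F. f x \<notin> T" using F_ultra by (auto simp: ultrafilter_def)
    then have "\<forall>\<^sub>F y in inf (nhds l) (filtermap f F). y \<notin> T"
      by (intro filter_leD[OF inf_le2]) (simp add: eventually_filtermap)
    moreover have "\<forall>\<^sub>F y in inf (nhds l) (filtermap f F). y \<in> T"
      using T_nhd by (intro filter_leD[OF inf_le1]) (auto simp: eventually_nhds)
    ultimately have "\<forall>\<^sub>F y in inf (nhds l) (filtermap f F). False"
      by eventually_elim simp
    then show False using l_cluster(2) by (simp add: trivial_limit_def)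
  qed
  then show ?thesis using l_cluster(1) by blast
qed

definition free_ultra :: "nat filter" where
  "free_ultra = (SOME U. U \<le> sequentially \<and> ultrafilter U)"

lemma free_ultra_le: "free_ultra \<le> sequentially" and ultrafilter_free_ultra: "ultrafilter free_ultra"
proof -
  have "\<exists>U. U \<le> sequentially \<and> ultrafilter U" by (rule ex_ultrafilter_le) simp
  from someI_ex[OF this] show "free_ultra \<le> sequentially" "ultrafilter free_ultra"
    by (simp_all add: free_ultra_def)
qed

lemma free_ultra_neq_bot [simp]: "free_ultra \<noteq> bot"
  using ultrafilter_free_ultra by (simp add: ultrafilter_def)

primrec tuples :: "nat \<Rightarrow> nat list filter" where
  "tuples 0 = principal {[]}"
| "tuples (Suc k) = Abs_filter (\<lambda>P. \<forall>\<^sub>F n in free_ultra. \<forall>\<^sub>F ns in tuples k. P (n # ns))"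

lemma eventually_tuples_0 [simp]: "eventually P (tuples 0) \<longleftrightarrow> P []"
  by (simp add: eventually_principal)

lemma eventually_tuples_Suc:
  "eventually P (tuples (Suc k)) \<longleftrightarrow> (\<forall>\<^sub>F n in free_ultra. \<forall>\<^sub>F ns in tuples k. P (n # ns))"
proof -
  have "is_filter (\<lambda>P. \<forall>\<^sub>F n in free_ultra. \<forall>\<^sub>F ns in tuples k. P (n # ns))"
  proof
    fix P Q
    assume "\<forall>\<^sub>F n in free_ultra. \<forall>\<^sub>F ns in tuples k. P (n # ns)"
      and "\<forall>\<^sub>F n in free_ultra. \<forall>\<^sub>F ns in tuples k. Q (n # ns)"
    then show "\<forall>\<^sub>F n in free_ultra. \<forall>\<^sub>F ns in tuples k. P (n # ns) \<and> Q (n # ns)"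
      by eventually_elim (rule eventually_conj)
  next
    fix P Q :: "nat list \<Rightarrow> bool"
    assume "\<forall>ns. P ns \<longrightarrow> Q ns" "\<forall>\<^sub>F n in free_ultra. \<forall>\<^sub>F ns in tuples k. P (n # ns)"
    then show "\<forall>\<^sub>F n in free_ultra. \<forall>\<^sub>F ns in tuples k. Q (n # ns)"
      by (auto elim!: eventually_mono)
  qed simp
  then show ?thesis by (simp add: eventually_Abs_filter)
qed

declare tuples.simps [simp del]

lemma ultrafilter_tuples: "ultrafilter (tuples k)"
proof (induction k)
  case 0
  then show ?case by (simp add: ultrafilter_def trivial_limit_def)
next
  case (Suc k)
  have "eventually P (tuples (Suc k)) \<or> eventually (\<lambda>x. \<not> P x) (tuples (Suc k))" for P
  proof -
    consider "\<forall>\<^sub>F n in free_ultra. \<forall>\<^sub>F ns in tuples k. P (n # ns)"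
      | "\<forall>\<^sub>F n in free_ultra. \<not> (\<forall>\<^sub>F ns in tuples k. P (n # ns))"
      using ultrafilter_free_ultra unfolding ultrafilter_def by blast
    then show ?thesis
    proof cases
      case 2
      then have "\<forall>\<^sub>F n in free_ultra. \<forall>\<^sub>F ns in tuples k. \<not> P (n # ns)"
        by eventually_elim (use Suc in \<open>auto simp: ultrafilter_def\<close>)
      then show ?thesis by (simp add: eventually_tuples_Suc)
    qed (simp add: eventually_tuples_Suc)
  qed
  moreover have "tuples (Suc k) \<noteq> bot"
    using Suc free_ultra_neq_bot
    unfolding trivial_limit_def eventually_tuples_Suc ultrafilter_def by simp
  ultimately show ?case by (simp add: ultrafilter_def)
qed

lemma tuples_neq_bot [simp]: "tuples k \<noteq> bot"
  using ultrafilter_tuples by (simp add: ultrafilter_def)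

lemma eventually_tuples_tl: "eventually P (tuples k) \<Longrightarrow> eventually (\<lambda>ns. P (tl ns)) (tuples (Suc k))"
  by (simp add: eventually_tuples_Suc)

lemma eventually_tuples_length: "\<forall>\<^sub>F ns in tuples k. length ns = k"
  by (induction k) (simp_all add: eventually_tuples_Suc)

lemma eventually_tuples_gt: "\<forall>\<^sub>F ns in tuples k. \<forall>n\<in>set ns. N < n"
proof (induction k)
  case (Suc k)
  have "\<forall>\<^sub>F n in free_ultra. N < n"
    using free_ultra_le eventually_gt_at_top by (rule filter_leD)
  then have "\<forall>\<^sub>F n in free_ultra. \<forall>\<^sub>F ns in tuples k. \<forall>m\<in>set (n # ns). N < m"
    by eventually_elim (use Suc in simp)
  then show ?case by (simp only: eventually_tuples_Suc)
qed simp

lemma eventually_tuples_distinct: "\<forall>\<^sub>F ns in tuples k. distinct ns"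
proof (induction k)
  case (Suc k)
  have "\<forall>\<^sub>F ns in tuples k. distinct (n # ns)" for n
    using eventually_tuples_gt[of n k] Suc by eventually_elim auto
  then show ?case by (simp add: eventually_tuples_Suc)
qed simp

lemma ex_disjoint_tuples:
  assumes "eventually P (tuples k)"
  obtains ns ms where "P ns" "P ms" "set ns \<inter> set ms = {}"
proof -
  obtain ns where P_ns: "P ns" using eventually_happens'[OF tuples_neq_bot assms] by blast
  have "\<forall>\<^sub>F ms in tuples k. P ms \<and> (\<forall>m\<in>set ms. sum_list ns < m)"
    by (intro eventually_conj assms eventually_tuples_gt)
  then obtain ms where ms_beyond: "P ms" "\<forall>m\<in>set ms. sum_list ns < m"
    using eventually_happens'[OF tuples_neq_bot] by blast
  then have "set ns \<inter> set ms = {}" using member_le_sum_list[of _ ns] by fastforce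
  then show ?thesis using P_ns ms_beyond(1) that by blast
qed

context weights begin

lemma ultrafilter_coordinatewise_limit:
  assumes F_ultra: "ultrafilter F" and p_pos: "0 < p"
    and bounded: "\<forall>\<^sub>F z in F. G z \<in> pspace K p \<and> pnorm K p (G z) \<le> B"
  obtains u where "u \<in> pspace K p" "pnorm K p u \<le> B" "\<And>i. ((\<lambda>z. G z i) \<longlongrightarrow> u i) F"
proof -
  have F_neq: "F \<noteq> bot" using F_ultra by (simp add: ultrafilter_def)
  have "\<exists>l. ((\<lambda>z. G z i) \<longlongrightarrow> l) F" for i
  proof -
    have "\<forall>\<^sub>F z in F. G z i \<in> {- B..B}"
      using bounded
    proof eventually_elim
      case (elim z)
      then have "\<bar>G z i\<bar> \<le> B" using abs_le_pnorm[of "G z" p i] p_pos by simp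
      then show ?case by (simp add: abs_le_iff)
    qed
    then show ?thesis using ultrafilter_tendsto_compact[OF F_ultra compact_Icc, of "\<lambda>z. G z i"] by blast
  qed
  then obtain u where u_limit: "\<And>i. ((\<lambda>z. G z i) \<longlongrightarrow> u i) F" by metis
  have "0 \<le> B"
    using eventually_happens'[OF F_neq bounded] pnorm_nonneg order_trans by blast
  from pnorm_Fatou[OF p_pos F_neq u_limit this bounded] show ?thesis using u_limit by (intro that)
qed

end

section \<open>Concentration under upper estimates\<close>

context tsirelson_weights begin

lemma pnorm_add_almost_disjoint_le:
  assumes p_ge_1: "1 \<le> p" and xy_bounds: "x \<in> pspace K p" "y \<in> pspace K p" "pnorm K p x \<le> A" "pnorm K p y \<le> B"
    and overlap_le: "pnorm K p (restr {n..} x) \<le> e" "pnorm K p (restr {..<n} y) \<le> e"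
  shows "pnorm K p (x + y) \<le> (A powr p + B powr p) powr (1 / p) + 2 * e"
proof -
  interpret seminorm_on "pspace K p" "pnorm K p" by (rule seminorm_on_pnorm[OF p_ge_1])
  define main where "main = restr {..<n} x + restr {n..} y"
  define rest where "rest = restr {n..} x + restr {..<n} y"
  have parts_mem: "main \<in> pspace K p" "rest \<in> pspace K p"
    unfolding main_def rest_def using xy_bounds by (simp_all add: mem_add pspace_restr)
  have "x + y = main + rest" by (auto simp: main_def rest_def restr_def)
  then have "pnorm K p (x + y) \<le> pnorm K p main + pnorm K p rest" using triangle[OF parts_mem] by simp
  also have "pnorm K p main \<le> (A powr p + B powr p) powr (1 / p)"
    unfolding main_def using p_ge_1 xy_bounds
    by (intro pnorm_add_disjoint_le pspace_restr order_trans[OF pnorm_restr_le]) (auto simp: restr_def)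
  also have "pnorm K p rest \<le> e + e"
    unfolding rest_def using triangle[of "restr {n..} x" "restr {..<n} y"] xy_bounds overlap_le
    by (simp add: pspace_restr)
  finally show ?thesis by simp
qed

lemma eventually_pnorm_add_le:
  assumes p_ge_1: "1 \<le> p" and x_mem: "x \<in> pspace K p"
    and h_null: "\<forall>\<^sub>F z in F. h z \<in> pspace K p \<and> pnorm K p (h z) \<le> B" "\<And>i. ((\<lambda>z. h z i) \<longlongrightarrow> 0) F"
    and e_pos: "0 < e"
  shows "\<forall>\<^sub>F z in F. pnorm K p (x + h z) \<le> (pnorm K p x powr p + B powr p) powr (1 / p) + e"
proof -
  have "\<forall>\<^sub>F n in sequentially. pnorm K p (restr {n..} x) < e / 2"
    using p_ge_1 x_mem e_pos by (intro order_tendstoD(2)[OF pnorm_tail_tendsto_0]) auto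
  then obtain n where n_tail_le: "pnorm K p (restr {n..} x) \<le> e / 2"
    using eventually_happens'[OF sequentially_bot] less_imp_le by blast
  have "\<forall>\<^sub>F z in F. pnorm K p (restr {..<n} (h z)) \<le> e / 2"
    using p_ge_1 h_null e_pos by (intro eventually_pnorm_head_le) auto
  with h_null(1) show ?thesis
    by eventually_elim
      (use pnorm_add_almost_disjoint_le[OF p_ge_1 x_mem _ order_refl _ n_tail_le] in fastforce)
qed

definition concentrates :: "real \<Rightarrow> 'z filter \<Rightarrow> ('z \<Rightarrow> nat \<Rightarrow> real) \<Rightarrow> (nat \<Rightarrow> real) \<Rightarrow> real \<Rightarrow> bool" where
  "concentrates r F G u c \<longleftrightarrow> u \<in> pspace K r \<and> (\<forall>i. ((\<lambda>z. G z i) \<longlongrightarrow> u i) F) \<and>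
    (\<forall>b>c. \<forall>\<^sub>F z in F. pnorm K r (G z - u) \<le> b)"

lemma eventually_pnorm_diff_le_of_concentrates:
  assumes r_ge_1: "1 \<le> r" and c_nonneg: "0 \<le> c" and conc: "concentrates r F G v c"
    and G_mem: "\<forall>\<^sub>F z in F. G z \<in> pspace K r"
    and u_near: "u \<in> pspace K r" "pnorm K r (v - u) \<le> \<Lambda>"
    and b_greater: "(\<Lambda> powr r + c powr r) powr (1 / r) < b"
  shows "\<forall>\<^sub>F z in F. pnorm K r (G z - u) \<le> b"
proof -
  interpret seminorm_on "pspace K r" "pnorm K r" by (rule seminorm_on_pnorm[OF r_ge_1])
  have v_mem: "v \<in> pspace K r" and G_tendsto: "\<And>i. ((\<lambda>z. G z i) \<longlongrightarrow> v i) F"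
    using conc by (auto simp: concentrates_def)
  obtain b' where b'_between: "(\<Lambda> powr r + c powr r) powr (1 / r) < b'" "b' < b"
    using dense[OF b_greater] by blast
  define d where "d = (b' powr r - \<Lambda> powr r) powr (1 / r)"
  have "((\<Lambda> powr r + c powr r) powr (1 / r)) powr r < b' powr r"
    using b'_between r_ge_1 by (intro powr_less_mono2) auto
  then have powr_less: "c powr r < b' powr r - \<Lambda> powr r" using r_ge_1 by (simp add: powr_powr)
  then have "(c powr r) powr (1 / r) < d" unfolding d_def using r_ge_1 by (intro powr_less_mono2) auto
  then have "c < d" using r_ge_1 c_nonneg by (simp add: powr_powr)
  have "0 \<le> b'" using b'_between(1) powr_ge_zero[of "\<Lambda> powr r + c powr r" "1 / r"] by linarith
  have "0 \<le> b' powr r - \<Lambda> powr r" using powr_less powr_ge_zero[of c r] by linarith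
  then have radius_eq: "(\<Lambda> powr r + d powr r) powr (1 / r) = b'"
    unfolding d_def using r_ge_1 \<open>0 \<le> b'\<close> by (simp add: powr_powr)
  have "((\<lambda>z. (G z - v) i) \<longlongrightarrow> 0) F" for i
    using tendsto_diff[OF G_tendsto[of i] tendsto_const[of "v i"]] by simp
  moreover have "\<forall>\<^sub>F z in F. pnorm K r (G z - v) \<le> d"
    using conc \<open>c < d\<close> by (simp add: concentrates_def)
  then have "\<forall>\<^sub>F z in F. G z - v \<in> pspace K r \<and> pnorm K r (G z - v) \<le> d"
    using G_mem by eventually_elim (simp add: mem_diff v_mem)
  ultimately have "\<forall>\<^sub>F z in F. pnorm K r ((v - u) + (G z - v))
      \<le> (pnorm K r (v - u) powr r + d powr r) powr (1 / r) + (b - b')"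
    using b'_between(2) by (intro eventually_pnorm_add_le[OF r_ge_1] mem_diff v_mem u_near) auto
  moreover have "(pnorm K r (v - u) powr r + d powr r) powr (1 / r) \<le> b'"
    unfolding radius_eq[symmetric] using r_ge_1 u_near(2) by (intro powr_mono2 add_right_mono) auto
  ultimately show ?thesis by (auto elim!: eventually_mono)
qed

lemma pnorm_section_limit_diff_le:
  assumes r_ge_1: "1 \<le> r" and \<Lambda>_nonneg: "0 \<le> \<Lambda>" and G_mem: "\<And>ns. length ns = Suc k \<Longrightarrow> G ns \<in> pspace K r"
    and exchange: "\<And>ns m. length ns = k \<Longrightarrow> pnorm K r (G (n # ns) - G (m # ns)) \<le> \<Lambda>"
    and section_limit: "\<And>i. ((\<lambda>ns. G (n # ns) i) \<longlongrightarrow> v i) (tuples k)"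
    and limit: "\<And>i. ((\<lambda>ns. G ns i) \<longlongrightarrow> u i) (tuples (Suc k))"
  shows "pnorm K r (v - u) \<le> \<Lambda>"
proof (rule pnorm_Fatou(2)[OF _ tuples_neq_bot _ \<Lambda>_nonneg])
  interpret seminorm_on "pspace K r" "pnorm K r" by (rule seminorm_on_pnorm[OF r_ge_1])
  have "((\<lambda>ns. G (n # tl ns) i) \<longlongrightarrow> v i) (tuples (Suc k))" for i
    using section_limit[of i] unfolding tendsto_def by (auto dest: eventually_tuples_tl)
  then show "((\<lambda>ns. (G (n # tl ns) - G ns) i) \<longlongrightarrow> (v - u) i) (tuples (Suc k))" for i
    unfolding minus_apply by (intro tendsto_diff limit)
  show "\<forall>\<^sub>F ns in tuples (Suc k). G (n # tl ns) - G ns \<in> pspace K r \<and> pnorm K r (G (n # tl ns) - G ns) \<le> \<Lambda>"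
    using eventually_tuples_length
  proof eventually_elim
    case (elim ns)
    then obtain m ms where ns_split: "ns = m # ms" "length ms = k" by (cases ns) auto
    then have "G (n # ms) - G (m # ms) \<in> pspace K r" by (intro mem_diff G_mem) auto
    then show ?case using exchange[OF ns_split(2), of m] by (simp add: ns_split(1))
  qed
qed (use r_ge_1 in simp)

lemma root_add_powr_scaled:
  fixes r \<Lambda> :: real
  assumes "1 \<le> r" "0 \<le> \<Lambda>"
  shows "(\<Lambda> powr r + (real k powr (1 / r) * \<Lambda>) powr r) powr (1 / r) = real (Suc k) powr (1 / r) * \<Lambda>"
proof -
  have "\<Lambda> powr r + (real k powr (1 / r) * \<Lambda>) powr r = real (Suc k) * \<Lambda> powr r"
    using assms by (simp add: powr_mult powr_powr distrib_right)
  then show ?thesis using assms by (simp add: powr_mult powr_powr)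
qed

lemma ex_concentrates_tuples:
  assumes r_ge_1: "1 \<le> r" and \<Lambda>_nonneg: "0 \<le> \<Lambda>"
    and "\<And>ns. length ns = k \<Longrightarrow> G ns \<in> pspace K r \<and> pnorm K r (G ns) \<le> B"
    and "\<And>as bs n m. length as + Suc (length bs) = k \<Longrightarrow>
      pnorm K r (G (as @ n # bs) - G (as @ m # bs)) \<le> \<Lambda>"
  shows "\<exists>u. concentrates r (tuples k) G u (real k powr (1 / r) * \<Lambda>)"
  using assms(3,4)
proof (induction k arbitrary: G)
  case 0
  have "pnorm K r (G [] - G []) = 0" using seminorm_on.zero[OF seminorm_on_pnorm[OF r_ge_1]] by simp
  then show ?case
    using 0 by (intro exI[of _ "G []"]) (auto simp: concentrates_def intro!: tendsto_eventually)
next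
  case (Suc k G)
  define c where "c = real k powr (1 / r) * \<Lambda>"
  have exchange: "pnorm K r (G ((n # as) @ n' # bs) - G ((n # as) @ m # bs)) \<le> \<Lambda>"
    if "length as + Suc (length bs) = k" for n as bs n' m
    using that by (intro Suc.prems(2)) simp
  have "\<exists>v. concentrates r (tuples k) (\<lambda>ns. G (n # ns)) v c" for n
    unfolding c_def by (rule Suc.IH) (use Suc.prems(1) exchange in \<open>simp_all only: append_Cons length_Cons\<close>)
  then obtain v where v_concentrates: "\<And>n. concentrates r (tuples k) (\<lambda>ns. G (n # ns)) (v n) c" by metis
  have bounded: "\<forall>\<^sub>F ns in tuples (Suc k). G ns \<in> pspace K r \<and> pnorm K r (G ns) \<le> B"
    using eventually_tuples_length by (rule eventually_mono) (rule Suc.prems(1))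
  obtain u where u_mem: "u \<in> pspace K r" and limit: "\<And>i. ((\<lambda>ns. G ns i) \<longlongrightarrow> u i) (tuples (Suc k))"
    using ultrafilter_coordinatewise_limit[OF ultrafilter_tuples _ bounded] r_ge_1 by auto
  have diff_le: "pnorm K r (v n - u) \<le> \<Lambda>" for n
  proof (rule pnorm_section_limit_diff_le[OF r_ge_1 \<Lambda>_nonneg _ _ _ limit])
    show "pnorm K r (G (n # ns) - G (m # ns)) \<le> \<Lambda>" if "length ns = k" for ns m
      using Suc.prems(2)[of "[]" ns n m] that by (simp only: append_Nil list.size add_0)
  qed (use Suc.prems(1) v_concentrates in \<open>auto simp: concentrates_def\<close>)
  have radius: "(\<Lambda> powr r + c powr r) powr (1 / r) = real (Suc k) powr (1 / r) * \<Lambda>"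
    unfolding c_def by (rule root_add_powr_scaled[OF r_ge_1 \<Lambda>_nonneg])
  have "\<forall>\<^sub>F ns in tuples k. pnorm K r (G (n # ns) - u) \<le> b" if "real (Suc k) powr (1 / r) * \<Lambda> < b" for n b
  proof (rule eventually_pnorm_diff_le_of_concentrates[OF r_ge_1 _ v_concentrates _ u_mem diff_le])
    show "\<forall>\<^sub>F ns in tuples k. G (n # ns) \<in> pspace K r"
      using eventually_tuples_length by (rule eventually_mono) (use Suc.prems(1) in simp)
  qed (use that \<Lambda>_nonneg radius in \<open>simp_all add: c_def\<close>)
  then show ?case using u_mem limit by (auto simp: concentrates_def eventually_tuples_Suc)
qed

end

section \<open>Renorming under a lower estimate\<close>

locale lower_estimate = seminorm_on V N
  for V :: "'a::real_vector set" and N :: "'a \<Rightarrow> real" +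
  fixes P :: "nat set \<Rightarrow> 'a \<Rightarrow> 'a" and q C :: real
  assumes linear_P: "linear (P E)"
    and P_P: "P A (P B x) = P (A \<inter> B) x"
    and P_Compl: "P A x + P (- A) x = x"
    and P_UNIV: "P UNIV x = x"
    and P_mem: "x \<in> V \<Longrightarrow> P E x \<in> V"
    and P_tail: "x \<in> V \<Longrightarrow> (\<lambda>n. N (P {n..} x)) \<longlonglongrightarrow> 0"
    and q_ge_1: "1 \<le> q" and C_pos: "0 < C"
    and lower: "x \<in> V \<Longrightarrow> sorted_wrt before Es \<Longrightarrow> (\<Sum>E\<leftarrow>Es. N (P E x) powr q) \<le> C * N x powr q"
begin

definition block_norm :: "'a \<Rightarrow> real" ("\<rho>") where
  "\<rho> x = (SUP Es\<in>{Es. sorted_wrt before Es}. (\<Sum>E\<leftarrow>Es. N (P E x) powr q) powr (1 / q))"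

lemma P_empty: "P {} x = 0"
  using P_Compl[of "{}" x] by (simp add: P_UNIV)

lemma P_head_tail: "P {..<n} x + P {n..} x = x"
proof -
  have "- {..<n} = {n..}" by auto
  then show ?thesis using P_Compl[of "{..<n}" x] by simp
qed

lemma sum_powr_nonneg: "0 \<le> (\<Sum>E\<leftarrow>Es. N (P E x) powr q)"
  by (intro sum_list_nonneg) auto

lemma sum_powr_root_le:
  assumes "x \<in> V" "sorted_wrt before Es"
  shows "(\<Sum>E\<leftarrow>Es. N (P E x) powr q) powr (1 / q) \<le> C powr (1 / q) * N x"
proof -
  have "(\<Sum>E\<leftarrow>Es. N (P E x) powr q) powr (1 / q) \<le> (C * N x powr q) powr (1 / q)"
    using lower[OF assms] q_ge_1 by (intro powr_mono2 sum_powr_nonneg) auto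
  then show ?thesis using q_ge_1 C_pos nonneg[OF assms(1)] by (simp add: powr_mult powr_powr)
qed

lemma bdd_above_sum_powr_root:
  "x \<in> V \<Longrightarrow> bdd_above ((\<lambda>Es. (\<Sum>E\<leftarrow>Es. N (P E x) powr q) powr (1 / q)) ` {Es. sorted_wrt before Es})"
  using sum_powr_root_le by (intro bdd_aboveI2) simp

lemma seminorm_on_block_norm: "seminorm_on V \<rho>"
proof -
  let ?root_sum = "\<lambda>x Es. (\<Sum>E\<leftarrow>Es. N (P E x) powr q) powr (1 / q)"
  have block: "seminorm_on V (\<lambda>x. N (P E x))" for E
    using P_mem
    by (intro seminorm_onI subspace)
      (simp_all add: linear_add[OF linear_P] linear_scale[OF linear_P] triangle scaleR)
  have "seminorm_on V (\<lambda>x. (\<Sum>E\<leftarrow>Es. N (P E x) powr q) powr (1 / q))" for Es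
    using seminorm_on_powr_sum[OF q_ge_1 subspace _ block, of "{..<length Es}" "\<lambda>_. 1" "\<lambda>j. Es ! j"]
    by (simp add: sum_list_sum_nth atLeast0LessThan)
  then have "seminorm_on {x \<in> V. bdd_above (?root_sum x ` {Es. sorted_wrt before Es})} \<rho>"
    unfolding block_norm_def by (intro seminorm_on_SUP) (auto intro: exI[of _ "[]"])
  moreover have "{x \<in> V. bdd_above (?root_sum x ` {Es. sorted_wrt before Es})} = V"
    using bdd_above_sum_powr_root by auto
  ultimately show ?thesis by simp
qed

sublocale rho: seminorm_on V \<rho>
  by (rule seminorm_on_block_norm)

lemma block_norm_le: "x \<in> V \<Longrightarrow> \<rho> x \<le> C powr (1 / q) * N x"
  unfolding block_norm_def by (rule cSUP_least) (auto intro: exI[of _ "[]"] sum_powr_root_le)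

lemma sum_powr_le_block_norm:
  assumes "x \<in> V" "sorted_wrt before Es"
  shows "(\<Sum>E\<leftarrow>Es. N (P E x) powr q) \<le> \<rho> x powr q"
proof -
  have "(\<Sum>E\<leftarrow>Es. N (P E x) powr q) powr (1 / q) \<le> \<rho> x"
    unfolding block_norm_def using assms by (intro cSUP_upper bdd_above_sum_powr_root) auto
  then have "((\<Sum>E\<leftarrow>Es. N (P E x) powr q) powr (1 / q)) powr q \<le> \<rho> x powr q"
    using q_ge_1 by (intro powr_mono2) auto
  then show ?thesis using q_ge_1 sum_powr_nonneg by (simp add: powr_powr)
qed

lemma block_norm_powr_least:
  assumes "x \<in> V" "\<And>Es. sorted_wrt before Es \<Longrightarrow> (\<Sum>E\<leftarrow>Es. N (P E x) powr q) \<le> A"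
  shows "\<rho> x powr q \<le> A"
proof -
  have A_nonneg: "0 \<le> A" using assms(2)[of "[]"] by simp
  have "\<rho> x \<le> A powr (1 / q)"
    unfolding block_norm_def using assms q_ge_1
    by (intro cSUP_least) (auto intro!: powr_mono2 sum_powr_nonneg intro: exI[of _ "[]"])
  then have "\<rho> x powr q \<le> (A powr (1 / q)) powr q"
    using q_ge_1 rho.nonneg[OF assms(1)] by (intro powr_mono2) auto
  then show ?thesis using q_ge_1 A_nonneg by (simp add: powr_powr)
qed

lemma le_block_norm:
  assumes "x \<in> V"
  shows "N x \<le> \<rho> x"
  using sum_powr_le_block_norm[OF assms, of "[UNIV]"] q_ge_1 rho.nonneg[OF assms]
  by (auto simp: P_UNIV intro: powr_le_powr_imp_le)

lemma block_norm_head_tail: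
  assumes x_mem: "x \<in> V"
  shows "\<rho> (P {..<n} x) powr q + \<rho> (P {n..} x) powr q \<le> \<rho> x powr q"
proof -
  have joined: "(\<Sum>E\<leftarrow>Es. N (P E (P {..<n} x)) powr q) + (\<Sum>E\<leftarrow>Fs. N (P E (P {n..} x)) powr q) \<le> \<rho> x powr q"
    if "sorted_wrt before Es" "sorted_wrt before Fs" for Es Fs
  proof -
    let ?Gs = "map (\<lambda>E. E \<inter> {..<n}) Es @ map (\<lambda>E. E \<inter> {n..}) Fs"
    have "sorted_wrt before ?Gs"
      using sorted_wrt_before_Int[OF that(1), of "{..<n}"] sorted_wrt_before_Int[OF that(2), of "{n..}"]
      by (auto simp: sorted_wrt_append before_def)
    from sum_powr_le_block_norm[OF x_mem this] show ?thesis by (simp add: P_P comp_def)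
  qed
  have "\<rho> (P {..<n} x) powr q \<le> \<rho> x powr q - (\<Sum>E\<leftarrow>Fs. N (P E (P {n..} x)) powr q)"
    if "sorted_wrt before Fs" for Fs
    using joined[OF _ that] by (intro block_norm_powr_least P_mem x_mem) (simp add: le_diff_eq)
  then have "\<rho> (P {n..} x) powr q \<le> \<rho> x powr q - \<rho> (P {..<n} x) powr q"
    by (intro block_norm_powr_least P_mem x_mem) (simp add: le_diff_eq add.commute)
  then show ?thesis by simp
qed

lemma block_norm_tail_tendsto_0:
  assumes "x \<in> V"
  shows "(\<lambda>n. \<rho> (P {n..} x)) \<longlonglongrightarrow> 0"
proof (rule tendsto_sandwich[OF _ _ tendsto_const])
  show "(\<lambda>n. C powr (1 / q) * N (P {n..} x)) \<longlonglongrightarrow> 0"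
    using tendsto_mult_left[OF P_tail[OF assms], of "C powr (1 / q)"] by simp
qed (use assms in \<open>auto intro!: always_eventually rho.nonneg block_norm_le P_mem\<close>)

text \<open>One of the heads of \<open>v + w\<close> and \<open>v - w\<close> is at least as large as the head of \<open>w\<close>.\<close>

lemma block_norm_tail_le:
  assumes v_mem: "v \<in> V" and w_mem: "w \<in> V" and diff_sum_le: "\<rho> (v - w) \<le> r" "\<rho> (v + w) \<le> r"
    and tail_w_le: "\<rho> (P {n..} w) \<le> \<eta>"
  shows "\<rho> (P {n..} v) powr q \<le> (r + \<eta>) powr q - (max 0 (\<rho> w - \<eta>)) powr q"
proof -
  define w' where "w' = P {..<n} w"
  have w'_mem: "w' \<in> V" unfolding w'_def by (rule P_mem[OF w_mem])
  have w'_eq: "w' = w - P {n..} w" by (simp add: w'_def eq_diff_eq P_head_tail)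
  have head_w': "P {..<n} w' = w'" by (simp add: w'_def P_P)
  have "{n..} \<inter> {..<n} = {}" by auto
  then have tail_w': "P {n..} w' = 0" by (simp add: w'_def P_P P_empty)
  have shifted_mem: "v + w' \<in> V" "v - w' \<in> V" by (simp_all add: mem_add mem_diff v_mem w'_mem)
  have shift: "v + w' = (v + w) - P {n..} w" "v - w' = (v - w) + P {n..} w"
    by (simp_all add: w'_eq)
  have shifted_le: "\<rho> (v + w') \<le> r + \<eta>" "\<rho> (v - w') \<le> r + \<eta>"
    unfolding shift
    using rho.triangle_diff[OF mem_add[OF v_mem w_mem] P_mem[OF w_mem], of "{n..}"]
      rho.triangle[OF mem_diff[OF v_mem w_mem] P_mem[OF w_mem], of "{n..}"] diff_sum_le tail_w_le by auto
  have double: "2 *\<^sub>R w' = P {..<n} (v + w') - P {..<n} (v - w')"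
    by (simp add: linear_add[OF linear_P] linear_diff[OF linear_P] head_w' scaleR_2)
  have "2 * \<rho> w' = \<rho> (2 *\<^sub>R w')" by (simp add: rho.scaleR[OF w'_mem])
  also have "\<dots> \<le> \<rho> (P {..<n} (v + w')) + \<rho> (P {..<n} (v - w'))"
    unfolding double by (intro rho.triangle_diff P_mem shifted_mem)
  finally have "2 * \<rho> w' \<le> \<rho> (P {..<n} (v + w')) + \<rho> (P {..<n} (v - w'))" .
  then consider "\<rho> w' \<le> \<rho> (P {..<n} (v + w'))" | "\<rho> w' \<le> \<rho> (P {..<n} (v - w'))" by linarith
  then obtain y where y_head: "y \<in> V" "\<rho> y \<le> r + \<eta>" "\<rho> w' \<le> \<rho> (P {..<n} y)" "P {n..} y = P {n..} v"
    using shifted_mem shifted_le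
    by cases (auto simp: linear_add[OF linear_P] linear_diff[OF linear_P] tail_w' intro: that)
  have "\<rho> w \<le> \<rho> w' + \<eta>"
    using rho.triangle[OF w'_mem P_mem[OF w_mem], of "{n..}"] tail_w_le by (simp add: w'_eq)
  then have "max 0 (\<rho> w - \<eta>) \<le> \<rho> (P {..<n} y)" using y_head(3) rho.nonneg[OF w'_mem] by simp
  then have "(max 0 (\<rho> w - \<eta>)) powr q \<le> \<rho> (P {..<n} y) powr q" using q_ge_1 by (intro powr_mono2) auto
  moreover have "\<rho> y powr q \<le> (r + \<eta>) powr q" using y_head q_ge_1 rho.nonneg by (intro powr_mono2) auto
  ultimately show ?thesis using block_norm_head_tail[OF y_head(1), of n] y_head(4) by simp
qed

lemma approximate_midpoint_tail:
  assumes a_mem: "a \<in> V" and b_mem: "b \<in> V" and \<eta>_pos: "0 < \<eta>"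
  obtains n where "\<And>v r. v \<in> V \<Longrightarrow> \<rho> (v - a) \<le> r \<Longrightarrow> \<rho> (v - b) \<le> r \<Longrightarrow>
    \<rho> (P {n..} (v - (a + b) /\<^sub>R 2)) powr q \<le> (r + \<eta>) powr q - (max 0 (\<rho> (a - b) / 2 - \<eta>)) powr q"
proof -
  define w where "w = (a - b) /\<^sub>R 2"
  have w_mem: "w \<in> V" unfolding w_def by (intro mem_scaleR mem_diff a_mem b_mem)
  have rho_w: "\<rho> w = \<rho> (a - b) / 2" unfolding w_def by (simp add: rho.scaleR mem_diff a_mem b_mem)
  have "\<forall>\<^sub>F n in sequentially. \<rho> (P {n..} w) < \<eta>"
    by (rule order_tendstoD(2)[OF block_norm_tail_tendsto_0[OF w_mem] \<eta>_pos])
  then obtain n where n_tail_le: "\<rho> (P {n..} w) \<le> \<eta>"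
    using eventually_happens'[OF sequentially_bot] less_imp_le by blast
  show ?thesis
  proof (rule that)
    fix v r assume v_mem: "v \<in> V" and dist_le: "\<rho> (v - a) \<le> r" "\<rho> (v - b) \<le> r"
    let ?v = "v - (a + b) /\<^sub>R 2"
    have "a = (a + b) /\<^sub>R 2 + w" "b = (a + b) /\<^sub>R 2 - w"
      unfolding w_def by (simp_all flip: scaleR_add_right scaleR_diff_right scaleR_2)
    then have "?v - w = v - a" "?v + w = v - b" by (simp_all add: algebra_simps)
    with dist_le have "\<rho> (?v - w) \<le> r" "\<rho> (?v + w) \<le> r" by (simp_all only:)
    from block_norm_tail_le[OF _ w_mem this n_tail_le]
    show "\<rho> (P {n..} ?v) powr q \<le> (r + \<eta>) powr q - (max 0 (\<rho> (a - b) / 2 - \<eta>)) powr q"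
      unfolding rho_w by (simp add: mem_diff mem_add mem_scaleR v_mem a_mem b_mem)
  qed
qed

end

section \<open>Images of approximate midpoints\<close>

lemma asymptotic_ratio:
  fixes d e :: "'a \<Rightarrow> real"
  assumes e_nonneg: "\<And>a. a \<in> A \<Longrightarrow> 0 \<le> e a" and e_le: "\<And>a. a \<in> A \<Longrightarrow> e a \<le> L * d a + L'"
    and unbounded: "\<And>\<theta>. \<exists>a\<in>A. \<theta> \<le> d a"
  obtains s where "0 \<le> s"
    "\<And>S. s < S \<Longrightarrow> \<exists>\<theta>. \<forall>a\<in>A. \<theta> \<le> d a \<longrightarrow> e a \<le> S * d a"
    "\<And>S \<theta>. S < s \<Longrightarrow> \<exists>a\<in>A. \<theta> \<le> d a \<and> S * d a < e a"
proof
  define B where "B = {S. \<exists>\<theta>. \<forall>a\<in>A. \<theta> \<le> d a \<longrightarrow> e a \<le> S * d a}"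
  have "e a \<le> (L + \<bar>L'\<bar>) * d a" if "a \<in> A" "1 \<le> d a" for a
    using e_le[OF that(1)] mult_left_mono[OF that(2), of "\<bar>L'\<bar>"] by (simp add: distrib_right)
  then have B_nonempty: "B \<noteq> {}" unfolding B_def by blast
  have B_nonneg: "0 \<le> S" if S_bound: "S \<in> B" for S
  proof -
    obtain \<theta> where \<theta>_bound: "\<forall>a\<in>A. \<theta> \<le> d a \<longrightarrow> e a \<le> S * d a" using S_bound by (auto simp: B_def)
    obtain a where a_far: "a \<in> A" "max \<theta> 1 \<le> d a" using unbounded by blast
    then have "0 \<le> S * d a" "0 < d a" using \<theta>_bound e_nonneg[OF a_far(1)] by force+
    then show ?thesis by (simp add: zero_le_mult_iff)
  qed
  show "0 \<le> Inf B" using B_nonempty B_nonneg by (rule cInf_greatest)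
  show "\<exists>\<theta>. \<forall>a\<in>A. \<theta> \<le> d a \<longrightarrow> e a \<le> S * d a" if S_bound: "Inf B < S" for S
  proof -
    obtain S' \<theta> where S'_less: "S' < S" and \<theta>_bound: "\<And>a. a \<in> A \<Longrightarrow> \<theta> \<le> d a \<Longrightarrow> e a \<le> S' * d a"
      using cInf_lessD[OF B_nonempty S_bound] by (auto simp: B_def)
    have "e a \<le> S * d a" if "a \<in> A" "max \<theta> 0 \<le> d a" for a
    proof -
      have "e a \<le> S' * d a" using \<theta>_bound that by simp
      also have "\<dots> \<le> S * d a" using S'_less that by (intro mult_right_mono) auto
      finally show ?thesis .
    qed
    then show ?thesis by blast
  qed
  show "\<exists>a\<in>A. \<theta> \<le> d a \<and> S * d a < e a" if "S < Inf B" for S \<theta>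
  proof -
    have "S \<notin> B" using that cInf_lower[OF _ bdd_belowI, of S B 0] B_nonneg by force
    then show ?thesis by (auto simp: B_def not_le)
  qed
qed

definition coarse_lipschitz_on ::
  "'a::real_vector set \<Rightarrow> ('a \<Rightarrow> real) \<Rightarrow> 'b::real_vector set \<Rightarrow> ('b \<Rightarrow> real) \<Rightarrow> real \<Rightarrow> ('a \<Rightarrow> 'b) \<Rightarrow> bool" where
  "coarse_lipschitz_on X M Y N L g \<longleftrightarrow>
    g ` X \<subseteq> Y \<and> (\<forall>x\<in>X. \<forall>y\<in>X. N (g x - g y) \<le> L * M (x - y) + L)"

lemma coarse_lipschitz_on_mem: "coarse_lipschitz_on X M Y N L g \<Longrightarrow> x \<in> X \<Longrightarrow> g x \<in> Y"
  by (auto simp: coarse_lipschitz_on_def)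

lemma coarse_lipschitz_on_le:
  "coarse_lipschitz_on X M Y N L g \<Longrightarrow> x \<in> X \<Longrightarrow> y \<in> X \<Longrightarrow> N (g x - g y) \<le> L * M (x - y) + L"
  by (simp add: coarse_lipschitz_on_def)

lemma asymptotic_slope:
  assumes X_seminorm: "seminorm_on X M" and Y_seminorm: "seminorm_on Y N"
    and coarse: "coarse_lipschitz_on X M Y N L g"
    and unbounded: "\<And>\<theta>. \<exists>x\<in>X. \<theta> \<le> M x"
  obtains s where "0 \<le> s"
    "\<And>S. s < S \<Longrightarrow> \<exists>\<theta>. \<forall>x\<in>X. \<forall>y\<in>X. \<theta> \<le> M (x - y) \<longrightarrow> N (g x - g y) \<le> S * M (x - y)"
    "\<And>S \<theta>. S < s \<Longrightarrow> \<exists>x\<in>X. \<exists>y\<in>X. \<theta> \<le> M (x - y) \<and> S * M (x - y) < N (g x - g y)"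
proof -
  interpret X: seminorm_on X M by fact
  interpret Y: seminorm_on Y N by fact
  have unbounded_diff: "\<exists>a\<in>X \<times> X. \<theta> \<le> M (fst a - snd a)" for \<theta>
  proof -
    obtain x where "x \<in> X" "\<theta> \<le> M x" using unbounded by blast
    then show ?thesis using X.mem_0 by (intro bexI[of _ "(x, 0)"]) auto
  qed
  have diff_nonneg: "0 \<le> N (g (fst a) - g (snd a))"
    and diff_le: "N (g (fst a) - g (snd a)) \<le> L * M (fst a - snd a) + L" if "a \<in> X \<times> X" for a
    using that coarse_lipschitz_on_mem[OF coarse] coarse_lipschitz_on_le[OF coarse]
    by (auto intro!: Y.nonneg Y.mem_diff)
  obtain s where "0 \<le> s"
    "\<And>S. s < S \<Longrightarrow> \<exists>\<theta>. \<forall>a\<in>X \<times> X. \<theta> \<le> M (fst a - snd a) \<longrightarrow>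
      N (g (fst a) - g (snd a)) \<le> S * M (fst a - snd a)"
    "\<And>S \<theta>. S < s \<Longrightarrow> \<exists>a\<in>X \<times> X. \<theta> \<le> M (fst a - snd a) \<and>
      S * M (fst a - snd a) < N (g (fst a) - g (snd a))"
    using asymptotic_ratio[of "X \<times> X" "\<lambda>a. N (g (fst a) - g (snd a))", OF diff_nonneg diff_le unbounded_diff]
    by blast
  then show ?thesis by (intro that[of s]) fastforce+
qed

definition steep_pair ::
  "'a::real_vector set \<Rightarrow> ('a \<Rightarrow> real) \<Rightarrow> ('b::real_vector \<Rightarrow> real) \<Rightarrow> ('a \<Rightarrow> 'b) \<Rightarrow> real \<Rightarrow> real \<Rightarrow> real \<Rightarrow>
    'a \<Rightarrow> 'a \<Rightarrow> bool" where
  "steep_pair X M N g s \<kappa> R y z \<longleftrightarrow> y \<in> X \<and> z \<in> X \<and> M (y - z) = 2 * R \<and> (s - \<kappa>) * R \<le> N (g y - g z) / 2 \<and>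
    (\<forall>u\<in>X. \<forall>v\<in>X. R / 2 \<le> M (u - v) \<longrightarrow> N (g u - g v) \<le> (s + \<kappa>) * M (u - v))"

lemma ex_steep_pairs:
  assumes "seminorm_on X M" "seminorm_on Y N" "coarse_lipschitz_on X M Y N L g" "\<And>\<theta>. \<exists>x\<in>X. \<theta> \<le> M x"
  obtains s where "0 \<le> s" "\<And>\<kappa> R0. 0 < \<kappa> \<Longrightarrow> \<exists>R\<ge>R0. \<exists>y z. steep_pair X M N g s \<kappa> R y z"
proof -
  obtain s where "0 \<le> s"
    and above: "\<And>S. s < S \<Longrightarrow> \<exists>\<theta>. \<forall>x\<in>X. \<forall>y\<in>X. \<theta> \<le> M (x - y) \<longrightarrow> N (g x - g y) \<le> S * M (x - y)"
    and below: "\<And>S \<theta>. S < s \<Longrightarrow> \<exists>x\<in>X. \<exists>y\<in>X. \<theta> \<le> M (x - y) \<and> S * M (x - y) < N (g x - g y)"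
    using asymptotic_slope[OF assms] by blast
  show ?thesis
  proof (rule that[OF \<open>0 \<le> s\<close>])
    fix \<kappa> R0 :: real assume "0 < \<kappa>"
    obtain \<theta> where slope: "\<And>u v. u \<in> X \<Longrightarrow> v \<in> X \<Longrightarrow> \<theta> \<le> M (u - v) \<Longrightarrow> N (g u - g v) \<le> (s + \<kappa>) * M (u - v)"
      using above[of "s + \<kappa>"] \<open>0 < \<kappa>\<close> by auto
    obtain y z where pair: "y \<in> X" "z \<in> X" and far: "max (4 * \<theta>) (2 * R0) \<le> M (y - z)"
      and steep: "(s - \<kappa>) * M (y - z) < N (g y - g z)"
      using below[of "s - \<kappa>" "max (4 * \<theta>) (2 * R0)"] \<open>0 < \<kappa>\<close> by auto
    have "steep_pair X M N g s \<kappa> (M (y - z) / 2) y z"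
      unfolding steep_pair_def using pair far steep slope by auto
    then show "\<exists>R\<ge>R0. \<exists>y z. steep_pair X M N g s \<kappa> R y z" using far by (intro exI[of _ "M (y - z) / 2"]) auto
  qed
qed

lemma midpoint_gain_less:
  fixes s \<epsilon> p q :: real
  assumes "0 \<le> s" "0 < \<epsilon>" "1 \<le> q" "q < p"
  obtains l where "0 < l" "l \<le> 1/2" "(s * (1 + l powr p) powr (1 / p)) powr q - s powr q < (\<epsilon> * l) powr q"
proof -
  have "((\<lambda>l. s powr q * l powr (p - q)) \<longlongrightarrow> s powr q * 0 powr (p - q)) (at_right 0)"
    using assms
    by (intro tendsto_intros tendsto_powr')
      (auto simp: eventually_at_right_less less_imp_le intro: eventually_mono[OF eventually_at_right_less])
  then have "\<forall>\<^sub>F l in at_right 0. s powr q * l powr (p - q) < \<epsilon> powr q"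
    by (rule order_tendstoD) (use assms in auto)
  moreover have "\<forall>\<^sub>F l in at_right (0::real). l \<in> {0<..<1/2}"
    by (rule eventually_at_right_real) simp
  ultimately have "\<forall>\<^sub>F l in at_right 0. s powr q * l powr (p - q) < \<epsilon> powr q \<and> l \<in> {0<..<1/2}"
    by (rule eventually_conj)
  then obtain l where l_small: "s powr q * l powr (p - q) < \<epsilon> powr q" "0 < l" "l < 1/2"
    using eventually_happens'[OF trivial_limit_at_right_real] by force
  define g where "g = (1 + l powr p) powr (1 / p)"
  have "g powr q = (1 + l powr p) powr (q / p)" by (simp add: g_def powr_powr)
  also have "\<dots> \<le> (1 + l powr p) powr 1" using assms by (intro powr_mono) auto
  finally have g_powr_le: "g powr q \<le> 1 + l powr p" by (simp add: add_nonneg_nonneg)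
  have "(s * g) powr q - s powr q = s powr q * (g powr q - 1)"
    using assms by (simp add: powr_mult g_def algebra_simps)
  also have "\<dots> \<le> s powr q * l powr p" using g_powr_le by (intro mult_left_mono) auto
  also have "\<dots> = (s powr q * l powr (p - q)) * l powr q" using l_small by (simp flip: powr_add)
  also have "\<dots> < \<epsilon> powr q * l powr q" using l_small by (intro mult_strict_right_mono) auto
  also have "\<dots> = (\<epsilon> * l) powr q" using l_small assms by (simp add: powr_mult)
  finally show ?thesis using l_small that by (simp add: g_def)
qed

lemma ex_midpoint_slack:
  fixes s g a q :: real
  assumes "0 \<le> s" "0 \<le> g" "0 < q" and gain: "(s * g) powr q - s powr q < a"
  shows "\<exists>\<kappa>>0. ((s + \<kappa>) * (g + \<kappa>) + \<kappa>) powr q - (max 0 (s - 2 * \<kappa>)) powr q < a"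
proof -
  have "((\<lambda>\<kappa>. \<bar>(s + \<kappa>) * (g + \<kappa>) + \<kappa>\<bar> powr q - (max 0 (s - 2 * \<kappa>)) powr q)
      \<longlongrightarrow> \<bar>(s + 0) * (g + 0) + 0\<bar> powr q - (max 0 (s - 2 * 0)) powr q) (at_right 0)"
    using assms by (intro tendsto_intros tendsto_powr' tendsto_max) auto
  then have "\<forall>\<^sub>F \<kappa> in at_right 0. \<bar>(s + \<kappa>) * (g + \<kappa>) + \<kappa>\<bar> powr q - (max 0 (s - 2 * \<kappa>)) powr q < a"
    by (rule order_tendstoD) (use assms in auto)
  then have "\<forall>\<^sub>F \<kappa> in at_right 0.
      \<bar>(s + \<kappa>) * (g + \<kappa>) + \<kappa>\<bar> powr q - (max 0 (s - 2 * \<kappa>)) powr q < a \<and> 0 < \<kappa>"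
    using eventually_at_right_less by (rule eventually_conj)
  from eventually_happens'[OF trivial_limit_at_right_real this]
  obtain \<kappa> where "\<bar>(s + \<kappa>) * (g + \<kappa>) + \<kappa>\<bar> powr q - (max 0 (s - 2 * \<kappa>)) powr q < a" "0 < \<kappa>"
    by blast
  then show ?thesis using assms(1,2) by (intro exI[of _ \<kappa>]) simp
qed

lemma midpoint_parameters:
  fixes s \<epsilon> p q :: real
  assumes "0 \<le> s" "0 < \<epsilon>" "1 \<le> q" "q < p"
  obtains l \<kappa> where "0 < l" "l \<le> 1/2" "0 < \<kappa>"
    "\<And>R m. 0 < R \<Longrightarrow> (s - \<kappa>) * R \<le> m \<Longrightarrow>
      ((s + \<kappa>) * (((1 + l powr p) powr (1 / p) + \<kappa>) * R) + \<kappa> * R) powr q - (max 0 (m - \<kappa> * R)) powr q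
        \<le> (\<epsilon> * l * R) powr q"
proof -
  obtain l where l_bounds: "0 < l" "l \<le> 1/2"
    and gain: "(s * (1 + l powr p) powr (1 / p)) powr q - s powr q < (\<epsilon> * l) powr q"
    using midpoint_gain_less[OF assms] by blast
  define g where "g = (1 + l powr p) powr (1 / p)"
  obtain \<kappa> where "0 < \<kappa>"
    and slack: "((s + \<kappa>) * (g + \<kappa>) + \<kappa>) powr q - (max 0 (s - 2 * \<kappa>)) powr q < (\<epsilon> * l) powr q"
    using ex_midpoint_slack[of s g q] assms gain by (auto simp: g_def)
  show ?thesis
  proof (rule that[OF l_bounds \<open>0 < \<kappa>\<close>])
    fix R m :: real assume R_pos: "0 < R" and m_ge: "(s - \<kappa>) * R \<le> m"
    define u v where "u = (s + \<kappa>) * (g + \<kappa>) + \<kappa>" and "v = max 0 (s - 2 * \<kappa>)"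
    have "v * R \<le> max 0 (m - \<kappa> * R)"
    proof (cases "s \<le> 2 * \<kappa>")
      case False
      then have "v * R = (s - \<kappa>) * R - \<kappa> * R" by (simp add: v_def algebra_simps)
      then show ?thesis using m_ge by simp
    qed (simp add: v_def)
    then have "(v * R) powr q \<le> (max 0 (m - \<kappa> * R)) powr q"
      using R_pos assms by (intro powr_mono2) (auto simp: v_def)
    then have "(u * R) powr q - (max 0 (m - \<kappa> * R)) powr q \<le> (u * R) powr q - (v * R) powr q"
      by simp
    also have "\<dots> = (u powr q - v powr q) * R powr q" by (simp add: powr_mult left_diff_distrib)
    also have "\<dots> \<le> (\<epsilon> * l) powr q * R powr q"
      using slack by (intro mult_right_mono) (simp_all add: u_def v_def)
    also have "\<dots> = (\<epsilon> * l * R) powr q" by (simp add: powr_mult)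
    finally show "((s + \<kappa>) * (((1 + l powr p) powr (1 / p) + \<kappa>) * R) + \<kappa> * R) powr q
        - (max 0 (m - \<kappa> * R)) powr q \<le> (\<epsilon> * l * R) powr q"
      by (simp add: u_def g_def algebra_simps)
  qed
qed

definition unit_null :: "(nat \<Rightarrow> real) set \<Rightarrow> real \<Rightarrow> 'z filter \<Rightarrow> ('z \<Rightarrow> nat \<Rightarrow> real) \<Rightarrow> bool" where
  "unit_null K p F e \<longleftrightarrow> (\<forall>\<^sub>F z in F. e z \<in> pspace K p \<and> pnorm K p (e z) \<le> 1) \<and>
    (\<forall>i. ((\<lambda>z. e z i) \<longlongrightarrow> 0) F)"

lemma (in tsirelson_weights) eventually_pnorm_add_scaled_bounds:
  assumes p_ge_1: "1 \<le> p" and h_norm: "h \<in> pspace K p" "pnorm K p h = R" "0 < R"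
    and e_null: "unit_null K p F e"
    and l_bounds: "0 \<le> l" "l \<le> 1/2" and \<kappa>_pos: "0 < \<kappa>"
  shows "\<forall>\<^sub>F z in F. R / 2 \<le> pnorm K p (h + (l * R) *\<^sub>R e z) \<and>
    pnorm K p (h + (l * R) *\<^sub>R e z) \<le> ((1 + l powr p) powr (1 / p) + \<kappa>) * R"
proof -
  interpret seminorm_on "pspace K p" "pnorm K p" by (rule seminorm_on_pnorm[OF p_ge_1])
  have unit: "\<forall>\<^sub>F z in F. e z \<in> pspace K p \<and> pnorm K p (e z) \<le> 1" and null: "\<And>i. ((\<lambda>z. e z i) \<longlongrightarrow> 0) F"
    using e_null by (auto simp: unit_null_def)
  have scaled: "\<forall>\<^sub>F z in F. (l * R) *\<^sub>R e z \<in> pspace K p \<and> pnorm K p ((l * R) *\<^sub>R e z) \<le> l * R"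
    using unit by eventually_elim (use l_bounds h_norm(3) in \<open>simp add: mem_scaleR scaleR mult_left_le\<close>)
  have "\<forall>\<^sub>F z in F. pnorm K p (h + (l * R) *\<^sub>R e z) \<le> (R powr p + (l * R) powr p) powr (1 / p) + \<kappa> * R"
    unfolding h_norm(2)[symmetric]
  proof (rule eventually_pnorm_add_le[OF p_ge_1 h_norm(1)])
    show "((\<lambda>z. ((l * pnorm K p h) *\<^sub>R e z) i) \<longlongrightarrow> 0) F" for i
      using tendsto_mult_right_zero[OF null, of "l * pnorm K p h" i] by simp
  qed (use scaled h_norm \<kappa>_pos in auto)
  moreover have "(R powr p + (l * R) powr p) powr (1 / p) = (1 + l powr p) powr (1 / p) * R"
  proof -
    have "R powr p + (l * R) powr p = (1 + l powr p) * R powr p"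
      by (simp add: powr_mult distrib_right)
    then show ?thesis using h_norm(3) p_ge_1 by (simp add: powr_mult powr_powr)
  qed
  moreover have "\<forall>\<^sub>F z in F. R / 2 \<le> pnorm K p (h + (l * R) *\<^sub>R e z)"
    using scaled
  proof eventually_elim
    case (elim z)
    have "R \<le> pnorm K p (h + (l * R) *\<^sub>R e z) + pnorm K p ((l * R) *\<^sub>R e z)"
      using triangle_diff[of "h + (l * R) *\<^sub>R e z" "(l * R) *\<^sub>R e z"] elim h_norm by (simp add: mem_add)
    moreover have "l * R \<le> R / 2" using l_bounds h_norm(3) by simp
    ultimately show ?case using elim by simp
  qed
  ultimately show ?thesis by (simp add: eventually_conj distrib_right)
qed

lemma (in weights) pnorm_unbounded:
  assumes "1 \<le> p"
  shows "\<exists>x\<in>pspace K p. \<theta> \<le> pnorm K p x"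
proof -
  interpret seminorm_on "pspace K p" "pnorm K p" by (rule seminorm_on_pnorm[OF assms])
  let ?x = "\<theta> *\<^sub>R indicator {0} :: nat \<Rightarrow> real"
  have x_mem: "?x \<in> pspace K p" by (intro mem_scaleR pspace_indicator) simp
  have "\<theta> \<le> pnorm K p ?x" using abs_le_pnorm[OF x_mem, of 0] assms by simp
  then show ?thesis using x_mem by blast
qed

context lower_estimate begin

lemma coarse_lipschitz_on_block_norm:
  assumes coarse: "coarse_lipschitz_on X M V N L g"
  shows "coarse_lipschitz_on X M V \<rho> (C powr (1 / q) * L) g"
proof -
  note mem = coarse_lipschitz_on_mem[OF coarse]
  have "\<rho> (g x - g y) \<le> C powr (1 / q) * L * M (x - y) + C powr (1 / q) * L" if "x \<in> X" "y \<in> X" for x y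
  proof -
    have "\<rho> (g x - g y) \<le> C powr (1 / q) * N (g x - g y)"
      by (intro block_norm_le mem_diff mem that)
    also have "\<dots> \<le> C powr (1 / q) * (L * M (x - y) + L)"
      by (intro mult_left_mono coarse_lipschitz_on_le[OF coarse] that) simp
    finally show ?thesis by (simp add: algebra_simps)
  qed
  then show ?thesis using mem by (auto simp: coarse_lipschitz_on_def)
qed

lemma eventually_image_tail_le:
  assumes K0_weights: "tsirelson_weights K0" and p_ge_1: "1 \<le> p" and g_range: "g ` pspace K0 p \<subseteq> V"
    and pair: "steep_pair (pspace K0 p) (pnorm K0 p) \<rho> g s \<kappa> R y1 y2"
    and R_pos: "0 < R" and s_nonneg: "0 \<le> s" and \<kappa>_pos: "0 < \<kappa>"
    and e_null: "unit_null K0 p F e" and l_bounds: "0 \<le> l" "l \<le> 1/2"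
  obtains n where "\<forall>\<^sub>F z in F.
    \<rho> (P {n..} (g ((y1 + y2) /\<^sub>R 2 + (l * R) *\<^sub>R e z) - (g y1 + g y2) /\<^sub>R 2)) powr q
      \<le> ((s + \<kappa>) * (((1 + l powr p) powr (1 / p) + \<kappa>) * R) + \<kappa> * R) powr q
        - (max 0 (\<rho> (g y1 - g y2) / 2 - \<kappa> * R)) powr q"
proof -
  interpret source: tsirelson_weights K0 by fact
  interpret source: seminorm_on "pspace K0 p" "pnorm K0 p" by (rule source.seminorm_on_pnorm[OF p_ge_1])
  have g_mem: "g x \<in> V" if "x \<in> pspace K0 p" for x using g_range that by blast
  have y_mem: "y1 \<in> pspace K0 p" "y2 \<in> pspace K0 p" and dist: "pnorm K0 p (y1 - y2) = 2 * R"
    and slope: "\<And>u v. u \<in> pspace K0 p \<Longrightarrow> v \<in> pspace K0 p \<Longrightarrow> R / 2 \<le> pnorm K0 p (u - v) \<Longrightarrow>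
      \<rho> (g u - g v) \<le> (s + \<kappa>) * pnorm K0 p (u - v)"
    using pair by (auto simp: steep_pair_def)
  let ?r = "(s + \<kappa>) * (((1 + l powr p) powr (1 / p) + \<kappa>) * R)"
  define x h where "x = (y1 + y2) /\<^sub>R 2" and "h = (y1 - y2) /\<^sub>R 2"
  have x_mem: "x \<in> pspace K0 p" and h_mem: "h \<in> pspace K0 p" "- h \<in> pspace K0 p"
    unfolding x_def h_def by (intro source.mem_scaleR source.mem_add source.mem_diff source.mem_uminus y_mem)+
  have h_norm: "pnorm K0 p h = R" "pnorm K0 p (- h) = R"
    unfolding source.uminus[OF h_mem(1)] using dist
    by (simp_all add: h_def source.scaleR source.mem_diff y_mem)
  have shift: "x + u - y1 = - h + u" "x + u - y2 = h + u" for u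
    by (auto simp: x_def h_def fun_eq_iff field_simps)
  obtain n where n_tail: "\<And>v r. v \<in> V \<Longrightarrow> \<rho> (v - g y1) \<le> r \<Longrightarrow> \<rho> (v - g y2) \<le> r \<Longrightarrow>
      \<rho> (P {n..} (v - (g y1 + g y2) /\<^sub>R 2)) powr q
        \<le> (r + \<kappa> * R) powr q - (max 0 (\<rho> (g y1 - g y2) / 2 - \<kappa> * R)) powr q"
    using approximate_midpoint_tail[OF g_mem[OF y_mem(1)] g_mem[OF y_mem(2)], of "\<kappa> * R"] \<kappa>_pos R_pos by auto
  note bounds = source.eventually_pnorm_add_scaled_bounds[OF p_ge_1 _ _ R_pos e_null l_bounds \<kappa>_pos]
  have unit: "\<forall>\<^sub>F z in F. e z \<in> pspace K0 p \<and> pnorm K0 p (e z) \<le> 1" using e_null by (simp add: unit_null_def)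
  have "\<forall>\<^sub>F z in F. \<rho> (P {n..} (g (x + (l * R) *\<^sub>R e z) - (g y1 + g y2) /\<^sub>R 2)) powr q
      \<le> (?r + \<kappa> * R) powr q - (max 0 (\<rho> (g y1 - g y2) / 2 - \<kappa> * R)) powr q"
    using unit bounds[OF h_mem(1) h_norm(1)] bounds[OF h_mem(2) h_norm(2)]
  proof eventually_elim
    case (elim z)
    let ?w = "x + (l * R) *\<^sub>R e z"
    have w_mem: "?w \<in> pspace K0 p" using elim(1) by (intro source.mem_add source.mem_scaleR x_mem) auto
    have "\<rho> (g ?w - g y) \<le> ?r" if "y \<in> pspace K0 p" "R / 2 \<le> pnorm K0 p (?w - y)"
      "pnorm K0 p (?w - y) \<le> ((1 + l powr p) powr (1 / p) + \<kappa>) * R" for y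
      using slope[OF w_mem that(1,2)] mult_left_mono[OF that(3), of "s + \<kappa>"] s_nonneg \<kappa>_pos by linarith
    then show ?case using elim by (intro n_tail g_mem w_mem) (auto simp: shift y_mem)
  qed
  then show ?thesis using that unfolding x_def by blast
qed

lemma ex_image_tail_small:
  assumes K0_weights: "tsirelson_weights K0" and p_ge_1: "1 \<le> p" and g_range: "g ` pspace K0 p \<subseteq> V"
    and pair: "steep_pair (pspace K0 p) (pnorm K0 p) \<rho> g s \<kappa> R y1 y2"
    and R_pos: "0 < R" and s_nonneg: "0 \<le> s" and \<kappa>_pos: "0 < \<kappa>"
    and e_null: "unit_null K0 p F e" and l_bounds: "0 \<le> l" "l \<le> 1/2" and \<delta>_nonneg: "0 \<le> \<delta>"
    and small: "((s + \<kappa>) * (((1 + l powr p) powr (1 / p) + \<kappa>) * R) + \<kappa> * R) powr q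
      - (max 0 (\<rho> (g y1 - g y2) / 2 - \<kappa> * R)) powr q \<le> \<delta> powr q"
  shows "\<exists>n. \<forall>\<^sub>F z in F. N (P {n..} (g ((y1 + y2) /\<^sub>R 2 + (l * R) *\<^sub>R e z) - (g y1 + g y2) /\<^sub>R 2)) \<le> \<delta>"
proof -
  interpret source: tsirelson_weights K0 by fact
  interpret source: seminorm_on "pspace K0 p" "pnorm K0 p" by (rule source.seminorm_on_pnorm[OF p_ge_1])
  have y_mem: "y1 \<in> pspace K0 p" "y2 \<in> pspace K0 p" using pair by (auto simp: steep_pair_def)
  define w where "w z = (y1 + y2) /\<^sub>R 2 + (l * R) *\<^sub>R e z" for z
  define c where "c = (g y1 + g y2) /\<^sub>R 2"
  obtain n where "\<forall>\<^sub>F z in F. \<rho> (P {n..} (g (w z) - c)) powr q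
      \<le> ((s + \<kappa>) * (((1 + l powr p) powr (1 / p) + \<kappa>) * R) + \<kappa> * R) powr q
        - (max 0 (\<rho> (g y1 - g y2) / 2 - \<kappa> * R)) powr q"
    using eventually_image_tail_le[OF K0_weights p_ge_1 g_range pair R_pos s_nonneg \<kappa>_pos e_null l_bounds]
    unfolding w_def c_def by blast
  moreover have "\<forall>\<^sub>F z in F. e z \<in> pspace K0 p"
    using e_null by (auto simp: unit_null_def elim: eventually_mono)
  ultimately have "\<forall>\<^sub>F z in F. N (P {n..} (g (w z) - c)) \<le> \<delta>"
  proof eventually_elim
    case (elim z)
    have "w z \<in> pspace K0 p" unfolding w_def using elim(2) by (intro source.mem_add source.mem_scaleR y_mem)
    then have "g (w z) - c \<in> V" unfolding c_def
      using g_range y_mem by (intro mem_diff mem_scaleR mem_add) auto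
    then have "N (P {n..} (g (w z) - c)) \<le> \<rho> (P {n..} (g (w z) - c))"
      by (intro le_block_norm P_mem)
    also have "\<dots> \<le> \<delta>"
      by (rule powr_le_powr_imp_le[OF order_trans[OF elim(1) small]]) (use q_ge_1 \<delta>_nonneg in auto)
    finally show ?case .
  qed
  then show ?thesis unfolding w_def c_def by blast
qed

text \<open>The points \<open>x + \<tau> *\<^sub>R e z\<close> are approximate midpoints of a pair that nearly attains the asymptotic slope
  of \<open>g\<close>. The smallness relative to \<open>\<tau>\<close> comes from \<open>q < p\<close>.\<close>

lemma ex_small_image_tails:
  assumes K0_weights: "tsirelson_weights K0" and q_less_p: "q < p"
    and coarse: "coarse_lipschitz_on (pspace K0 p) (pnorm K0 p) V N L g"
    and e_null: "unit_null K0 p F e" and \<epsilon>_pos: "0 < \<epsilon>" and \<tau>0_pos: "0 < \<tau>0"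
  obtains \<tau> x c n where "\<tau>0 \<le> \<tau>" "x \<in> pspace K0 p" "c \<in> V"
    "\<forall>\<^sub>F z in F. N (P {n..} (g (x + \<tau> *\<^sub>R e z) - c)) \<le> \<epsilon> * \<tau>"
proof -
  interpret source: tsirelson_weights K0 by fact
  have p_ge_1: "1 \<le> p" using q_less_p q_ge_1 by simp
  interpret source: seminorm_on "pspace K0 p" "pnorm K0 p" by (rule source.seminorm_on_pnorm[OF p_ge_1])
  note g_mem = coarse_lipschitz_on_mem[OF coarse]
  obtain s where s_nonneg: "0 \<le> s" and steep_pairs: "\<And>\<kappa> R0. 0 < \<kappa> \<Longrightarrow>
      \<exists>R\<ge>R0. \<exists>y1 y2. steep_pair (pspace K0 p) (pnorm K0 p) \<rho> g s \<kappa> R y1 y2"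
    using ex_steep_pairs[OF source.seminorm_on_axioms rho.seminorm_on_axioms
        coarse_lipschitz_on_block_norm[OF coarse] source.pnorm_unbounded[OF p_ge_1]] by blast
  obtain l \<kappa> where l_bounds: "0 < l" "l \<le> 1/2" and \<kappa>_pos: "0 < \<kappa>"
    and parameters: "\<And>R m. 0 < R \<Longrightarrow> (s - \<kappa>) * R \<le> m \<Longrightarrow>
      ((s + \<kappa>) * (((1 + l powr p) powr (1 / p) + \<kappa>) * R) + \<kappa> * R) powr q - (max 0 (m - \<kappa> * R)) powr q
        \<le> (\<epsilon> * l * R) powr q"
    using midpoint_parameters[OF s_nonneg \<epsilon>_pos q_ge_1 q_less_p] by blast
  obtain R y1 y2 where "\<tau>0 / l \<le> R" and pair: "steep_pair (pspace K0 p) (pnorm K0 p) \<rho> g s \<kappa> R y1 y2"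
    using steep_pairs[OF \<kappa>_pos] by blast
  then have \<tau>0_le: "\<tau>0 \<le> l * R" using l_bounds(1) by (simp add: pos_divide_le_eq mult.commute)
  then have R_pos: "0 < R" using \<tau>0_pos l_bounds by (metis less_le_trans zero_less_mult_pos)
  have y_mem: "y1 \<in> pspace K0 p" "y2 \<in> pspace K0 p" and steep: "(s - \<kappa>) * R \<le> \<rho> (g y1 - g y2) / 2"
    using pair by (auto simp: steep_pair_def)
  define x c where "x = (y1 + y2) /\<^sub>R 2" and "c = (g y1 + g y2) /\<^sub>R 2"
  have x_mem: "x \<in> pspace K0 p" and c_mem: "c \<in> V"
    unfolding x_def c_def by (intro source.mem_scaleR source.mem_add mem_scaleR mem_add g_mem y_mem)+
  have "g ` pspace K0 p \<subseteq> V" "0 \<le> \<epsilon> * l * R" using g_mem \<epsilon>_pos l_bounds R_pos by auto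
  then have "\<exists>n. \<forall>\<^sub>F z in F. N (P {n..} (g (x + (l * R) *\<^sub>R e z) - c)) \<le> \<epsilon> * l * R"
    unfolding x_def c_def using l_bounds parameters[OF R_pos steep]
    by (intro ex_image_tail_small[OF K0_weights p_ge_1 _ pair R_pos s_nonneg \<kappa>_pos e_null]) auto
  then show ?thesis using that \<tau>0_le x_mem c_mem by (auto simp: mult.assoc)
qed

end

section \<open>Finite direct sums\<close>

definition dspace :: "(nat \<Rightarrow> real) set \<Rightarrow> ('i \<Rightarrow> real) \<Rightarrow> 'i set \<Rightarrow> ('i \<Rightarrow> nat \<Rightarrow> real) set" where
  "dspace K ps I = {y. \<forall>i\<in>I. y i \<in> pspace K (ps i)}"

definition dnorm :: "(nat \<Rightarrow> real) set \<Rightarrow> ('i \<Rightarrow> real) \<Rightarrow> 'i set \<Rightarrow> ('i \<Rightarrow> nat \<Rightarrow> real) \<Rightarrow> real" where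
  "dnorm K ps I y = (\<Sum>i\<in>I. pnorm K (ps i) (y i))"

lemma dnorm_nonneg [simp]: "0 \<le> dnorm K ps I y"
  by (simp add: dnorm_def sum_nonneg)

lemma pnorm_le_dnorm: "finite I \<Longrightarrow> i \<in> I \<Longrightarrow> pnorm K (ps i) (y i) \<le> dnorm K ps I y"
  unfolding dnorm_def by (intro member_le_sum[where f = "\<lambda>i. pnorm K (ps i) (y i)"]) auto

lemma dnorm_mono_index: "finite J \<Longrightarrow> I \<subseteq> J \<Longrightarrow> dnorm K ps I y \<le> dnorm K ps J y"
  unfolding dnorm_def by (rule sum_mono2) auto

lemma dspace_antimono: "I \<subseteq> J \<Longrightarrow> dspace K ps J \<subseteq> dspace K ps I"
  by (auto simp: dspace_def)

lemma powr_sum_le: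
  fixes a :: "'i \<Rightarrow> real"
  assumes finite_I: "finite I" and a_nonneg: "\<And>i. i \<in> I \<Longrightarrow> 0 \<le> a i" and q_pos: "0 < q"
  shows "(\<Sum>i\<in>I. a i) powr q \<le> real (card I) powr q * (\<Sum>i\<in>I. a i powr q)"
proof -
  define S where "S = (\<Sum>i\<in>I. a i powr q)"
  have S_nonneg: "0 \<le> S" by (simp add: S_def sum_nonneg)
  have "a i \<le> S powr (1 / q)" if "i \<in> I" for i
  proof (rule powr_le_powr_imp_le)
    have "a i powr q \<le> S"
      unfolding S_def using that finite_I by (intro member_le_sum[where f = "\<lambda>i. a i powr q"]) auto
    then show "a i powr q \<le> (S powr (1 / q)) powr q" using q_pos S_nonneg by (simp add: powr_powr)
  qed (use q_pos in auto)
  then have "(\<Sum>i\<in>I. a i) \<le> real (card I) * S powr (1 / q)"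
    using sum_mono[of I a "\<lambda>_. S powr (1 / q)"] by simp
  then have "(\<Sum>i\<in>I. a i) powr q \<le> (real (card I) * S powr (1 / q)) powr q"
    using q_pos a_nonneg by (intro powr_mono2 sum_nonneg) auto
  then show ?thesis using q_pos S_nonneg by (simp add: powr_mult powr_powr S_def)
qed

lemma ex_dnorm_center_Un:
  assumes "finite I" "finite J" and disjoint: "I \<inter> J = {}"
    and centers_mem: "c1 \<in> dspace K ps I" "c2 \<in> dspace K ps J"
  shows "\<exists>c\<in>dspace K ps (I \<union> J).
    \<forall>y. dnorm K ps (I \<union> J) (y - c) = dnorm K ps I (y - c1) + dnorm K ps J (y - c2)"
proof (intro bexI allI)
  let ?c = "\<lambda>i. if i \<in> I then c1 i else c2 i"
  show "?c \<in> dspace K ps (I \<union> J)" using centers_mem by (auto simp: dspace_def)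
  show "dnorm K ps (I \<union> J) (y - ?c) = dnorm K ps I (y - c1) + dnorm K ps J (y - c2)" for y
    unfolding dnorm_def sum.union_disjoint[OF assms(1-3)]
    using disjoint by (intro arg_cong2[of _ _ _ _ "(+)"] sum.cong) auto
qed

context tsirelson_weights begin

lemma seminorm_on_dnorm: "(\<And>i. i \<in> I \<Longrightarrow> 1 \<le> ps i) \<Longrightarrow> seminorm_on (dspace K ps I) (dnorm K ps I)"
  unfolding dspace_def dnorm_def by (intro seminorm_on_direct_sum seminorm_on_pnorm)

lemma dspace_restr: "y \<in> dspace K ps I \<Longrightarrow> restr E \<circ> y \<in> dspace K ps I"
  by (simp add: dspace_def pspace_restr)

lemma dnorm_tail_tendsto_0:
  assumes "y \<in> dspace K ps I" "\<And>i. i \<in> I \<Longrightarrow> 1 \<le> ps i"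
  shows "(\<lambda>n. dnorm K ps I (restr {n..} \<circ> y)) \<longlonglongrightarrow> 0"
proof -
  have "(\<lambda>n. \<Sum>i\<in>I. pnorm K (ps i) (restr {n..} (y i))) \<longlonglongrightarrow> (\<Sum>i\<in>I. 0)"
    using assms
    by (intro tendsto_sum pnorm_tail_tendsto_0) (auto simp: dspace_def less_le_trans[OF zero_less_one])
  then show ?thesis by (simp add: dnorm_def)
qed

lemma dnorm_lower_estimate:
  assumes finite_I: "finite I" and exponents: "\<And>i. i \<in> I \<Longrightarrow> 1 \<le> ps i" "\<And>i. i \<in> I \<Longrightarrow> ps i < q"
    and q_ge_1: "1 \<le> q"
  shows "\<exists>C>0. \<forall>y\<in>dspace K ps I. \<forall>Es. sorted_wrt before Es \<longrightarrow>
    (\<Sum>E\<leftarrow>Es. dnorm K ps I (restr E \<circ> y) powr q) \<le> C * dnorm K ps I y powr q"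
proof -
  have "\<exists>C>0. \<forall>x\<in>pspace K (ps i). \<forall>Es. sorted_wrt before Es \<longrightarrow>
      (\<Sum>E\<leftarrow>Es. pnorm K (ps i) (restr E x) powr q) \<le> C * pnorm K (ps i) x powr q" if "i \<in> I" for i
    by (rule pnorm_lower_estimate[OF exponents(1)[OF that] exponents(2)[OF that]]) blast
  then obtain C where C_lower: "\<And>i. i \<in> I \<Longrightarrow> 0 < C i" "\<And>i x Es. i \<in> I \<Longrightarrow> x \<in> pspace K (ps i) \<Longrightarrow>
      sorted_wrt before Es \<Longrightarrow> (\<Sum>E\<leftarrow>Es. pnorm K (ps i) (restr E x) powr q) \<le> C i * pnorm K (ps i) x powr q"
    by metis
  define c where "c = real (card I) powr q * (\<Sum>i\<in>I. C i)"
  have c_nonneg: "0 \<le> c"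
    using C_lower(1) unfolding c_def by (intro mult_nonneg_nonneg sum_nonneg) (auto intro: less_imp_le)
  show ?thesis
  proof (intro exI conjI ballI allI impI)
    show "0 < c + 1" using c_nonneg by simp
    fix y Es assume y_mem: "y \<in> dspace K ps I" and Es_sorted: "sorted_wrt before Es"
    have "(\<Sum>E\<leftarrow>Es. dnorm K ps I (restr E \<circ> y) powr q)
        \<le> (\<Sum>E\<leftarrow>Es. real (card I) powr q * (\<Sum>i\<in>I. pnorm K (ps i) (restr E (y i)) powr q))"
      unfolding dnorm_def comp_def using q_ge_1 by (intro sum_list_mono powr_sum_le finite_I) auto
    also have "\<dots> = real (card I) powr q * (\<Sum>i\<in>I. \<Sum>E\<leftarrow>Es. pnorm K (ps i) (restr E (y i)) powr q)"
      by (induction Es) (simp_all add: distrib_left sum.distrib)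
    also have "\<dots> \<le> real (card I) powr q * (\<Sum>i\<in>I. C i * dnorm K ps I y powr q)"
    proof (intro mult_left_mono sum_mono)
      fix i assume i_mem: "i \<in> I"
      have "(\<Sum>E\<leftarrow>Es. pnorm K (ps i) (restr E (y i)) powr q) \<le> C i * pnorm K (ps i) (y i) powr q"
        using C_lower(2)[OF i_mem _ Es_sorted] y_mem i_mem by (simp add: dspace_def)
      also have "\<dots> \<le> C i * dnorm K ps I y powr q"
        using C_lower(1)[OF i_mem] q_ge_1
        by (intro mult_left_mono powr_mono2 pnorm_le_dnorm finite_I i_mem) auto
      finally show "(\<Sum>E\<leftarrow>Es. pnorm K (ps i) (restr E (y i)) powr q) \<le> C i * dnorm K ps I y powr q" .
    qed simp
    also have "\<dots> = c * dnorm K ps I y powr q"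
      by (simp add: c_def sum_distrib_right mult.assoc)
    also have "\<dots> \<le> (c + 1) * dnorm K ps I y powr q" by (simp add: distrib_right)
    finally show "(\<Sum>E\<leftarrow>Es. dnorm K ps I (restr E \<circ> y) powr q) \<le> (c + 1) * dnorm K ps I y powr q" .
  qed
qed

lemma ex_lower_estimate_dnorm:
  fixes I :: "'i set"
  assumes "finite I" "\<And>i. i \<in> I \<Longrightarrow> 1 \<le> ps i" "\<And>i. i \<in> I \<Longrightarrow> ps i < q" "1 \<le> q"
  shows "\<exists>C. lower_estimate (dspace K ps I) (dnorm K ps I) (\<lambda>E. (\<circ>) (restr E)) q C"
proof -
  obtain C where C_lower: "0 < C" "\<And>y Es. y \<in> dspace K ps I \<Longrightarrow> sorted_wrt before Es \<Longrightarrow>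
      (\<Sum>E\<leftarrow>Es. dnorm K ps I (restr E \<circ> y) powr q) \<le> C * dnorm K ps I y powr q"
    using dnorm_lower_estimate[of I ps q] assms by blast
  interpret seminorm_on "dspace K ps I" "dnorm K ps I" using assms by (intro seminorm_on_dnorm)
  have "lower_estimate (dspace K ps I) (dnorm K ps I) (\<lambda>E. (\<circ>) (restr E)) q C"
  proof (intro lower_estimate.intro lower_estimate_axioms.intro seminorm_on_axioms)
    fix E :: "nat set" and x :: "'i \<Rightarrow> nat \<Rightarrow> real"
    show "linear ((\<circ>) (restr E) :: ('i \<Rightarrow> nat \<Rightarrow> real) \<Rightarrow> _)"
      by (rule linearI) (auto simp: fun_eq_iff restr_def)
    show "(restr E \<circ> x) + (restr (- E) \<circ> x) = x"
      by (auto simp: fun_eq_iff restr_def)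
    show "(\<lambda>n. dnorm K ps I (restr {n..} \<circ> x)) \<longlonglongrightarrow> 0" if "x \<in> dspace K ps I"
      using that assms by (intro dnorm_tail_tendsto_0)
  qed (use C_lower assms in \<open>auto simp: dspace_restr fun_eq_iff\<close>)
  then show ?thesis by blast
qed

lemma ultrafilter_heads_converge:
  assumes F_ultra: "ultrafilter F" and finite_I: "finite I" and ps_ge_1: "\<And>i. i \<in> I \<Longrightarrow> 1 \<le> ps i"
    and bounded: "\<forall>\<^sub>F z in F. G z \<in> dspace K ps I \<and> dnorm K ps I (G z) \<le> B"
  shows "\<exists>c\<in>dspace K ps I. \<forall>n. \<forall>e>0. \<forall>\<^sub>F z in F. dnorm K ps I (restr {..<n} \<circ> (G z - c)) \<le> e"
proof -
  have "\<exists>u\<in>pspace K (ps i). \<forall>j. ((\<lambda>z. G z i j) \<longlongrightarrow> u j) F" if i_mem: "i \<in> I" for i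
  proof -
    have "\<forall>\<^sub>F z in F. G z i \<in> pspace K (ps i) \<and> pnorm K (ps i) (G z i) \<le> B"
      using bounded
      by eventually_elim
        (use i_mem pnorm_le_dnorm[OF finite_I i_mem] in \<open>auto simp: dspace_def intro: order_trans\<close>)
    moreover have "0 < ps i" using ps_ge_1[OF i_mem] by simp
    ultimately obtain u where "u \<in> pspace K (ps i)" "\<And>j. ((\<lambda>z. G z i j) \<longlongrightarrow> u j) F"
      using ultrafilter_coordinatewise_limit[OF F_ultra, of "ps i" "\<lambda>z. G z i" B] by blast
    then show ?thesis by blast
  qed
  then obtain c where c_limit: "\<And>i. i \<in> I \<Longrightarrow> c i \<in> pspace K (ps i)"
    "\<And>i j. i \<in> I \<Longrightarrow> ((\<lambda>z. G z i j) \<longlongrightarrow> c i j) F"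
    by metis
  have "\<forall>\<^sub>F z in F. dnorm K ps I (restr {..<n} \<circ> (G z - c)) \<le> e" if e_pos: "0 < e" for n e
  proof -
    define d where "d = e / (card I + 1)"
    have d_pos: "0 < d" using e_pos by (simp add: d_def)
    have "\<forall>\<^sub>F z in F. pnorm K (ps i) (restr {..<n} (G z i - c i)) \<le> d" if i_mem: "i \<in> I" for i
    proof (rule eventually_pnorm_head_le[OF _ _ d_pos])
      show "((\<lambda>z. (G z i - c i) j) \<longlongrightarrow> 0) F" for j
        using tendsto_diff[OF c_limit(2)[OF i_mem, of j] tendsto_const[of "c i j"]] by simp
    qed (use ps_ge_1[OF i_mem] in simp)
    then have "\<forall>\<^sub>F z in F. \<forall>i\<in>I. pnorm K (ps i) (restr {..<n} (G z i - c i)) \<le> d"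
      using finite_I by (simp add: eventually_ball_finite)
    then show ?thesis
    proof eventually_elim
      case (elim z)
      have "dnorm K ps I (restr {..<n} \<circ> (G z - c)) \<le> (\<Sum>i\<in>I. d)"
        unfolding dnorm_def using elim by (intro sum_mono) simp
      also have "\<dots> \<le> e" using e_pos by (simp add: d_def field_simps)
      finally show ?case .
    qed
  qed
  then show ?thesis using c_limit(1) by (intro bexI[of _ c]) (auto simp: dspace_def)
qed

lemma ultrafilter_dnorm_collapse:
  assumes F_ultra: "ultrafilter F" and finite_I: "finite I" and ps_ge_1: "\<And>i. i \<in> I \<Longrightarrow> 1 \<le> ps i"
    and bounded: "\<forall>\<^sub>F z in F. G z \<in> dspace K ps I \<and> dnorm K ps I (G z) \<le> B"
    and m_mem: "m \<in> dspace K ps I" and tails: "\<forall>\<^sub>F z in F. dnorm K ps I (restr {n..} \<circ> (G z - m)) \<le> \<delta>"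
    and \<delta>_pos: "0 < \<delta>"
  shows "\<exists>c\<in>dspace K ps I. \<forall>\<^sub>F z in F. dnorm K ps I (G z - c) \<le> 2 * \<delta>"
proof -
  interpret seminorm_on "dspace K ps I" "dnorm K ps I" using ps_ge_1 by (rule seminorm_on_dnorm)
  obtain c0 where c0_mem: "c0 \<in> dspace K ps I"
    and heads: "\<forall>\<^sub>F z in F. dnorm K ps I (restr {..<n} \<circ> (G z - c0)) \<le> \<delta>"
    using ultrafilter_heads_converge[of F I ps G B] F_ultra finite_I ps_ge_1 bounded \<delta>_pos by blast
  define c where "c = (restr {..<n} \<circ> c0) + (restr {n..} \<circ> m)"
  have c_mem: "c \<in> dspace K ps I" unfolding c_def by (intro mem_add dspace_restr c0_mem m_mem)
  have "\<forall>\<^sub>F z in F. dnorm K ps I (G z - c) \<le> 2 * \<delta>"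
    using bounded tails heads
  proof eventually_elim
    case (elim z)
    have "G z - c = (restr {..<n} \<circ> (G z - c0)) + (restr {n..} \<circ> (G z - m))"
      by (auto simp: c_def restr_def fun_eq_iff)
    then have "dnorm K ps I (G z - c)
        \<le> dnorm K ps I (restr {..<n} \<circ> (G z - c0)) + dnorm K ps I (restr {n..} \<circ> (G z - m))"
      using elim(1) c0_mem m_mem by (simp add: triangle dspace_restr mem_diff)
    then show ?case using elim by simp
  qed
  then show ?thesis using c_mem by blast
qed

lemma tuples_dnorm_concentration:
  assumes finite_I: "finite I" and ps_ge_1: "\<And>i. i \<in> I \<Longrightarrow> 1 \<le> ps i" and \<Lambda>_nonneg: "0 \<le> \<Lambda>"
    and bounded: "\<And>ns. length ns = k \<Longrightarrow> G ns \<in> dspace K ps I \<and> dnorm K ps I (G ns) \<le> B"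
    and exchange: "\<And>as bs n m. length as + Suc (length bs) = k \<Longrightarrow>
      dnorm K ps I (G (as @ n # bs) - G (as @ m # bs)) \<le> \<Lambda>"
  shows "\<exists>c\<in>dspace K ps I.
    \<forall>\<^sub>F ns in tuples k. dnorm K ps I (G ns - c) \<le> (\<Sum>i\<in>I. real k powr (1 / ps i) * \<Lambda> + 1)"
proof -
  have "\<exists>u. concentrates (ps i) (tuples k) (\<lambda>ns. G ns i) u (real k powr (1 / ps i) * \<Lambda>)"
    if i_mem: "i \<in> I" for i
  proof (rule ex_concentrates_tuples[OF ps_ge_1[OF i_mem] \<Lambda>_nonneg])
    show "G ns i \<in> pspace K (ps i) \<and> pnorm K (ps i) (G ns i) \<le> B" if "length ns = k" for ns
      using bounded[OF that] pnorm_le_dnorm[OF finite_I i_mem, of K ps "G ns"] i_mem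
      by (auto simp: dspace_def)
    show "pnorm K (ps i) (G (as @ n # bs) i - G (as @ m # bs) i) \<le> \<Lambda>"
      if "length as + Suc (length bs) = k" for as bs n m
      using exchange[OF that, of n m]
        pnorm_le_dnorm[OF finite_I i_mem, of K ps "G (as @ n # bs) - G (as @ m # bs)"] by simp
  qed
  then obtain c where c_concentrates: "\<And>i. i \<in> I \<Longrightarrow>
      concentrates (ps i) (tuples k) (\<lambda>ns. G ns i) (c i) (real k powr (1 / ps i) * \<Lambda>)"
    by metis
  then have "\<forall>i\<in>I. \<forall>\<^sub>F ns in tuples k. pnorm K (ps i) (G ns i - c i) \<le> real k powr (1 / ps i) * \<Lambda> + 1"
    by (simp add: concentrates_def)
  then have "\<forall>\<^sub>F ns in tuples k. \<forall>i\<in>I. pnorm K (ps i) (G ns i - c i) \<le> real k powr (1 / ps i) * \<Lambda> + 1"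
    by (rule eventually_ball_finite[OF finite_I])
  then have "\<forall>\<^sub>F ns in tuples k. dnorm K ps I (G ns - c) \<le> (\<Sum>i\<in>I. real k powr (1 / ps i) * \<Lambda> + 1)"
    unfolding dnorm_def by eventually_elim (auto intro: sum_mono)
  moreover have "c \<in> dspace K ps I" using c_concentrates by (simp add: dspace_def concentrates_def)
  ultimately show ?thesis by blast
qed

end

section \<open>Normalized sums of unit vectors\<close>

definition spread :: "real \<Rightarrow> nat \<Rightarrow> nat list \<Rightarrow> nat \<Rightarrow> real" where
  "spread p k ns = real k powr (- 1 / p) *\<^sub>R indicator (set ns)"

lemma spread_apply: "spread p k ns i = real k powr (- 1 / p) * indicator (set ns) i"
  by (simp add: spread_def)

lemma tendsto_spread_0: "((\<lambda>ns. spread p k ns i) \<longlongrightarrow> 0) (tuples k)"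
proof (rule tendsto_eventually)
  show "\<forall>\<^sub>F ns in tuples k. spread p k ns i = 0"
    using eventually_tuples_gt[of i k] by eventually_elim (auto simp: spread_apply indicator_def)
qed

context weights begin

lemma spread_mem: "spread p k ns \<in> pspace K p"
  by (rule pspace_finite_support[of "set ns"]) (auto simp: spread_apply)

lemma pnorm_spread_le:
  assumes p_ge_1: "1 \<le> p" and k_length: "0 < k" "length ns = k"
  shows "pnorm K p (spread p k ns) \<le> 1"
proof -
  interpret seminorm_on "pspace K p" "pnorm K p" by (rule seminorm_on_pnorm[OF p_ge_1])
  have "pnorm K p (indicator (set ns)) \<le> real (card (set ns)) powr (1 / p)"
    using p_ge_1 by (intro pnorm_indicator_le) auto
  also have "\<dots> \<le> real k powr (1 / p)"
    using card_length[of ns] k_length p_ge_1 by (intro powr_mono2) auto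
  finally have "pnorm K p (spread p k ns) \<le> real k powr (- 1 / p) * real k powr (1 / p)"
    unfolding spread_def by (simp add: scaleR pspace_indicator mult_left_mono)
  also have "\<dots> = 1" using k_length by (simp flip: powr_add)
  finally show ?thesis .
qed

lemma pnorm_spread_exchange_le:
  assumes p_ge_1: "1 \<le> p"
  shows "pnorm K p (spread p k (as @ n # bs) - spread p k (as @ m # bs)) \<le> 2 * real k powr (- 1 / p)"
proof -
  interpret seminorm_on "pspace K p" "pnorm K p" by (rule seminorm_on_pnorm[OF p_ge_1])
  have pair_mem: "real k powr (- 1 / p) *\<^sub>R indicator {n, m} \<in> pspace K p"
    by (intro mem_scaleR pspace_indicator) simp
  have "pnorm K p (spread p k (as @ n # bs) - spread p k (as @ m # bs))
      \<le> pnorm K p (real k powr (- 1 / p) *\<^sub>R indicator {n, m})"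
    using pair_mem p_ge_1
    by (rule pnorm_mono[OF _ less_le_trans[OF zero_less_one]]) (auto simp: spread_apply indicator_def)
  also have "\<dots> = real k powr (- 1 / p) * pnorm K p (indicator {n, m})"
    by (simp add: scaleR pspace_indicator)
  also have "\<dots> \<le> real k powr (- 1 / p) * 2"
  proof (rule mult_left_mono)
    have "pnorm K p (indicator {n, m}) \<le> real (card {n, m}) powr (1 / p)"
      using p_ge_1 by (intro pnorm_indicator_le) auto
    also have "\<dots> \<le> 2 powr (1 / p)" using p_ge_1 by (intro powr_mono2) (auto simp: card_insert_if)
    also have "\<dots> \<le> 2" using powr_mono[of "1 / p" 1 "2 :: real"] p_ge_1 by simp
    finally show "pnorm K p (indicator {n, m}) \<le> 2" .
  qed simp
  finally show ?thesis by simp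
qed

end

lemma (in tsirelson_weights) pnorm_spread_diff_ge:
  assumes p_ge_1: "1 \<le> p" and ns_props: "distinct ns" "length ns = k"
    and ms_props: "distinct ms" "length ms = k"
    and disjoint: "set ns \<inter> set ms = {}" and k_pos: "0 < k"
  shows "1 / 2 \<le> pnorm K p (spread p k ns - spread p k ms)"
proof -
  interpret seminorm_on "pspace K p" "pnorm K p" by (rule seminorm_on_pnorm[OF p_ge_1])
  let ?A = "set ns \<union> set ms"
  have "card ?A = 2 * k" using disjoint ns_props ms_props by (simp add: card_Un_disjoint distinct_card)
  then have "real k / 2 \<le> wnorm K (indicator ?A)" using card_le_wnorm_indicator[of ?A] by simp
  then have "(real k / 2) powr (1 / p) \<le> pnorm K p (indicator ?A)"
    unfolding pnorm_def using p_ge_1 by (simp add: powr_mono2)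
  then have "real k powr (- 1 / p) * (real k / 2) powr (1 / p)
      \<le> pnorm K p (real k powr (- 1 / p) *\<^sub>R indicator ?A)"
    by (simp add: scaleR pspace_indicator mult_left_mono)
  also have "\<dots> \<le> pnorm K p (spread p k ns - spread p k ms)"
    using p_ge_1 disjoint by (intro pnorm_mono mem_diff spread_mem) (auto simp: spread_apply indicator_def)
  finally have "real k powr (- 1 / p) * (real k / 2) powr (1 / p)
      \<le> pnorm K p (spread p k ns - spread p k ms)" .
  moreover have "real k powr (- 1 / p) * (real k / 2) powr (1 / p) = 1 / 2 powr (1 / p)"
    using k_pos by (simp add: powr_divide flip: powr_add)
  moreover have "(1 / 2 :: real) \<le> 1 / 2 powr (1 / p)"
    using powr_mono[of "1 / p" 1 "2 :: real"] p_ge_1 by (intro divide_left_mono) auto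
  ultimately show ?thesis by linarith
qed

lemma eventually_sum_powr_gap_less:
  fixes ps :: "'i \<Rightarrow> real"
  assumes "\<And>i. i \<in> J \<Longrightarrow> p < ps i" "0 < p" "0 < \<epsilon>"
  shows "\<forall>\<^sub>F k in sequentially. (\<Sum>i\<in>J. c * real k powr (1 / ps i - 1 / p)) < \<epsilon>"
proof -
  have "(\<lambda>k. \<Sum>i\<in>J. c * real k powr (1 / ps i - 1 / p)) \<longlonglongrightarrow> (\<Sum>i\<in>J. c * 0)"
  proof (intro tendsto_sum tendsto_mult tendsto_const)
    fix i assume "i \<in> J"
    then have "1 / ps i - 1 / p < 0" using assms by (simp add: frac_less2)
    then show "(\<lambda>k. real k powr (1 / ps i - 1 / p)) \<longlonglongrightarrow> 0"
      by (intro tendsto_neg_powr filterlim_real_sequentially)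
  qed
  then show ?thesis using assms(3) by (intro order_tendstoD) auto
qed

section \<open>Coarse Lipschitz maps into a direct sum\<close>

locale coarse_lipschitz_dsum = source: tsirelson_weights K0 + target: tsirelson_weights K
  for K0 K :: "(nat \<Rightarrow> real) set" +
  fixes p L :: real and ps :: "'i \<Rightarrow> real" and I :: "'i set" and g :: "(nat \<Rightarrow> real) \<Rightarrow> 'i \<Rightarrow> nat \<Rightarrow> real"
  assumes finite_I: "finite I" and ps_ge_1: "i \<in> I \<Longrightarrow> 1 \<le> ps i" and p_ge_1: "1 \<le> p" and L_pos: "0 < L"
    and coarse: "coarse_lipschitz_on (pspace K0 p) (pnorm K0 p) (dspace K ps I) (dnorm K ps I) L g"
begin

sublocale source: seminorm_on "pspace K0 p" "pnorm K0 p"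
  by (rule source.seminorm_on_pnorm[OF p_ge_1])

sublocale target: seminorm_on "dspace K ps I" "dnorm K ps I"
  using ps_ge_1 by (rule target.seminorm_on_dnorm)

lemmas g_mem = coarse_lipschitz_on_mem[OF coarse]
lemmas g_diff_le = coarse_lipschitz_on_le[OF coarse]

lemma coarse_lipschitz_dsum_subset:
  assumes "J \<subseteq> I"
  shows "coarse_lipschitz_dsum K0 K p L ps J g"
proof
  show "finite J" using finite_I assms by (rule finite_subset[rotated])
  show "coarse_lipschitz_on (pspace K0 p) (pnorm K0 p) (dspace K ps J) (dnorm K ps J) L g"
    using g_mem dspace_antimono[OF assms] order_trans[OF dnorm_mono_index[OF finite_I assms] g_diff_le]
    unfolding coarse_lipschitz_on_def by blast
qed (use ps_ge_1 p_ge_1 L_pos assms in auto)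

lemma dnorm_image_le:
  assumes x_mem: "x \<in> pspace K0 p" and v_unit: "v \<in> pspace K0 p" "pnorm K0 p v \<le> 1" and \<tau>_nonneg: "0 \<le> \<tau>"
  shows "g (x + \<tau> *\<^sub>R v) \<in> dspace K ps I"
    and "dnorm K ps I (g (x + \<tau> *\<^sub>R v)) \<le> dnorm K ps I (g x) + (L * \<tau> + L)"
proof -
  have shifted_mem: "x + \<tau> *\<^sub>R v \<in> pspace K0 p" by (intro source.mem_add source.mem_scaleR x_mem v_unit)
  then show "g (x + \<tau> *\<^sub>R v) \<in> dspace K ps I" by (rule g_mem)
  have "L * pnorm K0 p (\<tau> *\<^sub>R v) \<le> L * \<tau>"
    using L_pos \<tau>_nonneg v_unit by (intro mult_left_mono) (simp_all add: source.scaleR mult_left_le)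
  then have "dnorm K ps I (g (x + \<tau> *\<^sub>R v) - g x) \<le> L * \<tau> + L"
    using g_diff_le[OF shifted_mem x_mem] by simp
  then show "dnorm K ps I (g (x + \<tau> *\<^sub>R v)) \<le> dnorm K ps I (g x) + (L * \<tau> + L)"
    using target.le_add_diff[OF g_mem[OF shifted_mem] g_mem[OF x_mem]] by simp
qed

lemma ultrafilter_image_collapse:
  assumes exponents: "\<And>i. i \<in> I \<Longrightarrow> ps i < p" and F_ultra: "ultrafilter F" and e_null: "unit_null K0 p F e"
    and \<epsilon>_pos: "0 < \<epsilon>" and \<tau>0_pos: "0 < \<tau>0"
  shows "\<exists>\<tau>\<ge>\<tau>0. \<exists>x\<in>pspace K0 p. \<exists>c\<in>dspace K ps I.
    \<forall>\<^sub>F z in F. dnorm K ps I (g (x + \<tau> *\<^sub>R e z) - c) \<le> \<epsilon> * \<tau>"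
proof (cases "I = {}")
  case True
  then show ?thesis using \<epsilon>_pos \<tau>0_pos source.mem_0 by (auto simp: dspace_def dnorm_def)
next
  case False
  have "Max (ps ` I) \<in> ps ` I" using False finite_I by (intro Max_in) auto
  then have max_bounds: "1 \<le> Max (ps ` I)" "Max (ps ` I) < p" using ps_ge_1 exponents by auto
  obtain q where q_between: "Max (ps ` I) < q" "q < p" using dense[OF max_bounds(2)] by blast
  then have less_q: "ps i < q" if "i \<in> I" for i
    using that finite_I by (auto intro: le_less_trans[OF Max_ge])
  have "1 \<le> q" using max_bounds(1) q_between(1) by simp
  obtain C where "lower_estimate (dspace K ps I) (dnorm K ps I) (\<lambda>E. (\<circ>) (restr E)) q C"
    using target.ex_lower_estimate_dnorm[of I ps q] finite_I ps_ge_1 less_q \<open>1 \<le> q\<close> by blast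
  then interpret lower_estimate "dspace K ps I" "dnorm K ps I" "\<lambda>E. (\<circ>) (restr E)" q C .
  obtain \<tau> x m n where \<tau>_ge: "\<tau>0 \<le> \<tau>" and x_mem: "x \<in> pspace K0 p" and m_mem: "m \<in> dspace K ps I"
    and tails: "\<forall>\<^sub>F z in F. dnorm K ps I (restr {n..} \<circ> (g (x + \<tau> *\<^sub>R e z) - m)) \<le> \<epsilon> / 2 * \<tau>"
    using ex_small_image_tails[OF source.tsirelson_weights_axioms q_between(2) coarse e_null
        half_gt_zero[OF \<epsilon>_pos] \<tau>0_pos] by blast
  have "\<forall>\<^sub>F z in F. e z \<in> pspace K0 p \<and> pnorm K0 p (e z) \<le> 1" using e_null by (simp add: unit_null_def)
  then have "\<forall>\<^sub>F z in F. g (x + \<tau> *\<^sub>R e z) \<in> dspace K ps I \<and>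
      dnorm K ps I (g (x + \<tau> *\<^sub>R e z)) \<le> dnorm K ps I (g x) + (L * \<tau> + L)"
    by eventually_elim (use dnorm_image_le[OF x_mem] \<tau>_ge \<tau>0_pos in auto)
  then have "\<exists>c\<in>dspace K ps I. \<forall>\<^sub>F z in F. dnorm K ps I (g (x + \<tau> *\<^sub>R e z) - c) \<le> 2 * (\<epsilon> / 2 * \<tau>)"
    using \<epsilon>_pos \<tau>_ge \<tau>0_pos
    by (intro target.ultrafilter_dnorm_collapse[OF F_ultra finite_I ps_ge_1 _ m_mem tails]) auto
  then show ?thesis using \<tau>_ge x_mem by auto
qed

lemma shifted_spread_mem: "x \<in> pspace K0 p \<Longrightarrow> x + \<tau> *\<^sub>R spread p k ns \<in> pspace K0 p"
  by (intro source.mem_add source.mem_scaleR source.spread_mem)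

lemma spread_image_concentration:
  assumes k_pos: "0 < k" and \<tau>_nonneg: "0 \<le> \<tau>" and x_mem: "x \<in> pspace K0 p"
  defines "\<Lambda> \<equiv> L * (\<tau> * (2 * real k powr (- 1 / p))) + L"
  shows "\<exists>c\<in>dspace K ps I. \<forall>\<^sub>F ns in tuples k.
    dnorm K ps I (g (x + \<tau> *\<^sub>R spread p k ns) - c) \<le> (\<Sum>i\<in>I. real k powr (1 / ps i) * \<Lambda> + 1)"
proof (rule target.tuples_dnorm_concentration[OF finite_I ps_ge_1])
  let ?z = "\<lambda>ns. x + \<tau> *\<^sub>R spread p k ns"
  show "0 \<le> \<Lambda>" using L_pos \<tau>_nonneg by (simp add: \<Lambda>_def)
  show "g (?z ns) \<in> dspace K ps I \<and> dnorm K ps I (g (?z ns)) \<le> dnorm K ps I (g x) + (L * \<tau> + L)"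
    if "length ns = k" for ns
    using dnorm_image_le[OF x_mem source.spread_mem _ \<tau>_nonneg] source.pnorm_spread_le[OF p_ge_1 k_pos that]
    by blast
  show "dnorm K ps I (g (?z (as @ n # bs)) - g (?z (as @ m # bs))) \<le> \<Lambda>" for as bs n m
  proof -
    let ?u = "spread p k (as @ n # bs) - spread p k (as @ m # bs)"
    have u_mem: "?u \<in> pspace K0 p" by (intro source.mem_diff source.spread_mem)
    have "dnorm K ps I (g (?z (as @ n # bs)) - g (?z (as @ m # bs)))
        \<le> L * pnorm K0 p (?z (as @ n # bs) - ?z (as @ m # bs)) + L"
      by (intro g_diff_le shifted_spread_mem x_mem)
    also have "?z (as @ n # bs) - ?z (as @ m # bs) = \<tau> *\<^sub>R ?u" by (simp add: scaleR_diff_right)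
    also have "pnorm K0 p (\<tau> *\<^sub>R ?u) = \<tau> * pnorm K0 p ?u"
      unfolding source.scaleR[OF u_mem] using \<tau>_nonneg by simp
    also have "L * (\<tau> * pnorm K0 p ?u) + L \<le> \<Lambda>"
      unfolding \<Lambda>_def using L_pos \<tau>_nonneg source.pnorm_spread_exchange_le[OF p_ge_1]
      by (intro add_right_mono mult_left_mono) auto
    finally show ?thesis .
  qed
qed

lemma eventually_ex_center_above:
  assumes exponents: "\<And>i. i \<in> I \<Longrightarrow> p < ps i" and \<epsilon>_pos: "0 < \<epsilon>"
  shows "\<forall>\<^sub>F k in sequentially. \<exists>\<tau>0. \<forall>\<tau>\<ge>\<tau>0. \<forall>x\<in>pspace K0 p. \<exists>c\<in>dspace K ps I.
    \<forall>\<^sub>F ns in tuples k. dnorm K ps I (g (x + \<tau> *\<^sub>R spread p k ns) - c) \<le> \<epsilon> * \<tau>"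
proof -
  have "\<forall>\<^sub>F k in sequentially. (\<Sum>i\<in>I. 2 * L * real k powr (1 / ps i - 1 / p)) < \<epsilon> / 2"
    by (rule eventually_sum_powr_gap_less[OF exponents]) (use p_ge_1 \<epsilon>_pos in auto)
  then show ?thesis
    using eventually_gt_at_top[of 0]
  proof eventually_elim
    case (elim k)
    define M where "M = (\<Sum>i\<in>I. real k powr (1 / ps i) * L + 1)"
    have "\<exists>c\<in>dspace K ps I. \<forall>\<^sub>F ns in tuples k. dnorm K ps I (g (x + \<tau> *\<^sub>R spread p k ns) - c) \<le> \<epsilon> * \<tau>"
      if \<tau>_ge: "max 0 (2 * M / \<epsilon>) \<le> \<tau>" and x_mem: "x \<in> pspace K0 p" for \<tau> x
    proof -
      define \<Lambda> where "\<Lambda> = L * (\<tau> * (2 * real k powr (- 1 / p))) + L"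
      have \<tau>_nonneg: "0 \<le> \<tau>" and M_le: "M \<le> \<epsilon> / 2 * \<tau>" using \<tau>_ge \<epsilon>_pos by (auto simp: field_simps)
      obtain c where c_mem: "c \<in> dspace K ps I" and concentration: "\<forall>\<^sub>F ns in tuples k.
          dnorm K ps I (g (x + \<tau> *\<^sub>R spread p k ns) - c) \<le> (\<Sum>i\<in>I. real k powr (1 / ps i) * \<Lambda> + 1)"
        using spread_image_concentration[OF elim(2) \<tau>_nonneg x_mem] unfolding \<Lambda>_def by blast
      have "real k powr (1 / ps i) * \<Lambda> + 1
          = \<tau> * (2 * L * real k powr (1 / ps i - 1 / p)) + (real k powr (1 / ps i) * L + 1)" for i
        by (simp add: \<Lambda>_def powr_diff powr_minus_divide algebra_simps)
      then have "(\<Sum>i\<in>I. real k powr (1 / ps i) * \<Lambda> + 1)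
          = \<tau> * (\<Sum>i\<in>I. 2 * L * real k powr (1 / ps i - 1 / p)) + M"
        by (simp add: M_def sum.distrib sum_distrib_left)
      also have "\<dots> \<le> \<tau> * (\<epsilon> / 2) + \<epsilon> / 2 * \<tau>"
        using elim(1) \<tau>_nonneg M_le by (intro add_mono mult_left_mono) auto
      finally have "(\<Sum>i\<in>I. real k powr (1 / ps i) * \<Lambda> + 1) \<le> \<epsilon> * \<tau>" by simp
      with concentration have "\<forall>\<^sub>F ns in tuples k. dnorm K ps I (g (x + \<tau> *\<^sub>R spread p k ns) - c) \<le> \<epsilon> * \<tau>"
        by (auto elim: eventually_mono)
      then show ?thesis using c_mem by blast
    qed
    then show ?case by blast
  qed
qed

lemma unit_null_spread:
  assumes "0 < k"
  shows "unit_null K0 p (tuples k) (spread p k)"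
proof -
  have "\<forall>\<^sub>F ns in tuples k. spread p k ns \<in> pspace K0 p \<and> pnorm K0 p (spread p k ns) \<le> 1"
    using eventually_tuples_length
    by (rule eventually_mono) (use p_ge_1 assms source.spread_mem source.pnorm_spread_le in blast)
  then show ?thesis by (simp add: unit_null_def tendsto_spread_0)
qed

lemma ex_collapsing_spread:
  assumes exponents: "\<And>i. i \<in> I \<Longrightarrow> ps i \<noteq> p" and \<epsilon>_pos: "0 < \<epsilon>"
  obtains k \<tau> x c where "0 < k" "\<tau>1 \<le> \<tau>" "x \<in> pspace K0 p" "c \<in> dspace K ps I"
    "\<forall>\<^sub>F ns in tuples k. dnorm K ps I (g (x + \<tau> *\<^sub>R spread p k ns) - c) \<le> \<epsilon> * \<tau>"
proof -
  define I1 I2 where "I1 = {i \<in> I. ps i < p}" and "I2 = {i \<in> I. p < ps i}"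
  have disjoint: "I1 \<inter> I2 = {}" and I_eq: "I1 \<union> I2 = I"
    using exponents by (auto simp: I1_def I2_def neq_iff)
  interpret below: coarse_lipschitz_dsum K0 K p L ps I1 g
    using I_eq by (intro coarse_lipschitz_dsum_subset) auto
  interpret above: coarse_lipschitz_dsum K0 K p L ps I2 g
    using I_eq by (intro coarse_lipschitz_dsum_subset) auto
  have ps_below: "ps i < p" if "i \<in> I1" for i using that by (simp add: I1_def)
  have ps_above: "p < ps i" if "i \<in> I2" for i using that by (simp add: I2_def)
  have "\<forall>\<^sub>F k in sequentially. 0 < k \<and> (\<exists>\<tau>0. \<forall>\<tau>\<ge>\<tau>0. \<forall>x\<in>pspace K0 p. \<exists>c\<in>dspace K ps I2.
      \<forall>\<^sub>F ns in tuples k. dnorm K ps I2 (g (x + \<tau> *\<^sub>R spread p k ns) - c) \<le> \<epsilon> / 2 * \<tau>)"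
    by (intro eventually_conj eventually_gt_at_top
        above.eventually_ex_center_above[OF ps_above half_gt_zero[OF \<epsilon>_pos]])
  from eventually_happens'[OF sequentially_bot this] obtain k \<tau>0 where k_pos: "0 < k"
    and center_above: "\<And>\<tau> x. \<tau>0 \<le> \<tau> \<Longrightarrow> x \<in> pspace K0 p \<Longrightarrow> \<exists>c\<in>dspace K ps I2.
      \<forall>\<^sub>F ns in tuples k. dnorm K ps I2 (g (x + \<tau> *\<^sub>R spread p k ns) - c) \<le> \<epsilon> / 2 * \<tau>"
    by blast
  have "0 < max 1 (max \<tau>0 \<tau>1)" by simp
  then obtain \<tau> x c1 where \<tau>_ge: "max 1 (max \<tau>0 \<tau>1) \<le> \<tau>" and x_mem: "x \<in> pspace K0 p"
    and c1_mem: "c1 \<in> dspace K ps I1"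
    and near1: "\<forall>\<^sub>F ns in tuples k. dnorm K ps I1 (g (x + \<tau> *\<^sub>R spread p k ns) - c1) \<le> \<epsilon> / 2 * \<tau>"
    using below.ultrafilter_image_collapse[OF ps_below ultrafilter_tuples unit_null_spread[OF k_pos]
        half_gt_zero[OF \<epsilon>_pos]] by blast
  obtain c2 where c2_mem: "c2 \<in> dspace K ps I2"
    and near2: "\<forall>\<^sub>F ns in tuples k. dnorm K ps I2 (g (x + \<tau> *\<^sub>R spread p k ns) - c2) \<le> \<epsilon> / 2 * \<tau>"
    using center_above[OF _ x_mem] \<tau>_ge by auto
  obtain c where c_mem: "c \<in> dspace K ps I"
    and dnorm_split: "\<And>y. dnorm K ps I (y - c) = dnorm K ps I1 (y - c1) + dnorm K ps I2 (y - c2)"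
    using ex_dnorm_center_Un[OF below.finite_I above.finite_I disjoint c1_mem c2_mem] unfolding I_eq by blast
  have "\<forall>\<^sub>F ns in tuples k. dnorm K ps I (g (x + \<tau> *\<^sub>R spread p k ns) - c) \<le> \<epsilon> * \<tau>"
    using near1 near2 by eventually_elim (simp add: dnorm_split)
  then show ?thesis using that[OF k_pos _ x_mem c_mem] \<tau>_ge by auto
qed

lemma pnorm_shifted_spread_diff_ge:
  assumes "x \<in> pspace K0 p" "0 < \<tau>" "0 < k" "distinct ns" "length ns = k" "distinct ms" "length ms = k"
    "set ns \<inter> set ms = {}"
  shows "\<tau> / 2 \<le> pnorm K0 p ((x + \<tau> *\<^sub>R spread p k ns) - (x + \<tau> *\<^sub>R spread p k ms))"
proof -
  let ?u = "spread p k ns - spread p k ms"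
  have "?u \<in> pspace K0 p" by (intro source.mem_diff source.spread_mem)
  then have "pnorm K0 p (\<tau> *\<^sub>R ?u) = \<tau> * pnorm K0 p ?u" using assms(2) by (simp only: source.scaleR abs_of_pos)
  moreover have "1 / 2 \<le> pnorm K0 p ?u" using assms by (intro source.pnorm_spread_diff_ge[OF p_ge_1])
  moreover have "(x + \<tau> *\<^sub>R spread p k ns) - (x + \<tau> *\<^sub>R spread p k ms) = \<tau> *\<^sub>R ?u"
    by (simp add: scaleR_diff_right)
  ultimately show ?thesis using assms(2) by simp
qed

lemma ex_coarse_lower_bound_violated:
  assumes exponents: "\<And>i. i \<in> I \<Longrightarrow> ps i \<noteq> p"
  shows "\<exists>x\<in>pspace K0 p. \<exists>y\<in>pspace K0 p. dnorm K ps I (g x - g y) < pnorm K0 p (x - y) / L - L"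
proof (rule ccontr)
  assume "\<not> ?thesis"
  then have lower: "pnorm K0 p (x - y) / L - L \<le> dnorm K ps I (g x - g y)"
    if "x \<in> pspace K0 p" "y \<in> pspace K0 p" for x y
    using that by (meson not_less)
  have \<epsilon>_pos: "0 < 1 / (8 * L)" using L_pos by simp
  obtain k \<tau> x c where k_pos: "0 < k" and \<tau>_ge: "4 * L * L + 1 \<le> \<tau>" and x_mem: "x \<in> pspace K0 p"
    and c_mem: "c \<in> dspace K ps I"
    and near: "\<forall>\<^sub>F ns in tuples k. dnorm K ps I (g (x + \<tau> *\<^sub>R spread p k ns) - c) \<le> 1 / (8 * L) * \<tau>"
    using exponents \<epsilon>_pos by (rule ex_collapsing_spread)
  let ?z = "\<lambda>ns. x + \<tau> *\<^sub>R spread p k ns"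
  note z_mem = shifted_spread_mem[OF x_mem]
  have "\<forall>\<^sub>F ns in tuples k. dnorm K ps I (g (?z ns) - c) \<le> 1 / (8 * L) * \<tau> \<and> distinct ns \<and> length ns = k"
    by (intro eventually_conj near eventually_tuples_distinct eventually_tuples_length)
  then obtain ns ms where
      ns_near: "dnorm K ps I (g (?z ns) - c) \<le> 1 / (8 * L) * \<tau>" "distinct ns" "length ns = k"
    and ms_near: "dnorm K ps I (g (?z ms) - c) \<le> 1 / (8 * L) * \<tau>" "distinct ms" "length ms = k"
    and disjoint: "set ns \<inter> set ms = {}"
    by (rule ex_disjoint_tuples) blast
  have "0 \<le> 4 * L * L" using L_pos by simp
  then have "0 < \<tau>" using \<tau>_ge by linarith
  then have "\<tau> / 2 \<le> pnorm K0 p (?z ns - ?z ms)"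
    by (rule pnorm_shifted_spread_diff_ge[OF x_mem _ k_pos ns_near(2,3) ms_near(2,3) disjoint])
  then have "\<tau> / 2 / L - L \<le> pnorm K0 p (?z ns - ?z ms) / L - L"
    using L_pos by (intro diff_right_mono divide_right_mono) auto
  also have "\<dots> \<le> dnorm K ps I (g (?z ns) - g (?z ms))" by (rule lower[OF z_mem z_mem])
  also have "\<dots> \<le> 1 / (8 * L) * \<tau> + 1 / (8 * L) * \<tau>"
    using target.triangle_center[OF g_mem[OF z_mem] g_mem[OF z_mem] c_mem] ns_near(1) ms_near(1)
    by (rule order_trans[OF _ add_mono])
  finally have "\<tau> \<le> 4 * L * L" using L_pos by (simp add: field_simps)
  then show False using \<tau>_ge by simp
qed

end

section \<open>The Tsirelson norm\<close>

lemma admissible_less: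
  assumes "admissible k E" "i < j" "j < k" "a \<in> E i" "b \<in> E j"
  shows "a < b"
  using assms(2,3,5)
proof (induction j arbitrary: b)
  case (Suc j)
  have E_successive: "finite (E j)" "E j \<noteq> {}" "finite (E (Suc j))" "Max (E j) < Min (E (Suc j))"
    using assms(1) Suc.prems unfolding admissible_def by auto
  have "Max (E j) < b" using E_successive Suc.prems by (meson Min_le less_le_trans)
  moreover have "a \<le> Max (E j)"
  proof (cases "i = j")
    case True
    then show ?thesis using E_successive assms(4) by simp
  next
    case False
    then have "a < Max (E j)" using Suc.IH[of "Max (E j)"] Suc.prems E_successive by simp
    then show ?thesis by simp
  qed
  ultimately show ?case by simp
qed simp

lemma admissible_disjoint:
  assumes "admissible k E" "i < k" "j < k" "a \<in> E i" "a \<in> E j"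
  shows "i = j"
  using admissible_less[OF assms(1), of i j a a] admissible_less[OF assms(1), of j i a a] assms
  by (metis less_irrefl linorder_neqE_nat)

lemma sum_restr_admissible_le:
  assumes E_admissible: "admissible k E" and \<phi>_le: "\<And>j. j < k \<Longrightarrow> \<phi> j i \<le> c" and c_nonneg: "0 \<le> c"
  shows "(\<Sum>j<k. restr (E j) (\<phi> j) i) \<le> c"
proof (cases "\<exists>j<k. i \<in> E j")
  case True
  then obtain j where j_block: "j < k" "i \<in> E j" by blast
  have "i \<notin> E j'" if "j' < k" "j' \<noteq> j" for j'
    using admissible_disjoint[OF E_admissible that(1) j_block(1) _ j_block(2)] that(2) by blast
  then have "restr (E j') (\<phi> j') i = (if j' = j then \<phi> j i else 0)" if "j' < k" for j'
    using that j_block(2) by (simp add: restr_def)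
  then have "(\<Sum>j'<k. restr (E j') (\<phi> j') i) = (\<Sum>j'<k. if j' = j then \<phi> j i else 0)"
    by (intro sum.cong) auto
  then show ?thesis using j_block(1) \<phi>_le by simp
next
  case False
  then have "(\<Sum>j<k. restr (E j) (\<phi> j) i) = 0" by (intro sum.neutral) (auto simp: restr_def)
  then show ?thesis using c_nonneg by simp
qed

inductive_set norming :: "(nat \<Rightarrow> real) set" where
  unit: "indicator {i} \<in> norming"
| half_sum: "admissible k E \<Longrightarrow> (\<And>j. j < k \<Longrightarrow> \<phi>s j \<in> norming) \<Longrightarrow>
    (\<lambda>i. (1/2) * (\<Sum>j<k. restr (E j) (\<phi>s j) i)) \<in> norming"

interpretation norming: tsirelson_weights norming
proof
  show "0 \<le> \<phi> i" if "\<phi> \<in> norming" for \<phi> i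
    using that by induction (auto simp: restr_def intro!: sum_nonneg)
  show "\<phi> i \<le> 1" if "\<phi> \<in> norming" for \<phi> i
    using that
  proof induction
    case (half_sum k E \<phi>s)
    then show ?case using sum_restr_admissible_le[of k E \<phi>s i 1] by simp
  qed (simp add: indicator_def)
  show "\<exists>\<phi>\<in>norming. \<phi> i = 1" for i by (rule bexI[OF _ norming.unit[of i]]) simp
  show "\<exists>\<psi>\<in>norming. \<forall>i. (1/2) * (\<Sum>j<k. restr (E j) (\<phi>s j) i) \<le> \<psi> i"
    if "admissible k E" "\<And>j. j < k \<Longrightarrow> \<phi>s j \<in> norming" for k E \<phi>s
    by (rule bexI[OF _ norming.half_sum[OF that]]) simp_all
qed

lemma subspace_c00: "subspace c00"
proof (rule subspaceI)
  show "x + y \<in> c00" if "x \<in> c00" "y \<in> c00" for x y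
    using that by (auto simp: c00_def intro: finite_subset[of _ "{i. x i \<noteq> 0} \<union> {i. y i \<noteq> 0}"])
qed (auto simp: c00_def elim: rev_finite_subset)

lemma c00_restr: "x \<in> c00 \<Longrightarrow> restr E x \<in> c00"
  by (auto simp: c00_def restr_def elim: rev_finite_subset)

lemma c00_restr_finite: "finite E \<Longrightarrow> restr E x \<in> c00"
  by (auto simp: c00_def restr_def elim: rev_finite_subset)

lemma c00_subset_wspace: "c00 \<subseteq> wspace norming"
  by (auto simp: c00_def intro: norming.wspace_finite_support)

lemma is_norm_on_c00_iff: "is_norm_on_c00 f \<longleftrightarrow> seminorm_on c00 f \<and> (\<forall>x\<in>c00. f x = 0 \<longrightarrow> x = 0)"
proof
  assume f_norm: "is_norm_on_c00 f"
  then have "seminorm_on c00 f"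
    by (auto simp: is_norm_on_c00_def seminorm_on_def subspace_c00 plus_fun_def scaleR_fun_def)
  then show "seminorm_on c00 f \<and> (\<forall>x\<in>c00. f x = 0 \<longrightarrow> x = 0)"
    using f_norm by (simp add: is_norm_on_c00_def zero_fun_def)
next
  assume f_norm: "seminorm_on c00 f \<and> (\<forall>x\<in>c00. f x = 0 \<longrightarrow> x = 0)"
  then interpret seminorm_on c00 f by simp
  show "is_norm_on_c00 f"
    using f_norm triangle scaleR nonneg zero
    by (auto simp: is_norm_on_c00_def plus_fun_def scaleR_fun_def zero_fun_def)
qed

definition admissible_sums :: "((nat \<Rightarrow> real) \<Rightarrow> real) \<Rightarrow> (nat \<Rightarrow> real) \<Rightarrow> real set" where
  "admissible_sums f x = {\<Sum>j<k. f (restr (E j) x) | k E. admissible k E}"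

lemma admissible_sums_nonempty: "admissible_sums f x \<noteq> {}"
proof -
  have "admissible 1 (\<lambda>_. {0})" by (simp add: admissible_def)
  then show ?thesis unfolding admissible_sums_def by blast
qed

lemma tsirelson_eq_iff:
  "tsirelson_eq f \<longleftrightarrow> (\<forall>x\<in>c00. f x = max (supnorm0 x) ((1/2) * Sup (admissible_sums f x)))"
  by (simp add: tsirelson_eq_def admissible_sums_def)

definition c00_wnorm :: "(nat \<Rightarrow> real) \<Rightarrow> real" where
  "c00_wnorm x = (if x \<in> c00 then wnorm norming x else 0)"

lemma c00_wnorm_eq: "x \<in> c00 \<Longrightarrow> c00_wnorm x = wnorm norming x"
  by (simp add: c00_wnorm_def)

lemma is_norm_on_c00_c00_wnorm: "is_norm_on_c00 c00_wnorm"
  unfolding is_norm_on_c00_iff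
proof (intro conjI ballI impI)
  interpret seminorm_on "wspace norming" "wnorm norming" by (rule norming.seminorm_on_wnorm)
  show "seminorm_on c00 c00_wnorm"
  proof (rule seminorm_onI[OF subspace_c00])
    fix x y c assume x_mem: "x \<in> c00"
    show "c00_wnorm (x + y) \<le> c00_wnorm x + c00_wnorm y" if "y \<in> c00"
      using x_mem that c00_subset_wspace
      by (auto simp: c00_wnorm_eq subspace_add[OF subspace_c00] intro: triangle)
    show "c00_wnorm (c *\<^sub>R x) \<le> \<bar>c\<bar> * c00_wnorm x"
      using x_mem c00_subset_wspace by (auto simp: c00_wnorm_eq subspace_scale[OF subspace_c00] scaleR)
  qed
  fix x assume "x \<in> c00" "c00_wnorm x = 0"
  then show "x = 0"
    using norming.abs_le_wnorm[of x] c00_subset_wspace by (auto simp: c00_wnorm_eq fun_eq_iff)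
qed

lemma admissible_sum_le_wnorm:
  assumes "x \<in> c00" "s \<in> admissible_sums c00_wnorm x"
  shows "s \<le> 2 * wnorm norming x"
  using assms norming.sum_wnorm_admissible_le c00_subset_wspace
  by (auto simp: admissible_sums_def c00_wnorm_eq c00_restr)

lemma bdd_above_abs:
  assumes "x \<in> c00"
  shows "bdd_above (range (\<lambda>i. \<bar>x i\<bar>))"
  using norming.abs_le_wnorm assms c00_subset_wspace by (intro bdd_aboveI2) blast

lemma wnorm_le_tsirelson_rhs:
  assumes x_mem: "x \<in> c00"
  shows "wnorm norming x \<le> max (supnorm0 x) ((1/2) * Sup (admissible_sums c00_wnorm x))"
proof (rule norming.wnorm_least)
  fix \<phi> M assume "\<phi> \<in> norming"
  then show "wsum \<phi> M x \<le> max (supnorm0 x) ((1/2) * Sup (admissible_sums c00_wnorm x))"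
  proof cases
    case (unit i)
    have "wsum \<phi> M x = (\<Sum>j<M. if j = i then \<bar>x i\<bar> else 0)"
      unfolding wsum_def unit by (intro sum.cong) (auto simp: indicator_def)
    also have "\<dots> \<le> \<bar>x i\<bar>" by simp
    also have "\<dots> \<le> supnorm0 x"
      unfolding supnorm0_def by (rule cSUP_upper[OF _ bdd_above_abs[OF x_mem]]) simp
    finally show ?thesis by simp
  next
    case (half_sum k E \<phi>s)
    have "wsum \<phi> M x = (\<Sum>i<M. \<Sum>j<k. (1/2) * (restr (E j) (\<phi>s j) i * \<bar>x i\<bar>))"
      unfolding wsum_def half_sum(1) by (simp add: sum_distrib_left sum_distrib_right mult.assoc)
    also have "\<dots> = (1/2) * (\<Sum>j<k. wsum (\<phi>s j) M (restr (E j) x))"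
      by (subst sum.swap) (simp add: wsum_restr sum_distrib_left)
    also have "\<dots> \<le> (1/2) * (\<Sum>j<k. c00_wnorm (restr (E j) x))"
      using half_sum(3) c00_restr[OF x_mem] c00_subset_wspace
      by (intro mult_left_mono sum_mono) (auto simp: c00_wnorm_eq intro!: norming.wsum_le_wnorm)
    also have "\<dots> \<le> (1/2) * Sup (admissible_sums c00_wnorm x)"
      using half_sum(2) admissible_sum_le_wnorm[OF x_mem]
      by (intro mult_left_mono cSup_upper bdd_aboveI) (auto simp: admissible_sums_def)
    finally show ?thesis by simp
  qed
qed

lemma tsirelson_eq_c00_wnorm: "tsirelson_eq c00_wnorm"
  unfolding tsirelson_eq_iff
proof
  fix x assume x_mem: "x \<in> c00"
  have "supnorm0 x \<le> wnorm norming x"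
    unfolding supnorm0_def using norming.abs_le_wnorm x_mem c00_subset_wspace by (intro cSUP_least) auto
  moreover have "Sup (admissible_sums c00_wnorm x) \<le> 2 * wnorm norming x"
    using admissible_sums_nonempty admissible_sum_le_wnorm[OF x_mem] by (rule cSup_least)
  ultimately show "c00_wnorm x = max (supnorm0 x) ((1/2) * Sup (admissible_sums c00_wnorm x))"
    using wnorm_le_tsirelson_rhs[OF x_mem] by (simp add: c00_wnorm_eq[OF x_mem])
qed

lemma seminorm_on_c00_restr_le:
  assumes f_seminorm: "seminorm_on c00 f" and "finite A"
  shows "f (restr A x) \<le> (\<Sum>i\<in>A. \<bar>x i\<bar> * f (indicator {i}))"
  using assms(2)
proof (induction A rule: finite_induct)
  interpret seminorm_on c00 f by (rule f_seminorm)
  case empty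
  have "restr {} x = 0" by (auto simp: restr_def)
  with zero show ?case by (simp only: sum.empty order_refl)
next
  interpret seminorm_on c00 f by (rule f_seminorm)
  case (insert a A)
  have a_mem: "indicator {a} \<in> c00" by (simp add: c00_def indicator_def)
  have "restr (insert a A) x = x a *\<^sub>R indicator {a} + restr A x"
    using insert by (auto simp: restr_def indicator_def)
  then have "f (restr (insert a A) x) \<le> f (x a *\<^sub>R indicator {a}) + f (restr A x)"
    using insert a_mem by (simp add: triangle mem_scaleR c00_restr_finite)
  then show ?case using insert by (simp add: scaleR[OF a_mem])
qed

lemma bdd_above_admissible_sums:
  assumes f_seminorm: "seminorm_on c00 f" and x_mem: "x \<in> c00"
  shows "bdd_above (admissible_sums f x)"
proof (rule bdd_aboveI)
  interpret seminorm_on c00 f by (rule f_seminorm)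
  have unit: "0 \<le> f (indicator {i})" for i
    by (rule nonneg) (simp add: c00_def indicator_def)
  fix s assume "s \<in> admissible_sums f x"
  then obtain k E where s_eq: "s = (\<Sum>j<k. f (restr (E j) x))" and E_admissible: "admissible k E"
    by (auto simp: admissible_sums_def)
  have finite_E: "finite (E j)" if "j < k" for j using E_admissible that by (simp add: admissible_def)
  have "s \<le> (\<Sum>j<k. \<Sum>i\<in>E j. \<bar>x i\<bar> * f (indicator {i}))"
    unfolding s_eq using finite_E by (intro sum_mono seminorm_on_c00_restr_le[OF f_seminorm]) auto
  also have "\<dots> = (\<Sum>i\<in>(\<Union>j<k. E j). \<bar>x i\<bar> * f (indicator {i}))"
    using finite_E admissible_disjoint[OF E_admissible] by (intro sum.UNION_disjoint[symmetric]) auto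
  also have "\<dots> = (\<Sum>i\<in>(\<Union>j<k. E j) \<inter> {i. x i \<noteq> 0}. \<bar>x i\<bar> * f (indicator {i}))"
    using finite_E by (intro sum.mono_neutral_right) auto
  also have "\<dots> \<le> (\<Sum>i | x i \<noteq> 0. \<bar>x i\<bar> * f (indicator {i}))"
    using x_mem unit by (intro sum_mono2) (auto simp: c00_def)
  finally show "s \<le> (\<Sum>i | x i \<noteq> 0. \<bar>x i\<bar> * f (indicator {i}))" .
qed

lemma admissible_sum_of_support_subset:
  assumes "f 0 = 0" "admissible k E" "j < k" "{i. x i \<noteq> 0} \<subseteq> E j"
  shows "(\<Sum>i<k. f (restr (E i) x)) = f x"
proof -
  have "f (restr (E i) x) = (if i = j then f x else 0)" if "i < k" for i
  proof (cases "i = j")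
    case True
    have "restr (E j) x = x" using assms(4) by (intro ext) (auto simp: restr_def)
    then show ?thesis using True by simp
  next
    case False
    then have "restr (E i) x = 0"
      using admissible_disjoint[OF assms(2) that assms(3)] assms(4) by (fastforce simp: restr_def)
    then show ?thesis using False assms(1) by simp
  qed
  then have "(\<Sum>i<k. f (restr (E i) x)) = (\<Sum>i<k. if i = j then f x else 0)"
    by (intro sum.cong) auto
  then show ?thesis using assms(3) by simp
qed

lemma tsirelson_eq_le:
  assumes f_tsirelson: "is_norm_on_c00 f" "tsirelson_eq f"
    and g_tsirelson: "is_norm_on_c00 g" "tsirelson_eq g"
  shows "x \<in> c00 \<Longrightarrow> f x \<le> g x"
proof (induction "card {i. x i \<noteq> 0}" arbitrary: x rule: less_induct)
  case less
  note x_mem = \<open>x \<in> c00\<close>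
  interpret f: seminorm_on c00 f using f_tsirelson(1) by (simp add: is_norm_on_c00_iff)
  interpret g: seminorm_on c00 g using g_tsirelson(1) by (simp add: is_norm_on_c00_iff)
  have f_eq: "f x = max (supnorm0 x) ((1/2) * Sup (admissible_sums f x))"
    and g_eq: "g x = max (supnorm0 x) ((1/2) * Sup (admissible_sums g x))"
    using f_tsirelson(2) g_tsirelson(2) x_mem by (simp_all add: tsirelson_eq_iff)
  have "Sup (admissible_sums f x) \<le> max (f x) (2 * g x)"
  proof (rule cSup_least[OF admissible_sums_nonempty])
    fix s assume "s \<in> admissible_sums f x"
    then obtain k E where s_eq: "s = (\<Sum>j<k. f (restr (E j) x))" and E_admissible: "admissible k E"
      by (auto simp: admissible_sums_def)
    show "s \<le> max (f x) (2 * g x)"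
    proof (cases "\<exists>j<k. {i. x i \<noteq> 0} \<subseteq> E j")
      case True
      then show ?thesis using admissible_sum_of_support_subset[of f k E _ x] f.zero E_admissible s_eq by auto
    next
      case False
      have "f (restr (E j) x) \<le> g (restr (E j) x)" if "j < k" for j
      proof (rule less.hyps)
        have "{i. restr (E j) x i \<noteq> 0} \<subset> {i. x i \<noteq> 0}"
          using False that by (auto simp: restr_def)
        then show "card {i. restr (E j) x i \<noteq> 0} < card {i. x i \<noteq> 0}"
          using x_mem by (intro psubset_card_mono) (auto simp: c00_def)
      qed (rule c00_restr[OF x_mem])
      then have "s \<le> (\<Sum>j<k. g (restr (E j) x))" unfolding s_eq by (intro sum_mono) auto
      also have "\<dots> \<le> Sup (admissible_sums g x)"
        using E_admissible
        by (intro cSup_upper bdd_above_admissible_sums[OF g.seminorm_on_axioms x_mem])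
          (auto simp: admissible_sums_def)
      also have "\<dots> \<le> 2 * g x" using g_eq by simp
      finally show ?thesis by simp
    qed
  qed
  moreover have "supnorm0 x \<le> g x" using g_eq by simp
  ultimately show ?case
    using f_eq f.nonneg[OF x_mem] g.nonneg[OF x_mem] by (auto simp: max_def split: if_splits)
qed

lemma tsirelson_norm_eq: "tsirelson_norm = c00_wnorm"
  unfolding tsirelson_norm_def
proof (rule the_equality)
  show "is_norm_on_c00 c00_wnorm \<and> tsirelson_eq c00_wnorm \<and> (\<forall>x. x \<notin> c00 \<longrightarrow> c00_wnorm x = 0)"
    by (simp add: is_norm_on_c00_c00_wnorm tsirelson_eq_c00_wnorm c00_wnorm_def)
  fix f assume f_tsirelson: "is_norm_on_c00 f \<and> tsirelson_eq f \<and> (\<forall>x. x \<notin> c00 \<longrightarrow> f x = 0)"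
  have "f x = c00_wnorm x" if "x \<in> c00" for x
    using tsirelson_eq_le[OF _ _ is_norm_on_c00_c00_wnorm tsirelson_eq_c00_wnorm that, of f]
      tsirelson_eq_le[OF is_norm_on_c00_c00_wnorm tsirelson_eq_c00_wnorm _ _ that, of f] f_tsirelson
    by (auto intro: antisym)
  then show "f = c00_wnorm" using f_tsirelson by (auto simp: fun_eq_iff c00_wnorm_def)
qed

section \<open>The spaces of the theorem as weighted spaces\<close>

lemma trunc_c00: "trunc m x \<in> c00"
  by (simp add: trunc_def c00_restr_finite)

lemma tsirelson_norm_trunc_diff:
  "tsirelson_norm (\<lambda>i. trunc n x i - trunc m x i) = wnorm norming (trunc n x - trunc m x)"
  using subspace_diff[OF subspace_c00 trunc_c00[of n x] trunc_c00[of m x]]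
  by (simp add: tsirelson_norm_eq c00_wnorm_def fun_diff_def)

lemma wspace_subset_T_space: "wspace norming \<subseteq> T_space"
proof
  fix x assume x_mem: "x \<in> wspace norming"
  have "\<exists>N. \<forall>m\<ge>N. \<forall>n\<ge>N. wnorm norming (trunc n x - trunc m x) < e" if e_pos: "0 < e" for e
  proof -
    obtain N where N_tail_less: "wnorm norming (restr {N..} x) < e"
      using eventually_happens'[OF sequentially_bot
          order_tendstoD(2)[OF norming.wnorm_tail_tendsto_0[OF x_mem] e_pos]] by blast
    have "wnorm norming (trunc n x - trunc m x) < e" if "N \<le> m" "N \<le> n" for m n
    proof -
      have "wnorm norming (trunc n x - trunc m x) \<le> wnorm norming (restr {N..} x)"
        using that by (intro norming.wnorm_mono norming.wspace_restr x_mem) (auto simp: trunc_def restr_def)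
      then show ?thesis using N_tail_less by simp
    qed
    then show ?thesis by blast
  qed
  then show "x \<in> T_space" by (simp add: T_space_def tsirelson_norm_trunc_diff)
qed

lemma T_space_subset_wspace: "T_space \<subseteq> wspace norming"
proof
  interpret seminorm_on "wspace norming" "wnorm norming" by (rule norming.seminorm_on_wnorm)
  have trunc_mem: "trunc m x \<in> wspace norming" for m x using trunc_c00 c00_subset_wspace by blast
  fix x assume "x \<in> T_space"
  then obtain N where N_Cauchy: "\<And>m n. N \<le> m \<Longrightarrow> N \<le> n \<Longrightarrow> wnorm norming (trunc n x - trunc m x) < 1"
    unfolding T_space_def tsirelson_norm_trunc_diff using zero_less_one by blast
  show "x \<in> wspace norming"
  proof (rule norming.wspaceI)
    fix \<phi> M assume \<phi>_mem: "\<phi> \<in> norming"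
    let ?n = "max M N"
    have "wsum \<phi> M x = wsum \<phi> M (trunc ?n x)"
      unfolding wsum_def by (intro sum.cong) (auto simp: trunc_def restr_def)
    also have "\<dots> \<le> wnorm norming (trunc ?n x)" by (rule norming.wsum_le_wnorm[OF trunc_mem \<phi>_mem])
    also have "\<dots> \<le> wnorm norming (trunc N x) + wnorm norming (trunc ?n x - trunc N x)"
      by (rule le_add_diff[OF trunc_mem trunc_mem])
    also have "\<dots> \<le> wnorm norming (trunc N x) + 1" using N_Cauchy[of N ?n] by simp
    finally show "wsum \<phi> M x \<le> wnorm norming (trunc N x) + 1" .
  qed
qed

lemma T_space_eq: "T_space = wspace norming"
  using wspace_subset_T_space T_space_subset_wspace by (rule subset_antisym[rotated])

lemma T_norm_eq:
  assumes x_mem: "x \<in> wspace norming"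
  shows "T_norm x = wnorm norming x"
proof -
  have "(\<lambda>m. wnorm norming (trunc m x)) \<longlonglongrightarrow> wnorm norming x"
  proof (rule order_tendstoI)
    show "\<forall>\<^sub>F m in sequentially. a < wnorm norming (trunc m x)" if "a < wnorm norming x" for a
      using norming.eventually_less_wnorm_restr[OF x_mem, of a UNIV] that by (simp add: trunc_def)
    have "wnorm norming (trunc m x) \<le> wnorm norming x" for m
      by (intro norming.wnorm_mono x_mem) (auto simp: trunc_def restr_def)
    then show "\<forall>\<^sub>F m in sequentially. wnorm norming (trunc m x) < a" if "wnorm norming x < a" for a
      using that by (auto intro!: always_eventually intro: le_less_trans)
  qed
  then show ?thesis
    unfolding T_norm_def by (simp add: tsirelson_norm_eq c00_wnorm_eq trunc_c00 limI)
qed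

lemma Tp_eq: "Tp p = pspace norming p"
  by (simp add: Tp_def T_space_eq pspace_def abs_powr_def)

lemma Tp_dist_eq:
  assumes "1 \<le> p" "x \<in> Tp p" "y \<in> Tp p"
  shows "Tp_dist p x y = pnorm norming p (x - y)"
proof -
  have "x - y \<in> pspace norming p"
    using assms seminorm_on.mem_diff[OF norming.seminorm_on_pnorm] by (simp add: Tp_eq)
  then have "T_norm (abs_powr p (x - y)) = wnorm norming (abs_powr p (x - y))"
    by (simp add: T_norm_eq pspace_def)
  then show ?thesis
    by (simp add: Tp_dist_def Tp_norm_def pnorm_def abs_powr_def)
qed

interpretation one: tsirelson_weights "{\<lambda>_. 1}"
proof
  fix k E and \<phi>s :: "nat \<Rightarrow> nat \<Rightarrow> real"
  assume "admissible k E" "\<And>j. j < k \<Longrightarrow> \<phi>s j \<in> {\<lambda>_. 1}"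
  then have "(1/2) * (\<Sum>j<k. restr (E j) (\<phi>s j) i) \<le> 1" for i
    using sum_restr_admissible_le[of k E \<phi>s i 1] by simp
  then show "\<exists>\<psi>\<in>{\<lambda>_. 1}. \<forall>i. (1/2) * (\<Sum>j<k. restr (E j) (\<phi>s j) i) \<le> \<psi> i" by simp
qed auto

lemma wspace_one: "wspace {\<lambda>_. 1} = {x. summable (\<lambda>i. \<bar>x i\<bar>)}"
proof (intro set_eqI iffI)
  fix x assume "x \<in> wspace {\<lambda>_. 1}"
  then have "(\<Sum>i<M. \<bar>x i\<bar>) \<le> wnorm {\<lambda>_. 1} x" for M
    using one.wsum_le_wnorm[of x "\<lambda>_. 1" M] by (simp add: wsum_def)
  then have "summable (\<lambda>i. \<bar>x i\<bar>)"
    by (intro summableI_nonneg_bounded[where x = "wnorm {\<lambda>_. 1} x"]) auto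
  then show "x \<in> {x. summable (\<lambda>i. \<bar>x i\<bar>)}" by simp
next
  fix x :: "nat \<Rightarrow> real" assume "x \<in> {x. summable (\<lambda>i. \<bar>x i\<bar>)}"
  then show "x \<in> wspace {\<lambda>_. 1}"
    by (intro one.wspaceI[where A = "\<Sum>i. \<bar>x i\<bar>"]) (auto simp: wsum_def intro!: sum_le_suminf)
qed

lemma wnorm_one:
  assumes "summable (\<lambda>i. \<bar>x i\<bar>)"
  shows "wnorm {\<lambda>_. 1} x = (\<Sum>i. \<bar>x i\<bar>)"
proof (rule antisym)
  show "wnorm {\<lambda>_. 1} x \<le> (\<Sum>i. \<bar>x i\<bar>)"
    using assms by (intro one.wnorm_least) (auto simp: wsum_def intro!: sum_le_suminf)
  show "(\<Sum>i. \<bar>x i\<bar>) \<le> wnorm {\<lambda>_. 1} x"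
    using assms one.wsum_le_wnorm[of x "\<lambda>_. 1"]
    by (intro suminf_le_const) (simp_all add: wsum_def wspace_one)
qed

lemma lp_eq: "lp p = pspace {\<lambda>_. 1} p"
  by (simp add: lp_def pspace_def wspace_one)

lemma lp_dist_eq:
  assumes "1 \<le> p" "x \<in> lp p" "y \<in> lp p"
  shows "lp_dist p x y = pnorm {\<lambda>_. 1} p (x - y)"
proof -
  have "x - y \<in> pspace {\<lambda>_. 1} p"
    using assms seminorm_on.mem_diff[OF one.seminorm_on_pnorm] by (simp add: lp_eq)
  then have "wnorm {\<lambda>_. 1} (abs_powr p (x - y)) = (\<Sum>i. \<bar>abs_powr p (x - y) i\<bar>)"
    by (intro wnorm_one) (simp add: pspace_def wspace_one)
  then show ?thesis by (simp add: lp_dist_def pnorm_def)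
qed

lemma dsum_subset_dspace: "dsum n ps \<subseteq> dspace norming ps {..<n}"
  by (auto simp: dsum_def dspace_def Tp_eq)

lemma dsum_dist_eq:
  assumes "\<And>i. i < n \<Longrightarrow> 1 \<le> ps i" "x \<in> dsum n ps" "y \<in> dsum n ps"
  shows "dsum_dist n ps x y = dnorm norming ps {..<n} (x - y)"
  unfolding dsum_dist_def dnorm_def using assms by (intro sum.cong) (auto simp: dsum_def Tp_dist_eq)

section \<open>The theorem\<close>

lemma coarse_lipschitz_embedsE:
  assumes "coarse_lipschitz_embeds A dA B dB" "\<And>x y. x \<in> A \<Longrightarrow> y \<in> A \<Longrightarrow> 0 \<le> dA x y"
  obtains f L where "f ` A \<subseteq> B" "0 < L"
    "\<And>x y. x \<in> A \<Longrightarrow> y \<in> A \<Longrightarrow> dB (f x) (f y) \<le> L * dA x y + L"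
    "\<And>x y. x \<in> A \<Longrightarrow> y \<in> A \<Longrightarrow> dA x y / L - L \<le> dB (f x) (f y)"
  using assms unfolding coarse_lipschitz_embeds_def by (metis order_refl)

lemma coarse_lipschitz_embeds_isometry:
  assumes "coarse_lipschitz_embeds A dA B dB" "h ` B \<subseteq> C"
    and "\<And>x y. x \<in> B \<Longrightarrow> y \<in> B \<Longrightarrow> dC (h x) (h y) = dB x y"
  shows "coarse_lipschitz_embeds A dA C dC"
proof -
  obtain f L where f_range: "f ` A \<subseteq> B" and L_bounds: "0 < L"
    "\<forall>t\<ge>0. \<forall>x\<in>A. \<forall>y\<in>A. dA x y \<le> t \<longrightarrow> dB (f x) (f y) \<le> L * t + L"
    "\<forall>t\<ge>0. \<forall>x\<in>A. \<forall>y\<in>A. t \<le> dA x y \<longrightarrow> t / L - L \<le> dB (f x) (f y)"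
    using assms(1) unfolding coarse_lipschitz_embeds_def by blast
  have "dC (h (f x)) (h (f y)) = dB (f x) (f y)" if "x \<in> A" "y \<in> A" for x y
    using f_range that by (intro assms(3)) auto
  moreover have "(h \<circ> f) ` A \<subseteq> C" using f_range assms(2) by fastforce
  ultimately show ?thesis
    unfolding coarse_lipschitz_embeds_def using L_bounds by (intro exI[of _ "h \<circ> f"] exI[of _ L]) simp
qed

lemma coarse_lipschitz_embeds_dsum_singleton:
  assumes "coarse_lipschitz_embeds A dA (Tp q) (Tp_dist q)"
  shows "coarse_lipschitz_embeds A dA (dsum 1 (\<lambda>_. q)) (dsum_dist 1 (\<lambda>_. q))"
  by (rule coarse_lipschitz_embeds_isometry[OF assms, where h = "\<lambda>x i. if i = 0 then x else (\<lambda>_. 0)"])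
    (auto simp: dsum_def dsum_dist_def)

lemma not_coarse_lipschitz_embeds_dsum:
  assumes K_weights: "tsirelson_weights K" and p_ge_1: "1 \<le> p"
    and exponents: "\<And>i. i < n \<Longrightarrow> 1 \<le> ps i" "\<And>i. i < n \<Longrightarrow> ps i \<noteq> p"
    and A_eq: "A = pspace K p" and dA_eq: "\<And>x y. x \<in> A \<Longrightarrow> y \<in> A \<Longrightarrow> dA x y = pnorm K p (x - y)"
  shows "\<not> coarse_lipschitz_embeds A dA (dsum n ps) (dsum_dist n ps)"
proof
  assume "coarse_lipschitz_embeds A dA (dsum n ps) (dsum_dist n ps)"
  then obtain f L where f_range: "f ` A \<subseteq> dsum n ps" and L_pos: "0 < L"
    and upper: "\<And>x y. x \<in> A \<Longrightarrow> y \<in> A \<Longrightarrow> dsum_dist n ps (f x) (f y) \<le> L * dA x y + L"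
    and lower: "\<And>x y. x \<in> A \<Longrightarrow> y \<in> A \<Longrightarrow> dA x y / L - L \<le> dsum_dist n ps (f x) (f y)"
    by (rule coarse_lipschitz_embedsE) (auto simp: dA_eq)
  have dist: "dsum_dist n ps (f x) (f y) = dnorm norming ps {..<n} (f x - f y)" if "x \<in> A" "y \<in> A" for x y
    using f_range that by (intro dsum_dist_eq exponents) auto
  have "coarse_lipschitz_on (pspace K p) (pnorm K p) (dspace norming ps {..<n}) (dnorm norming ps {..<n}) L f"
    using order_trans[OF f_range dsum_subset_dspace] upper
    by (simp add: coarse_lipschitz_on_def dist dA_eq flip: A_eq)
  then have "coarse_lipschitz_dsum K norming p L ps {..<n} f"
    using K_weights p_ge_1 exponents(1) L_pos
    by (intro coarse_lipschitz_dsum.intro coarse_lipschitz_dsum_axioms.intro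
        norming.tsirelson_weights_axioms) auto
  then obtain x y where xy_mem: "x \<in> A" "y \<in> A"
    and "dnorm norming ps {..<n} (f x - f y) < pnorm K p (x - y) / L - L"
    using coarse_lipschitz_dsum.ex_coarse_lower_bound_violated exponents(2) A_eq by blast
  then show False using lower[OF xy_mem] by (simp add: dist dA_eq)
qed

lemma increasing_exponents_ge_1:
  fixes ps :: "nat \<Rightarrow> real"
  assumes "1 \<le> ps 0" "\<forall>i. Suc i < n \<longrightarrow> ps i < ps (Suc i)" "i < n"
  shows "1 \<le> ps i"
  using assms(3)
proof (induction i)
  case (Suc i)
  then have "1 \<le> ps i" "ps i < ps (Suc i)" using assms(2) by auto
  then show ?case by simp
qed (rule assms(1))

theorem theorem1p3:
  fixes n :: nat and ps :: "nat \<Rightarrow> real" and p :: real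
  assumes "1 \<le> n"
    and "1 \<le> ps 0"
    and "\<forall>i. Suc i < n \<longrightarrow> ps i < ps (Suc i)"
    and "1 \<le> p"
    and "\<forall>i<n. p \<noteq> ps i"
  shows "\<not> coarse_lipschitz_embeds (Tp p) (Tp_dist p) (dsum n ps) (dsum_dist n ps)
       \<and> \<not> coarse_lipschitz_embeds (lp p) (lp_dist p) (dsum n ps) (dsum_dist n ps)
       \<and> (\<forall>p' q :: real. 1 \<le> p' \<and> 1 \<le> q \<and> p' \<noteq> q \<longrightarrow>
            \<not> coarse_lipschitz_embeds (Tp p') (Tp_dist p') (Tp q) (Tp_dist q))"
proof (intro conjI allI impI)
  have Tp_case: "\<not> coarse_lipschitz_embeds (Tp p) (Tp_dist p) (dsum n ps) (dsum_dist n ps)"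
    if "1 \<le> p" "\<And>i. i < n \<Longrightarrow> 1 \<le> ps i" "\<And>i. i < n \<Longrightarrow> ps i \<noteq> p" for p n ps
    by (rule not_coarse_lipschitz_embeds_dsum[OF norming.tsirelson_weights_axioms that
          Tp_eq Tp_dist_eq[OF that(1)]])
  have exponents_ge_1: "1 \<le> ps i" if "i < n" for i using assms(2,3) that by (rule increasing_exponents_ge_1)
  have exponents_neq: "ps i \<noteq> p" if "i < n" for i using assms(5) that by auto
  show "\<not> coarse_lipschitz_embeds (Tp p) (Tp_dist p) (dsum n ps) (dsum_dist n ps)"
    by (rule Tp_case[OF assms(4) exponents_ge_1 exponents_neq])
  show "\<not> coarse_lipschitz_embeds (lp p) (lp_dist p) (dsum n ps) (dsum_dist n ps)"
    by (rule not_coarse_lipschitz_embeds_dsum[OF one.tsirelson_weights_axioms assms(4)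
          exponents_ge_1 exponents_neq lp_eq lp_dist_eq[OF assms(4)]])
  show "\<not> coarse_lipschitz_embeds (Tp p') (Tp_dist p') (Tp q) (Tp_dist q)"
    if "1 \<le> p' \<and> 1 \<le> q \<and> p' \<noteq> q" for p' q
    using Tp_case[of p' 1 "\<lambda>_. q"] coarse_lipschitz_embeds_dsum_singleton that by auto
qed

end
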